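(* Let $D(s)=\sum_{n=1}^{\infty}a_n n^{-s}$ be a Dirichlet series with periodic coefficients, i.e. there is $q\in\mathbb{N}$ with $a_{n+q}=a_n$ for all $n\geq1$. Let $\alpha\in\mathbb{C}$ with $\mathrm{Re}\,\alpha\geq1$. Then $D(s+\alpha)$ is cyclic in $\mathcal{H}^2$ if and only if $a_1\neq0$ and $D$ has no zeros in $\mathbb{C}_{\mathrm{Re}\,\alpha}$.
   Context: $\mathcal{H}^2$ is the Hilbert space of Dirichlet series $\sum_{n\ge1}b_nn^{-s}$ with $\sum|b_n|^2<\infty$ (norm squared $\sum|b_n|^2$); its elements are holomorphic on $\mathbb{C}_{1/2}$, where $\mathbb{C}_\sigma=\{s\in\mathbb{C}:\mathrm{Re}\,s>\sigma\}$. $\mathcal{H}^\infty$ denotes the set of Dirichlet series (in $\mathcal{H}^2$) that extend to bounded holomorphic functions on $\mathbb{C}_0$; it is the multiplier algebra of $\mathcal{H}^2$. An element $F\in\mathcal{H}^2$ is cyclic if the closure in $\mathcal{H}^2$ of $\{hF:h\in\mathcal{H}^\infty\}$ is all of $\mathcal{H}^2$. The constant term of $D$ is $a_1$. *)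

theory Defs
  imports "HOL-Complex_Analysis.Complex_Analysis"
begin

text \<open>A Dirichlet series \<open>\<Sum>n\<ge>1. b n * n^(-s)\<close> is represented by its coefficient
function \<open>b :: nat \<Rightarrow> complex\<close>; the value \<open>b 0\<close> is ignored throughout.\<close>

definition dirichlet_eval :: "(nat \<Rightarrow> complex) \<Rightarrow> complex \<Rightarrow> complex" where
  "dirichlet_eval b s = (\<Sum>\<^sub>\<infinity>n\<in>{1..}. b n / (of_nat n) powr s)"

definition H2 :: "(nat \<Rightarrow> complex) set" where
  "H2 = {b. (\<lambda>n. (cmod (b n))^2) summable_on {1..}}"

definition h2_norm :: "(nat \<Rightarrow> complex) \<Rightarrow> real" where
  "h2_norm b = sqrt (\<Sum>\<^sub>\<infinity>n\<in>{1..}. (cmod (b n))^2)"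

text \<open>Product of Dirichlet series = Dirichlet convolution of coefficients.\<close>
definition dconv :: "(nat \<Rightarrow> complex) \<Rightarrow> (nat \<Rightarrow> complex) \<Rightarrow> nat \<Rightarrow> complex" where
  "dconv f g n = (\<Sum>d\<in>{d. d dvd n}. f d * g (n div d))"

definition Hinf :: "(nat \<Rightarrow> complex) set" where
  "Hinf = {b. b \<in> H2 \<and> (\<exists>F. F holomorphic_on {s. Re s > 0} \<and> bounded (F ` {s. Re s > 0})
                \<and> (\<forall>s. Re s > 1/2 \<longrightarrow> F s = dirichlet_eval b s))}"

definition cyclic_H2 :: "(nat \<Rightarrow> complex) \<Rightarrow> bool" where
  "cyclic_H2 F \<longleftrightarrow> F \<in> H2 \<and>
     (\<forall>G\<in>H2. \<forall>\<epsilon>>0. \<exists>h\<in>Hinf. dconv h F \<in> H2 \<and> h2_norm (\<lambda>n. G n - dconv h F n) < \<epsilon>)"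

end

theory Submission
  imports Defs "HOL-Number_Theory.Number_Theory" "HOL-Real_Asymp.Real_Asymp"
begin

text \<open>
  Put \<open>f n = a n / n powr \<alpha>\<close> and let \<open>F\<close> be its Dirichlet series on \<open>Re s > 0\<close>.

  Necessity: evaluating at a completely multiplicative function supported on finitely many primes, with
  values of modulus \<open>< 1\<close> there, is bounded on \<open>H2\<close> and multiplicative, so a cyclic \<open>f\<close> has non-zero
  values at all such points. In particular the partial sums of \<open>F\<close> over \<open>N\<close>-smooth integers do not vanish,
  and by Hurwitz' theorem neither does \<open>F\<close>.

  Sufficiency: the Borel-Caratheodory inequality bounds \<open>1 / F (s + \<delta>)\<close> on \<open>Re s > 0\<close>, and mean values on
  vertical lines show that its Dirichlet coefficients are square summable, so these are multipliers. If \<open>F\<close>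
  converges absolutely slightly to the left of \<open>Re s = 0\<close> (always the case for \<open>Re \<alpha> > 1\<close>), dividing out
  the zeros of \<open>F\<close> near that line, none of which lies to its right, shows \<open>|F s| \<le> C |F (s + \<delta>)|\<close> with \<open>C\<close>
  independent of \<open>\<delta>\<close>. Thus \<open>F / F (\<cdot> + \<delta>)\<close> is bounded in \<open>H2\<close> and tends to \<open>1\<close> coefficientwise.

  For \<open>Re \<alpha> = 1\<close>, let \<open>c\<close> be a residue class prime to \<open>q\<close> whose primes have divergent reciprocal sum. Moving
  the values at these primes turns the non-vanishing of \<open>F\<close> into the non-vanishing of an exponential
  sum with frequencies at the roots of unity; a zero-free function of exponential type is a
  single exponential, and this forces \<open>a (c * n) = l * a n\<close> for all \<open>n\<close>. These classes generate
  all classes prime to \<open>q\<close>, by comparing harmonic sums over two cosets of equal density. Hence \<open>F\<close> is the product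
  of a zero-free series over \<open>q\<close>-smooth integers, to which the previous argument applies, and of an Euler
  product, whose factors are removed one by one.
\<close>

section \<open>The space H2 and Dirichlet convolution\<close>

text \<open>The obstacle is the line \<open>Re \<alpha> = 1\<close>. Comparing the series with its
  translates needs room to the left of \<open>Re s = 0\<close>, because zeros on or near that line
  must be counted in discs that cross it, and for \<open>Re \<alpha> = 1\<close> this room is
  missing. Restricting to \<open>q\<close>-smooth integers restores it: they are so sparse that
  their series still converges absolutely at \<open>Re s = -1/2\<close>. The remaining primes must
  then enter as exact Euler factors, which is a statement about \<open>a\<close> alone. To prove it,
  non-vanishing is used at all finitely supported points of the polydisc, since coordinates at
  different primes have to be moved independently. Classes whose primes have convergent reciprocal
  sum escape this argument, but their primes are sparse enough for a density comparison to reach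
  them. Two points on convergence: bounded coefficientwise convergence in \<open>H2\<close> is only
  weak, so averages are taken to reach norm convergence; and the multipliers inverting the smooth
  part are absolutely summable, so the error of removing only finitely many Euler factors can be
  chosen after the multiplier.\<close>

lemma nonneg_partial_sums_bounded:
  fixes g :: "nat \<Rightarrow> real"
  assumes "\<And>n. n \<ge> 1 \<Longrightarrow> g n \<ge> 0" and "\<And>N. (\<Sum>n=1..N. g n) \<le> C"
  shows "g summable_on {1..}" and "infsum g {1..} \<le> C"
proof -
  have fin: "sum g A \<le> C" if "finite A" "A \<subseteq> {1..}" for A
  proof -
    have "sum g A \<le> (\<Sum>n=1..Max (insert 1 A). g n)"
      using that assms(1) by (intro sum_mono2) auto
    then show ?thesis using assms(2) order_trans by blast
  qed
  show s: "g summable_on {1..}"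
    by (rule nonneg_bdd_above_summable_on) (use assms(1) fin in \<open>auto intro!: bdd_aboveI[of _ C]\<close>)
  show "infsum g {1..} \<le> C"
    by (rule infsum_le_finite_sums[OF s]) (use fin in auto)
qed

lemma partial_sum_le_infsum:
  fixes g :: "nat \<Rightarrow> real"
  assumes "\<And>n. n \<ge> 1 \<Longrightarrow> g n \<ge> 0" "g summable_on {1..}"
  shows "(\<Sum>n=1..N. g n) \<le> infsum g {1..}"
  using finite_sum_le_infsum[OF assms(2), of "{1..N}"] assms(1) by auto

lemma H2_I:
  assumes "\<And>N. (\<Sum>n=1..N. (cmod (x n))\<^sup>2) \<le> C\<^sup>2" "C \<ge> 0"
  shows "x \<in> H2" and "h2_norm x \<le> C"
proof -
  have "(\<lambda>n. (cmod (x n))\<^sup>2) summable_on {1..}" "infsum (\<lambda>n. (cmod (x n))\<^sup>2) {1..} \<le> C\<^sup>2"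
    using nonneg_partial_sums_bounded[of "\<lambda>n. (cmod (x n))\<^sup>2" "C\<^sup>2"] assms(1) by simp_all
  then show "x \<in> H2" and "h2_norm x \<le> C"
    unfolding H2_def h2_norm_def using assms(2) by (simp_all add: real_le_lsqrt)
qed

lemma h2_norm_nonneg: "h2_norm x \<ge> 0"
  by (auto simp: h2_norm_def intro!: infsum_nonneg)

lemma h2_norm_partial:
  assumes "x \<in> H2"
  shows "(\<Sum>n=1..N. (cmod (x n))\<^sup>2) \<le> (h2_norm x)\<^sup>2"
  using partial_sum_le_infsum[of "\<lambda>n. (cmod (x n))\<^sup>2" N] assms
  by (auto simp: H2_def h2_norm_def infsum_nonneg)

lemma h2_norm_coeff:
  assumes "x \<in> H2" "n \<ge> 1"
  shows "cmod (x n) \<le> h2_norm x"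
proof -
  have "(cmod (x n))\<^sup>2 \<le> (\<Sum>n=1..n. (cmod (x n))\<^sup>2)"
    using assms(2) by (intro member_le_sum) auto
  also have "\<dots> \<le> (h2_norm x)\<^sup>2" by (rule h2_norm_partial[OF assms(1)])
  finally show ?thesis using h2_norm_nonneg power2_le_imp_le by blast
qed

lemma H2_cong:
  assumes "\<And>n. n \<ge> 1 \<Longrightarrow> x n = y n"
  shows "x \<in> H2 \<longleftrightarrow> y \<in> H2" "h2_norm x = h2_norm y"
proof -
  show "x \<in> H2 \<longleftrightarrow> y \<in> H2"
    unfolding H2_def mem_Collect_eq by (rule summable_on_cong) (use assms in auto)
  show "h2_norm x = h2_norm y"
    unfolding h2_norm_def by (rule arg_cong[of _ _ sqrt], rule infsum_cong) (use assms in auto)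
qed

lemma H2_add:
  assumes "x \<in> H2" "y \<in> H2"
  shows "(\<lambda>n. x n + y n) \<in> H2" and "h2_norm (\<lambda>n. x n + y n) \<le> h2_norm x + h2_norm y"
proof -
  have "(\<Sum>n=1..N. (cmod (x n + y n))\<^sup>2) \<le> (h2_norm x + h2_norm y)\<^sup>2" for N
  proof -
    have "sqrt (\<Sum>n=1..N. (cmod (x n + y n))\<^sup>2) \<le> sqrt (\<Sum>n=1..N. (cmod (x n) + cmod (y n))\<^sup>2)"
      by (intro real_sqrt_le_mono sum_mono power_mono norm_triangle_ineq) auto
    also have "\<dots> \<le> sqrt (\<Sum>n=1..N. (cmod (x n))\<^sup>2) + sqrt (\<Sum>n=1..N. (cmod (y n))\<^sup>2)"
      using L2_set_triangle_ineq[of "\<lambda>n. cmod (x n)" "\<lambda>n. cmod (y n)" "{1..N}"] by (simp add: L2_set_def)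
    also have "\<dots> \<le> h2_norm x + h2_norm y"
      by (intro add_mono real_le_lsqrt h2_norm_partial assms h2_norm_nonneg)
    finally show ?thesis
      using sqrt_le_D by blast
  qed
  then show "(\<lambda>n. x n + y n) \<in> H2" "h2_norm (\<lambda>n. x n + y n) \<le> h2_norm x + h2_norm y"
    using H2_I[of "\<lambda>n. x n + y n" "h2_norm x + h2_norm y"] h2_norm_nonneg by auto
qed

lemma H2_scale:
  assumes "x \<in> H2"
  shows "(\<lambda>n. c * x n) \<in> H2" and "h2_norm (\<lambda>n. c * x n) \<le> cmod c * h2_norm x"
proof -
  have "(\<Sum>n=1..N. (cmod (c * x n))\<^sup>2) \<le> (cmod c * h2_norm x)\<^sup>2" for N
    using mult_left_mono[OF h2_norm_partial[OF assms, of N], of "(cmod c)\<^sup>2"]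
    by (simp add: norm_mult power_mult_distrib sum_distrib_left)
  then show "(\<lambda>n. c * x n) \<in> H2" and "h2_norm (\<lambda>n. c * x n) \<le> cmod c * h2_norm x"
    using H2_I[of "\<lambda>n. c * x n" "cmod c * h2_norm x"] h2_norm_nonneg by auto
qed

lemma H2_diff:
  assumes "x \<in> H2" "y \<in> H2"
  shows "(\<lambda>n. x n - y n) \<in> H2" and "h2_norm (\<lambda>n. x n - y n) \<le> h2_norm x + h2_norm y"
  using H2_add[OF assms(1) H2_scale(1)[OF assms(2), of "-1"]] H2_scale(2)[OF assms(2), of "-1"] by auto

lemma H2_cauchy_schwarz:
  assumes "x \<in> H2" "y \<in> H2"
  shows "(\<lambda>n. cmod (x n * y n)) summable_on {1..}"
    and "infsum (\<lambda>n. cmod (x n * y n)) {1..} \<le> h2_norm x * h2_norm y"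
proof -
  have "(\<Sum>n=1..N. cmod (x n * y n)) \<le> h2_norm x * h2_norm y" for N
  proof -
    have "(\<Sum>n=1..N. cmod (x n * y n)) \<le> sqrt (\<Sum>n=1..N. (cmod (x n))\<^sup>2) * sqrt (\<Sum>n=1..N. (cmod (y n))\<^sup>2)"
      using L2_set_mult_ineq[of "\<lambda>n. cmod (x n)" "\<lambda>n. cmod (y n)" "{1..N}"] by (simp add: L2_set_def norm_mult)
    also have "\<dots> \<le> h2_norm x * h2_norm y"
      by (intro mult_mono real_le_lsqrt h2_norm_partial assms h2_norm_nonneg) (auto intro: sum_nonneg)
    finally show ?thesis .
  qed
  then show "(\<lambda>n. cmod (x n * y n)) summable_on {1..}"
    "infsum (\<lambda>n. cmod (x n * y n)) {1..} \<le> h2_norm x * h2_norm y"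
    using nonneg_partial_sums_bounded[of "\<lambda>n. cmod (x n * y n)"] by auto
qed

section \<open>Absolutely summable coefficients: an algebra under convolution, acting on
  \<open>H2\<close>\<close>

definition l1 :: "(nat \<Rightarrow> complex) \<Rightarrow> bool" where
  "l1 f \<longleftrightarrow> (\<lambda>n. cmod (f n)) summable_on {1..}"

lemma l1_summable: "l1 f \<Longrightarrow> f summable_on {1..}"
  unfolding l1_def by (rule abs_summable_summable)

lemma l1_cong: "(\<And>n. n \<ge> 1 \<Longrightarrow> f n = g n) \<Longrightarrow> l1 f \<longleftrightarrow> l1 g"
  unfolding l1_def by (rule summable_on_cong) auto

lemma l1_dominated:
  assumes "l1 g" "\<And>n. n \<ge> 1 \<Longrightarrow> cmod (f n) \<le> cmod (g n)"
  shows "l1 f"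
  using assms(1) unfolding l1_def
  by (rule Infinite_Sum.abs_summable_on_comparison_test') (use assms(2) in auto)

lemma divisor_pos:
  fixes n d :: nat
  assumes "n \<ge> 1" "d dvd n"
  shows "d \<ge> 1" "n div d \<ge> 1"
  using assms by (auto elim!: dvdE simp: Suc_le_eq)

lemma bij_betw_divisor_pairs:
  "bij_betw (\<lambda>(n, d). (d, n div d)) (Sigma {1..} (\<lambda>n. {d. d dvd n})) ({1..} \<times> {1::nat..})"
  by (rule bij_betwI[where g = "\<lambda>(d, e). (d * e, d)"])
     (use divisor_pos in \<open>auto simp: Suc_le_eq\<close>)

text \<open>Absolute convergence allows the double sum over \<open>(d, e)\<close> to be regrouped
  along \<open>n = d * e\<close>. Multiplicativity of all evaluations, on half-planes and at points
  of the polydisc, is this identity for twisted coefficients.\<close>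

lemma infsum_dconv:
  assumes "l1 u" "l1 v"
  shows "l1 (dconv u v)" and "infsum (dconv u v) {1..} = infsum u {1..} * infsum v {1..}"
proof -
  let ?S = "Sigma {1::nat..} (\<lambda>n. {d. d dvd n})"
  have ab: "(\<lambda>x. norm (case x of (d, e) \<Rightarrow> u d * v e)) summable_on ({1..} \<times> {1..})"
  proof (subst Infinite_Sum.abs_summable_on_Sigma_iff, intro conjI ballI)
    show "(\<lambda>y. norm (case (x, y) of (d, e) \<Rightarrow> u d * v e)) summable_on {1..}" for x
      using assms(2) unfolding l1_def prod.case norm_mult by (rule summable_on_cmult_right)
    have "norm (\<Sum>\<^sub>\<infinity>y\<in>{1..}. norm (case (x, y) of (d, e) \<Rightarrow> u d * v e)) =
      norm (u x) * (\<Sum>\<^sub>\<infinity>y\<in>{1..}. norm (v y))" for x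
      unfolding prod.case norm_mult infsum_cmult_right' by (simp add: infsum_nonneg abs_mult)
    then show "(\<lambda>x. norm (\<Sum>\<^sub>\<infinity>y\<in>{1..}. norm (case (x, y) of (d, e) \<Rightarrow> u d * v e))) summable_on {1..}"
      using assms(1) unfolding l1_def by (simp only: summable_on_cmult_left)
  qed
  have ab': "(\<lambda>(n, d). norm (u d * v (n div d))) summable_on ?S"
    using summable_on_reindex_bij_betw[OF bij_betw_divisor_pairs, of "\<lambda>x. norm (case x of (d, e) \<Rightarrow> u d * v e)"] ab
    by (simp add: case_prod_unfold)
  have fin: "finite {d. d dvd n}" if "n \<ge> 1" for n :: nat using that by auto
  have s: "(\<lambda>n. \<Sum>\<^sub>\<infinity>d\<in>{d. d dvd n}. norm (u d * v (n div d))) summable_on {1..}"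
    using summable_on_Sigma_banach[OF ab'] by simp
  have "(\<lambda>n. \<Sum>d\<in>{d. d dvd n}. norm (u d * v (n div d))) summable_on {1..}"
    by (rule summable_on_cong[THEN iffD1, OF _ s]) (use fin in auto)
  then show "l1 (dconv u v)" unfolding l1_def dconv_def
    by (rule Infinite_Sum.abs_summable_on_comparison_test') (auto intro!: order_trans[OF norm_sum])
  have sc: "(\<lambda>(n, d). u d * v (n div d)) summable_on ?S"
    using abs_summable_summable[of "\<lambda>(n, d). u d * v (n div d)" ?S] ab' by (simp add: case_prod_unfold)
  have "infsum (dconv u v) {1..} = (\<Sum>\<^sub>\<infinity>n\<in>{1..}. \<Sum>\<^sub>\<infinity>d\<in>{d. d dvd n}. u d * v (n div d))"
    unfolding dconv_def by (rule infsum_cong) (use fin in auto)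
  also have "\<dots> = (\<Sum>\<^sub>\<infinity>(n, d)\<in>?S. u d * v (n div d))"
    using infsum_Sigma'_banach[OF sc] .
  also have "\<dots> = (\<Sum>\<^sub>\<infinity>(d, e)\<in>{1..} \<times> {1..}. u d * v e)"
    using infsum_reindex_bij_betw[OF bij_betw_divisor_pairs, of "\<lambda>(d, e). u d * v e"]
    by (simp add: case_prod_unfold)
  also have "\<dots> = infsum u {1..} * infsum v {1..}"
    using infsum_Sigma'_banach[OF abs_summable_summable[OF ab]]
    by (simp add: infsum_cmult_right' infsum_cmult_left')
  finally show "infsum (dconv u v) {1..} = infsum u {1..} * infsum v {1..}" .
qed

text \<open>Young's inequality for the multiplicative semigroup. Writing \<open>cmod (h d)\<close>
  as a product of two square roots, Cauchy-Schwarz bounds the squared convolution by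
  \<open>?K\<close> times the convolution \<open>w\<close> of \<open>cmod h\<close> with the squares
  of \<open>cmod x\<close>; summing \<open>w\<close> gives the second factor
  \<open>?K\<close>.\<close>

lemma dconv_l1_H2:
  assumes "l1 h" "x \<in> H2"
  shows "dconv h x \<in> H2" and "h2_norm (dconv h x) \<le> infsum (\<lambda>n. cmod (h n)) {1..} * h2_norm x"
proof -
  let ?K = "infsum (\<lambda>n. cmod (h n)) {1..}"
  define h' where "h' n = complex_of_real (cmod (h n))" for n
  define x' where "x' n = complex_of_real ((cmod (x n))\<^sup>2)" for n
  have l: "l1 h'" "l1 x'" using assms by (auto simp: l1_def h'_def x'_def H2_def norm_power)
  have K0: "?K \<ge> 0" by (rule infsum_nonneg) auto
  have ih: "infsum h' {1..} = ?K"
    unfolding h'_def using assms(1) by (intro infsumI has_sum_of_real) (simp add: l1_def)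
  have ix: "infsum x' {1..} = (h2_norm x)\<^sup>2"
    unfolding x'_def using assms(2)
    by (intro infsumI has_sum_of_real) (simp add: H2_def h2_norm_def infsum_nonneg)
  define w where "w n = (\<Sum>d\<in>{d. d dvd n}. cmod (h d) * (cmod (x (n div d)))\<^sup>2)" for n
  have w: "dconv h' x' n = of_real (w n)" for n
    by (simp add: dconv_def h'_def x'_def w_def)
  have wn: "w n \<ge> 0" for n by (simp add: w_def sum_nonneg)
  have ws: "w summable_on {1..}"
    using infsum_dconv(1)[OF l] wn by (simp add: l1_def w)
  have "of_real (infsum w {1..}) = infsum (dconv h' x') {1..}"
    unfolding w[abs_def] by (rule infsumI[symmetric], rule has_sum_of_real) (rule has_sum_infsum[OF ws])
  also have "\<dots> = of_real (?K * (h2_norm x)\<^sup>2)" using infsum_dconv(2)[OF l] ih ix by simp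
  finally have wi: "infsum w {1..} = ?K * (h2_norm x)\<^sup>2" using of_real_eq_iff by (simp only: of_real_eq_iff)
  have pt: "(cmod (dconv h x n))\<^sup>2 \<le> ?K * w n" if n: "n \<ge> 1" for n
  proof -
    let ?D = "{d. d dvd n}"
    have fD: "finite ?D" using n by auto
    have "cmod (dconv h x n) \<le> (\<Sum>d\<in>?D. cmod (h d) * cmod (x (n div d)))"
      unfolding dconv_def by (rule order_trans[OF norm_sum]) (simp add: norm_mult)
    also have "\<dots> = (\<Sum>d\<in>?D. sqrt (cmod (h d)) * (sqrt (cmod (h d)) * cmod (x (n div d))))"
      by (simp flip: mult.assoc)
    also have "\<dots> \<le> sqrt (\<Sum>d\<in>?D. cmod (h d)) * sqrt (w n)"
      using L2_set_mult_ineq[of "\<lambda>d. sqrt (cmod (h d))" "\<lambda>d. sqrt (cmod (h d)) * cmod (x (n div d))" ?D]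
      by (simp add: L2_set_def w_def power_mult_distrib abs_mult)
    finally have "(cmod (dconv h x n))\<^sup>2 \<le> (sqrt (\<Sum>d\<in>?D. cmod (h d)) * sqrt (w n))\<^sup>2"
      by (intro power_mono) auto
    also have "\<dots> = (\<Sum>d\<in>?D. cmod (h d)) * w n"
      using wn by (simp add: power_mult_distrib sum_nonneg)
    also have "\<dots> \<le> ?K * w n"
      using assms(1) fD n unfolding l1_def
      by (intro mult_right_mono finite_sum_le_infsum wn) (auto simp: Suc_le_eq dvd_pos_nat)
    finally show ?thesis .
  qed
  have "(\<Sum>n=1..N. (cmod (dconv h x n))\<^sup>2) \<le> (?K * h2_norm x)\<^sup>2" for N
  proof -
    have "(\<Sum>n=1..N. (cmod (dconv h x n))\<^sup>2) \<le> ?K * (\<Sum>n=1..N. w n)"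
      unfolding sum_distrib_left by (intro sum_mono pt) auto
    also have "\<dots> \<le> ?K * (?K * (h2_norm x)\<^sup>2)"
      unfolding wi[symmetric] by (intro mult_left_mono partial_sum_le_infsum wn ws K0)
    finally show ?thesis by (simp add: power2_eq_square ac_simps)
  qed
  then show "dconv h x \<in> H2" and "h2_norm (dconv h x) \<le> ?K * h2_norm x"
    using H2_I[of "dconv h x" "?K * h2_norm x"] K0 h2_norm_nonneg by auto
qed

section \<open>Zero-free discs and ratios of holomorphic functions\<close>

text \<open>The map sending \<open>u\<close> to \<open>u / (2 * K - u)\<close> takes the half-plane
  \<open>Re u < K\<close> into the unit disc and fixes 0, so the Schwarz lemma applies to the
  composite \<open>\<phi>\<close>; solving back for \<open>u\<close> gives the bound.\<close>

lemma Borel_Caratheodory: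
  assumes hol: "g holomorphic_on ball c R" and re: "\<And>z. z \<in> ball c R \<Longrightarrow> Re (g z) \<le> A"
    and r: "cmod (z - c) \<le> r" "r < R"
  shows "cmod (g z - g c) \<le> 2 * r / (R - r) * (A - Re (g c))"
proof -
  have r0: "0 \<le> r" using r(1) norm_ge_zero order_trans by blast
  then have R: "R > 0" using r by simp
  \<comment> \<open>A \<open>K\<close> strictly above \<open>A - Re (g c)\<close> keeps
    \<open>K > 0\<close> and \<open>Re u < K\<close> even where the bound \<open>A\<close> is
    attained. The slack is removed at the end.\<close>
  have main: "cmod (g z - g c) \<le> 2 * r / (R - r) * K" if K: "K > A - Re (g c)" for K
  proof -
    have A0: "A - Re (g c) \<ge> 0" using re[of c] R by simp
    then have K0: "K > 0" using K by simp
    define u where "u w = g (c + of_real R * w) - g c" for w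
    have inb: "c + of_real R * w \<in> ball c R" if "cmod w < 1" for w
      using that R by (simp add: dist_norm norm_mult)
    have reu: "Re (u w) < K" if "cmod w < 1" for w
      using re[OF inb[OF that]] K by (simp add: u_def)
    define \<phi> where "\<phi> w = u w / (of_real (2 * K) - u w)" for w
    have ne: "of_real (2 * K) - u w \<noteq> 0" if "cmod w < 1" for w
    proof
      assume "of_real (2 * K) - u w = 0"
      then have "u w = of_real (2 * K)" by simp
      then have "Re (u w) = 2 * K" by simp
      then show False using reu[OF that] K0 by simp
    qed
    have holu: "u holomorphic_on ball 0 1"
    proof -
      have "(g \<circ> (\<lambda>w. c + of_real R * w)) holomorphic_on ball 0 1"
        by (rule holomorphic_on_compose_gen[OF _ hol]) (use inb in \<open>auto intro!: holomorphic_intros\<close>)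
      then show ?thesis unfolding u_def o_def by (intro holomorphic_intros)
    qed
    have hol\<phi>: "\<phi> holomorphic_on ball 0 1"
      unfolding \<phi>_def using ne by (intro holomorphic_intros holu) auto
    have \<phi>0: "\<phi> 0 = 0" by (simp add: \<phi>_def u_def)
    have \<phi>1: "cmod (\<phi> w) < 1" if w: "cmod w < 1" for w
    proof -
      have "(cmod (of_real (2 * K) - u w))\<^sup>2 - (cmod (u w))\<^sup>2 = 4 * K * (K - Re (u w))"
        unfolding cmod_power2 by (simp add: power2_eq_square algebra_simps)
      also have "\<dots> > 0" using K0 reu[OF w] by simp
      finally have "(cmod (u w))\<^sup>2 < (cmod (of_real (2 * K) - u w))\<^sup>2" by simp
      then have "cmod (u w) < cmod (of_real (2 * K) - u w)"
        using norm_ge_zero power_less_imp_less_base by blast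
      then show ?thesis using ne[OF w] by (simp add: \<phi>_def norm_divide)
    qed
    define w where "w = (z - c) / of_real R"
    have wr: "cmod w \<le> r / R" using r R by (simp add: w_def norm_divide divide_right_mono)
    have w1: "cmod w < 1" using wr r R by (meson divide_less_eq_1_pos order_le_less_trans)
    have uw: "u w = g z - g c" using R by (simp add: u_def w_def)
    have le: "cmod (\<phi> w) \<le> r / R"
      using Schwarz_Lemma(1)[OF hol\<phi> \<phi>0 \<phi>1 w1] wr by linarith
    have "u w = \<phi> w * (of_real (2 * K) - u w)" using ne[OF w1] by (simp add: \<phi>_def)
    then have "u w = of_real (2 * K) * \<phi> w - \<phi> w * u w" by (simp add: algebra_simps)
    then have "cmod (u w) \<le> 2 * K * cmod (\<phi> w) + cmod (\<phi> w) * cmod (u w)"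
      using norm_triangle_ineq4[of "of_real (2 * K) * \<phi> w" "\<phi> w * u w"] K0 by (simp add: norm_mult)
    also have "\<dots> \<le> 2 * K * (r / R) + r / R * cmod (u w)"
      using le K0 by (intro add_mono mult_left_mono mult_right_mono) auto
    finally have "cmod (u w) * (R - r) \<le> 2 * K * r" using R by (simp add: field_simps)
    then show ?thesis using r uw by (simp add: field_simps)
  qed
  have "cmod (g z - g c) \<le> 2 * r / (R - r) * (A - Re (g c)) + e" if e: "e > 0" for e
  proof -
    define d where "d = e / (2 * r / (R - r) + 1)"
    have q: "2 * r / (R - r) \<ge> 0" using r r0 by simp
    then have d0: "d > 0" using e by (simp add: d_def)
    have "2 * r / (R - r) * d \<le> e"
    proof -
      have "(2 * r / (R - r) + 1) * d = e" using q by (simp add: d_def)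
      then show ?thesis using d0 by (simp add: algebra_simps)
    qed
    moreover have "cmod (g z - g c) \<le> 2 * r / (R - r) * (A - Re (g c)) + 2 * r / (R - r) * d"
      using main[of "A - Re (g c) + d"] d0 by (simp only: distrib_left less_add_same_cancel1)
    ultimately show ?thesis by linarith
  qed
  then show ?thesis by (rule field_le_epsilon)
qed

text \<open>A zero-free \<open>f\<close> has a logarithm on the disc with real part at most
  \<open>ln M\<close>, to which Borel-Caratheodory applies. The bound depends only on
  \<open>m\<close>, \<open>M\<close> and the two radii, hence is uniform over discs of the same size
  at all heights.\<close>

lemma zero_free_disc_lower_bound:
  assumes hol: "f holomorphic_on ball c R" and ne: "\<And>z. z \<in> ball c R \<Longrightarrow> f z \<noteq> 0"
    and M: "\<And>z. z \<in> ball c R \<Longrightarrow> cmod (f z) \<le> M" and m: "0 < m" "m \<le> cmod (f c)"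
    and r: "cmod (z - c) \<le> r" "r < R"
  shows "cmod (f z) \<ge> m * exp (- (2 * r / (R - r) * ln (M / m)))"
proof -
  have r0: "0 \<le> r" using r(1) norm_ge_zero order_trans by blast
  then have R: "R > 0" using r by simp
  have cM: "cmod (f c) \<le> M" using M[of c] R by simp
  obtain g where g: "g holomorphic_on ball c R" "\<And>w. w \<in> ball c R \<Longrightarrow> f w = exp (g w)"
    using contractible_imp_holomorphic_log[OF hol convex_imp_contractible[OF convex_ball] ne] by metis
  have mod: "cmod (f w) = exp (Re (g w))" if "w \<in> ball c R" for w using g(2)[OF that] by simp
  have zin: "z \<in> ball c R" using r by (simp add: dist_norm norm_minus_commute)
  have cin: "c \<in> ball c R" using R by simp
  have Mpos: "M > 0" using m cM by linarith
  have "Re (g w) \<le> ln M" if "w \<in> ball c R" for w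
    using M[OF that] mod[OF that] Mpos by (simp add: ln_ge_iff)
  then have "cmod (g z - g c) \<le> 2 * r / (R - r) * (ln M - Re (g c))"
    using Borel_Caratheodory[OF g(1) _ r] by blast
  moreover have rg: "Re (g c) \<ge> ln m" using m mod[OF cin] by (metis exp_gt_zero ln_exp ln_le_cancel_iff)
  ultimately have "cmod (g z - g c) \<le> 2 * r / (R - r) * (ln M - ln m)"
    using r r0 by (smt (verit) divide_nonneg_nonneg mult_left_mono)
  then have "\<bar>Re (g z - g c)\<bar> \<le> 2 * r / (R - r) * ln (M / m)"
    using abs_Re_le_cmod[of "g z - g c"] Mpos m by (simp add: ln_div)
  then have "Re (g z) \<ge> ln m + - (2 * r / (R - r) * ln (M / m))" using rg by simp
  then have "exp (ln m + - (2 * r / (R - r) * ln (M / m))) \<le> cmod (f z)"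
    unfolding mod[OF zin] exp_le_cancel_iff .
  then show ?thesis using m by (simp only: exp_add exp_ln)
qed

text \<open>Each zero is divided out by a Blaschke factor; this raises the lower bound \<open>m\<close> at the centre by
  \<open>R0 / R1\<close>, so \<open>N\<close> bounds the number of zeros in the smaller disc.\<close>

lemma disc_ratio_bound:
  assumes R: "0 < R2" "R2 < R1" "R1 < R0" and m0: "m0 > 0"
  shows "\<exists>C. \<forall>f m s s'. f holomorphic_on cball 0 R0 \<longrightarrow> (\<forall>z\<in>cball 0 R0. cmod (f z) \<le> M) \<longrightarrow> m0 \<le> m \<longrightarrow>
     m \<le> cmod (f 0) \<longrightarrow> M < m * (R0 / R1) ^ N \<longrightarrow> s \<in> cball 0 R2 \<longrightarrow> s' \<in> cball 0 R2 \<longrightarrow>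
     (\<forall>\<rho>\<in>cball 0 R1. f \<rho> = 0 \<longrightarrow> cmod (s - \<rho>) \<le> cmod (s' - \<rho>)) \<longrightarrow> cmod (f s) \<le> C * cmod (f s')"
proof (induction N)
  \<comment> \<open>Here \<open>M < m\<close> contradicts \<open>m \<le> cmod (f 0)\<close> and
    \<open>cmod (f 0) \<le> M\<close>, so any constant will do.\<close>
  case 0
  show ?case
  proof (rule exI[of _ 0], intro allI impI)
    fix f :: "complex \<Rightarrow> complex" and m and s s' :: complex
    assume "\<forall>z\<in>cball 0 R0. cmod (f z) \<le> M" "m \<le> cmod (f 0)" "M < m * (R0 / R1) ^ 0"
    moreover have "0 \<in> cball (0::complex) R0" using R by simp
    ultimately have False by fastforce
    then show "cmod (f s) \<le> 0 * cmod (f s')" ..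
  qed
next
  case (Suc N)
  obtain C where C': "\<forall>f m s s'. f holomorphic_on cball 0 R0 \<longrightarrow> (\<forall>z\<in>cball 0 R0. cmod (f z) \<le> M) \<longrightarrow> m0 \<le> m \<longrightarrow>
     m \<le> cmod (f 0) \<longrightarrow> M < m * (R0 / R1) ^ N \<longrightarrow> s \<in> cball 0 R2 \<longrightarrow> s' \<in> cball 0 R2 \<longrightarrow>
     (\<forall>\<rho>\<in>cball 0 R1. f \<rho> = 0 \<longrightarrow> cmod (s - \<rho>) \<le> cmod (s' - \<rho>)) \<longrightarrow> cmod (f s) \<le> C * cmod (f s')"
    using Suc.IH by (rule exE)
  note C = C'[rule_format]
  \<comment> \<open>\<open>L\<close> is the lower bound available when no zero lies in the disc of
    radius \<open>R1\<close>. \<open>K\<close> is the cost of dividing out one zero: the upper bound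
    \<open>2 * R0\<close> for \<open>q s'\<close> over the lower bound \<open>R0 - R1\<close> for
    \<open>q s\<close>.\<close>
  define L where "L = m0 * exp (- (2 * R2 / (R1 - R2) * ln (M / m0)))"
  define K where "K = 2 * R0 / (R0 - R1)"
  have L0: "L > 0" using m0 by (simp add: L_def)
  have K0: "K > 0" using R by (simp add: K_def)
  show ?case
  proof (rule exI[of _ "max (M / L) (K * \<bar>C\<bar>)"], intro allI impI)
    fix f m s s'
    assume hol: "f holomorphic_on cball 0 R0" and M: "\<forall>z\<in>cball 0 R0. cmod (f z) \<le> M"
      and m: "m0 \<le> m" "m \<le> cmod (f 0)" and MN: "M < m * (R0 / R1) ^ Suc N"
      and s: "s \<in> cball 0 R2" and s': "s' \<in> cball 0 R2"
      and z: "\<forall>\<rho>\<in>cball 0 R1. f \<rho> = 0 \<longrightarrow> cmod (s - \<rho>) \<le> cmod (s' - \<rho>)"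
    have sR: "cmod s \<le> R2" "cmod s' \<le> R2" using s s' by auto
    show "cmod (f s) \<le> max (M / L) (K * \<bar>C\<bar>) * cmod (f s')"
    proof (cases "\<exists>\<rho>\<in>cball 0 R1. f \<rho> = 0")
      case False
      have "cmod (f s') \<ge> L" unfolding L_def
        by (rule zero_free_disc_lower_bound[where c = 0 and R = R1])
          (use False M m m0 R s' in \<open>auto intro!: holomorphic_on_subset[OF hol]\<close>)
      moreover have "cmod (f s) \<le> M" using M s R by auto
      moreover have "M \<ge> 0" using calculation(2) norm_ge_zero order_trans by blast
      ultimately have "cmod (f s) \<le> M / L * cmod (f s')"
        using L0 by (smt (verit) divide_nonneg_pos mult_left_mono nonzero_eq_divide_eq)
      also have "\<dots> \<le> max (M / L) (K * \<bar>C\<bar>) * cmod (f s')" by (intro mult_right_mono) auto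
      finally show ?thesis .
    next
      case True
      then obtain \<rho> where \<rho>: "cmod \<rho> \<le> R1" "f \<rho> = 0" by auto
      have \<rho>0: "\<rho> \<noteq> 0" using \<rho> m m0 by auto
      \<comment> \<open>\<open>g\<close> is \<open>f\<close> with the zero divided out. As
        \<open>cmod (q w) = cmod (w - \<rho>)\<close> on the circle of radius \<open>R0\<close>,
        replacing the factor \<open>w - \<rho>\<close> by \<open>q w\<close> keeps the bound
        \<open>M\<close> by the maximum principle, while at 0 it replaces
        \<open>cmod \<rho> \<le> R1\<close> by \<open>R0\<close>.\<close>
      define g where "g w = (if w = \<rho> then deriv f \<rho> else f w / (w - \<rho>))" for w
      define q where "q w = (of_real (R0\<^sup>2) - cnj \<rho> * w) / of_real R0" for w
      define f1 where "f1 w = g w * q w" for w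
      have fg: "f w = g w * (w - \<rho>)" for w using \<rho> by (simp add: g_def)
      have "(\<lambda>w. if w = \<rho> then deriv f \<rho> else (f w - f \<rho>) / (w - \<rho>)) holomorphic_on cball 0 R0"
        by (rule pole_lemma[OF hol]) (use \<rho> R in auto)
      then have holg: "g holomorphic_on cball 0 R0" by (simp add: g_def[abs_def] \<rho>(2) cong: if_cong)
      have hol1: "f1 holomorphic_on cball 0 R0" unfolding f1_def q_def
        using R by (intro holomorphic_intros holg) auto
      have qn: "cmod (q w) = cmod (w - \<rho>)" if w: "cmod w = R0" for w
      proof -
        have "of_real (R0\<^sup>2) = w * cnj w" using w by (simp add: complex_norm_square[symmetric])
        then have "of_real (R0\<^sup>2) - cnj \<rho> * w = w * cnj (w - \<rho>)" by (simp add: algebra_simps)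
        then have "cmod (of_real (R0\<^sup>2) - cnj \<rho> * w) = R0 * cmod (w - \<rho>)"
          using w by (simp only: norm_mult complex_mod_cnj)
        then show ?thesis using R by (simp add: q_def norm_divide)
      qed
      have M1: "cmod (f1 w) \<le> M" if w: "w \<in> cball 0 R0" for w
      proof (rule maximum_modulus_frontier[of f1 "cball 0 R0" M w])
        show "f1 holomorphic_on interior (cball 0 R0)"
          by (rule holomorphic_on_subset[OF hol1]) (simp add: interior_subset)
        show "continuous_on (closure (cball 0 R0)) f1" using hol1 by (simp add: holomorphic_on_imp_continuous_on)
        show "cmod (f1 y) \<le> M" if "y \<in> frontier (cball 0 R0)" for y
        proof -
          have y: "cmod y = R0" using that R by (auto simp: frontier_cball)
          have "cmod (f1 y) = cmod (f y)" unfolding fg f1_def norm_mult qn[OF y] by simp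
          then show ?thesis using M y by auto
        qed
      qed (use w in auto)
      have f0: "cmod (f1 0) \<ge> m * (R0 / R1)"
      proof -
        have "cmod (f 0) = cmod (g 0) * cmod \<rho>" by (simp add: fg norm_mult)
        then have "cmod (f1 0) = cmod (f 0) / cmod \<rho> * R0"
          using R \<rho>0 by (simp add: f1_def q_def norm_mult norm_divide norm_power power2_eq_square)
        also have "\<dots> \<ge> m / R1 * R0"
          using m m0 \<rho> \<rho>0 R by (intro mult_right_mono frac_le) auto
        finally show ?thesis by simp
      qed
      have ind: "cmod (f1 s) \<le> C * cmod (f1 s')"
      proof (rule C[OF hol1 M1 _ f0])
        show "m0 \<le> m * (R0 / R1)"
          using m m0 R by (smt (verit) divide_less_eq_1_pos less_divide_eq_1_pos mult_le_cancel_left1)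
        show "M < m * (R0 / R1) * (R0 / R1) ^ N" using MN by (simp add: mult.assoc)
        show "cmod (s - w) \<le> cmod (s' - w)" if w: "w \<in> cball 0 R1" "f1 w = 0" for w
        proof -
          have "q w \<noteq> 0"
          proof
            assume "q w = 0"
            then have "of_real (R0\<^sup>2) = cnj \<rho> * w" using R by (simp add: q_def)
            then have "R0\<^sup>2 = cmod \<rho> * cmod w"
              by (metis abs_of_nonneg complex_mod_cnj norm_mult norm_of_real zero_le_power2)
            also have "\<dots> \<le> R1 * R1" using w \<rho> R by (intro mult_mono) auto
            also have "\<dots> < R0 * R0" using R by (intro mult_strict_mono) auto
            finally show False by (simp add: power2_eq_square)
          qed
          then have "f w = 0" using w by (simp add: f1_def fg)
          then show ?thesis using z w by blast
        qed
      qed (use s s' in auto)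
      have low: "cmod (q s) \<ge> R0 - R1" 
      proof -
        have "cmod (cnj \<rho> * s) \<le> R1 * R0" using \<rho> sR R unfolding norm_mult complex_mod_cnj by (intro mult_mono) auto
        moreover have "cmod (of_real (R0\<^sup>2) - cnj \<rho> * s) \<ge> R0\<^sup>2 - cmod (cnj \<rho> * s)"
          using norm_triangle_ineq2[of "of_real (R0\<^sup>2)" "cnj \<rho> * s"] by (simp add: norm_power)
        ultimately have "cmod (of_real (R0\<^sup>2) - cnj \<rho> * s) \<ge> (R0 - R1) * R0" by (simp add: power2_eq_square algebra_simps)
        then show ?thesis using R by (simp add: q_def norm_divide field_simps)
      qed
      have up: "cmod (q s') \<le> 2 * R0"
      proof -
        have "cmod (cnj \<rho> * s') \<le> R0 * R0" using \<rho> sR R unfolding norm_mult complex_mod_cnj by (intro mult_mono) auto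
        moreover have "cmod (of_real (R0\<^sup>2) - cnj \<rho> * s') \<le> R0\<^sup>2 + cmod (cnj \<rho> * s')"
          using norm_triangle_ineq4[of "of_real (R0\<^sup>2)" "cnj \<rho> * s'"] by (simp add: norm_power)
        ultimately have "cmod (of_real (R0\<^sup>2) - cnj \<rho> * s') \<le> 2 * R0 * R0" by (simp add: power2_eq_square algebra_simps)
        then show ?thesis using R by (simp add: q_def norm_divide field_simps)
      qed
      \<comment> \<open>The assumption on the zeros lets the factor of \<open>\<rho>\<close> pass
        from \<open>s\<close> to \<open>s'\<close> without loss; for the remaining zeros it was
        handed to the induction hypothesis.\<close>
      have d: "cmod (s - \<rho>) \<le> cmod (s' - \<rho>)" using z \<rho> by simp
      have "cmod (g s) * (R0 - R1) \<le> cmod (f1 s)" using low by (simp add: f1_def norm_mult mult_left_mono)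
      also have "\<dots> \<le> \<bar>C\<bar> * cmod (f1 s')" using ind by (smt (verit) mult_right_mono norm_ge_zero)
      also have "\<dots> \<le> \<bar>C\<bar> * (cmod (g s') * (2 * R0))" using up by (simp add: f1_def norm_mult mult_left_mono)
      finally have gs: "cmod (g s) \<le> K * \<bar>C\<bar> * cmod (g s')" using R by (simp add: K_def field_simps)
      have "cmod (f s) = cmod (g s) * cmod (s - \<rho>)" by (simp add: fg norm_mult)
      also have "\<dots> \<le> (K * \<bar>C\<bar> * cmod (g s')) * cmod (s' - \<rho>)"
        using gs d K0 by (intro mult_mono) auto
      also have "\<dots> = K * \<bar>C\<bar> * cmod (f s')" by (simp add: fg norm_mult)
      also have "\<dots> \<le> max (M / L) (K * \<bar>C\<bar>) * cmod (f s')" by (intro mult_right_mono) auto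
      finally show ?thesis .
    qed
  qed
qed

text \<open>With \<open>f = exp g\<close> the real part of \<open>g\<close> grows at most linearly.
  Borel-Caratheodory on the disc of radius \<open>2 * cmod z\<close> then bounds \<open>g\<close>
  itself linearly, and Liouville's theorem makes it affine.\<close>

lemma entire_nonvanishing_exponential_type:
  assumes hol: "f holomorphic_on UNIV" and ne: "\<And>z. f z \<noteq> 0"
    and bd: "\<And>z. cmod (f z) \<le> A * exp (B * cmod z)" and B: "B \<ge> 0"
  shows "\<exists>b. \<forall>z. f z = f 0 * exp (b * z)"
proof -
  obtain g where g: "g holomorphic_on UNIV" "\<And>w. f w = exp (g w)"
    using contractible_imp_holomorphic_log[OF hol convex_imp_contractible[OF convex_UNIV] ne] by (metis UNIV_I)
  have "0 < cmod (f 0)" using ne by simp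
  also have "\<dots> \<le> A" using bd[of 0] by simp
  finally have A: "A > 0" .
  have re: "Re (g w) \<le> ln A + B * cmod w" for w
  proof -
    have "exp (Re (g w)) \<le> A * exp (B * cmod w)" using bd[of w] g(2)[of w] by simp
    then have "ln (exp (Re (g w))) \<le> ln (A * exp (B * cmod w))" using A by (subst ln_le_cancel_iff) auto
    then show ?thesis using A by (simp add: ln_mult)
  qed
  define Q where "Q = 2 * (\<bar>ln A\<bar> + \<bar>Re (g 0)\<bar> + 2 * B) + cmod (g 0)"
  have gr: "cmod (g z) \<le> Q * cmod z ^ 1" if z: "cmod z \<ge> 1" for z
  proof -
    let ?r = "cmod z"
    have "cmod (g z - g 0) \<le> 2 * ?r / (2 * ?r - ?r) * (ln A + B * (2 * ?r) - Re (g 0))"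
    proof (rule Borel_Caratheodory[where c = 0 and R = "2 * ?r"])
      show "Re (g w) \<le> ln A + B * (2 * ?r)" if "w \<in> ball 0 (2 * ?r)" for w
        using re[of w] mult_left_mono[of "cmod w" "2 * ?r" B] that B by auto
    qed (use z in \<open>auto intro: holomorphic_on_subset[OF g(1)]\<close>)
    also have "2 * ?r / (2 * ?r - ?r) = 2" using z by auto
    also have "2 * (ln A + B * (2 * ?r) - Re (g 0)) \<le> 2 * (\<bar>ln A\<bar> * ?r + B * (2 * ?r) + \<bar>Re (g 0)\<bar> * ?r)"
      using z mult_left_mono[of 1 ?r "\<bar>ln A\<bar>"] mult_left_mono[of 1 ?r "\<bar>Re (g 0)\<bar>"] by auto
    finally have "cmod (g z - g 0) \<le> 2 * (\<bar>ln A\<bar> * ?r + B * (2 * ?r) + \<bar>Re (g 0)\<bar> * ?r)" .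
    moreover have "cmod (g 0) \<le> cmod (g 0) * ?r" using z mult_left_mono[of 1 ?r "cmod (g 0)"] by auto
    moreover have "cmod (g z) \<le> cmod (g z - g 0) + cmod (g 0)"
      using norm_triangle_ineq[of "g z - g 0" "g 0"] by simp
    ultimately show ?thesis by (simp add: Q_def algebra_simps)
  qed
  have lin: "g z = g 0 + deriv g 0 * z" for z
    using Liouville_polynomial[OF g(1) gr, of 1 z] by simp
  show ?thesis
  proof (intro exI allI)
    fix z show "f z = f 0 * exp (deriv g 0 * z)"
      unfolding g(2) by (subst lin) (simp add: exp_add)
  qed
qed

section \<open>Mean values on vertical lines\<close>

lemma of_nat_powr_exp: "n \<ge> 1 \<Longrightarrow> (of_nat n :: complex) powr s = exp (s * of_real (ln (real n)))"
  by (simp add: powr_def Ln_of_nat)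

lemma norm_of_nat_powr: "n \<ge> 1 \<Longrightarrow> cmod (of_nat n powr s) = real n powr Re s"
  by (simp add: of_nat_powr_exp powr_def)

lemma dirichlet_term_norm: "n \<ge> 1 \<Longrightarrow> cmod (b n / of_nat n powr s) = cmod (b n) * real n powr (- Re s)"
  by (simp add: norm_divide norm_of_nat_powr powr_minus_divide)

lemma vertical_line_has_integral:
  assumes "\<And>t. (\<Phi> has_field_derivative G (Complex \<tau> t)) (at (Complex \<tau> t))" "T \<ge> 0"
  shows "((\<lambda>t. G (Complex \<tau> t)) has_integral (\<Phi> (Complex \<tau> T) - \<Phi> (Complex \<tau> (-T))) / \<i>) {-T..T}"
proof -
  have "((\<lambda>t. G (Complex \<tau> t)) has_integral (\<Phi> (Complex \<tau> T) / \<i> - \<Phi> (Complex \<tau> (-T)) / \<i>)) {-T..T}"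
  proof (rule fundamental_theorem_of_calculus)
    fix x
    have "((\<lambda>t. Complex \<tau> t) has_vector_derivative \<i>) (at x within {-T..T})"
      unfolding Complex_eq by (auto intro!: derivative_eq_intros simp: has_vector_derivative_def scaleR_conv_of_real)
    then have "((\<Phi> \<circ> (\<lambda>t. Complex \<tau> t)) has_vector_derivative \<i> * G (Complex \<tau> x)) (at x within {-T..T})"
      by (rule field_vector_diff_chain_within) (use assms(1)[of x] in \<open>auto intro: has_field_derivative_at_within\<close>)
    then have "((\<lambda>t. \<Phi> (Complex \<tau> t) / \<i>) has_vector_derivative (\<i> * G (Complex \<tau> x)) / \<i>) (at x within {-T..T})"
      unfolding o_def by (intro has_vector_derivative_divide)
    then show "((\<lambda>t. \<Phi> (Complex \<tau> t) / \<i>) has_vector_derivative G (Complex \<tau> x)) (at x within {-T..T})" by simp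
  qed (use assms(2) in auto)
  then show ?thesis by (simp only: diff_divide_distrib)
qed

text \<open>The bound does not grow with \<open>T\<close>, so non-zero frequencies disappear from
  mean values after division by \<open>2 * T\<close>.\<close>

lemma exp_line_integral_bound:
  fixes l :: real assumes "l \<noteq> 0" "T \<ge> 0"
  shows "(\<lambda>t. exp (Complex \<sigma> t * of_real l)) integrable_on {-T..T}"
    and "cmod (integral {-T..T} (\<lambda>t. exp (Complex \<sigma> t * of_real l))) \<le> 2 * exp (\<sigma> * l) / \<bar>l\<bar>"
proof -
  let ?\<Phi> = "\<lambda>z. exp (z * of_real l) / of_real l"
  have "(?\<Phi> has_field_derivative exp (z * of_real l)) (at z)" for z
    using assms(1) by (auto intro!: derivative_eq_intros)
  from vertical_line_has_integral[where G = "\<lambda>z. exp (z * of_real l)", OF this assms(2)]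
  have "((\<lambda>t. exp (Complex \<sigma> t * of_real l)) has_integral (?\<Phi> (Complex \<sigma> T) - ?\<Phi> (Complex \<sigma> (-T))) / \<i>) {-T..T}" .
  then have i: "(\<lambda>t. exp (Complex \<sigma> t * of_real l)) integrable_on {-T..T}"
    "integral {-T..T} (\<lambda>t. exp (Complex \<sigma> t * of_real l)) = (?\<Phi> (Complex \<sigma> T) - ?\<Phi> (Complex \<sigma> (-T))) / \<i>"
    by (auto simp: has_integral_iff)
  then show "(\<lambda>t. exp (Complex \<sigma> t * of_real l)) integrable_on {-T..T}" by simp
  have n: "cmod (?\<Phi> (Complex \<sigma> t)) = exp (\<sigma> * l) / \<bar>l\<bar>" for t
    by (simp add: norm_divide)
  show "cmod (integral {-T..T} (\<lambda>t. exp (Complex \<sigma> t * of_real l))) \<le> 2 * exp (\<sigma> * l) / \<bar>l\<bar>"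
    unfolding i(2) norm_divide[of _ \<i>]
    using norm_triangle_ineq4[of "?\<Phi> (Complex \<sigma> T)" "?\<Phi> (Complex \<sigma> (-T))"] unfolding n by simp
qed

lemma summable_tail_small:
  fixes g :: "nat \<Rightarrow> real"
  assumes "\<And>n. g n \<ge> 0" "g summable_on {1..}" "e > 0"
  shows "\<exists>N\<ge>m. infsum g {N<..} < e"
proof -
  have "\<exists>F. finite F \<and> F \<subseteq> {1..} \<and> dist (sum g F) (infsum g {1..}) \<le> e / 2"
    using infsum_finite_approximation[OF assms(2), of "e / 2"] assms(3) by auto
  then obtain F where F: "finite F" "F \<subseteq> {1..}" "dist (sum g F) (infsum g {1..}) \<le> e / 2" by blast
  define N where "N = Max (insert 1 (insert m F))"
  have Nge: "x \<le> N" if "x \<in> insert 1 (insert m F)" for x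
    unfolding N_def by (rule Max_ge) (use that F in auto)
  then have N: "F \<subseteq> {1..N}" "m \<le> N" "1 \<le> N" using F by auto
  then have u: "{1..} = {1..N} \<union> {N<..}" by auto
  have s: "g summable_on {N<..}" by (rule summable_on_subset_banach[OF assms(2)]) (use N in auto)
  have "infsum g {1..} = sum g {1..N} + infsum g {N<..}"
    by (subst u, subst infsum_Un_disjoint) (use s in auto)
  moreover have "sum g F \<le> sum g {1..N}" using N assms(1) by (intro sum_mono2) auto
  ultimately have "infsum g {N<..} \<le> e / 2" using F(3) unfolding dist_real_def by linarith
  then show ?thesis using N assms(3) by (intro exI[of _ N]) auto
qed

text \<open>On a line of absolute convergence the term \<open>n = m\<close> integrates to exactly
  \<open>2 * T * g m\<close>, the finitely many other terms up to \<open>N\<close> oscillate and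
  make up \<open>C\<close>, and the tail beyond \<open>N\<close> is at most \<open>e\<close> at
  every point of the line.\<close>

lemma vertical_integral_coefficient_convergent:
  assumes abs: "(\<lambda>n. cmod (g n) * real n powr (- \<sigma>)) summable_on {1..}" and m: "m \<ge> 1" and e: "e > 0"
    and int: "\<And>T. T \<ge> 0 \<Longrightarrow> (\<lambda>t. H (Complex \<sigma> t) * of_nat m powr (Complex \<sigma> t)) integrable_on {-T..T}"
    and H: "\<And>t. H (Complex \<sigma> t) = dirichlet_eval g (Complex \<sigma> t)"
  shows "\<exists>C. \<forall>T\<ge>0. cmod (integral {-T..T} (\<lambda>t. H (Complex \<sigma> t) * of_nat m powr (Complex \<sigma> t)) - of_real (2 * T) * g m)
           \<le> C + 2 * T * e"
proof -
  let ?w = "real m powr \<sigma>"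
  have w: "?w > 0" using m by simp
  obtain N where N: "N \<ge> m" "infsum (\<lambda>n. cmod (g n) * real n powr (- \<sigma>)) {N<..} < e / ?w"
    using summable_tail_small[OF _ abs, of "e / ?w" m] e w by auto
  define q where "q n t = g n / of_nat n powr (Complex \<sigma> t) * of_nat m powr (Complex \<sigma> t)" for n t
  define C where "C = (\<Sum>n\<in>{1..N} - {m}. cmod (g n) * (2 * exp (\<sigma> * (ln m - ln n)) / \<bar>ln m - ln n\<bar>))"
  have qe: "q n t = g n * exp (Complex \<sigma> t * of_real (ln m - ln n))" if "n \<ge> 1" for n t
    using that m by (simp add: q_def of_nat_powr_exp exp_diff right_diff_distrib)
  have qint: "(q n) integrable_on {-T..T}" if "n \<ge> 1" "T \<ge> 0" for n T
  proof (cases "n = m")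
    case True
    have "q n = (\<lambda>t. g m)" using qe[OF that(1)] True by auto
    then show ?thesis by (simp add: integrable_const_ivl)
  next
    case False
    then have "ln (real m) - ln (real n) \<noteq> 0" using m that by simp
    then show ?thesis unfolding qe[OF that(1), abs_def]
      using exp_line_integral_bound(1)[of "ln m - ln n" T \<sigma>] that by (intro integrable_on_mult_right) auto
  qed
  have tail: "cmod (H (Complex \<sigma> t) * of_nat m powr (Complex \<sigma> t) - (\<Sum>n=1..N. q n t)) \<le> e" for t
  proof -
    have u: "{1..} = {1..N} \<union> {N<..}" using N m by auto
    let ?f = "\<lambda>n. g n / of_nat n powr (Complex \<sigma> t)"
    have sa: "(\<lambda>n. norm (?f n)) summable_on {1..}"
      by (rule summable_on_cong[THEN iffD2, OF _ abs]) (use dirichlet_term_norm[of _ g "Complex \<sigma> t"] in auto)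
    have sN: "(\<lambda>n. norm (?f n)) summable_on {N<..}"
      by (rule summable_on_subset_banach[OF sa]) (use N m in auto)
    have "dirichlet_eval g (Complex \<sigma> t) = (\<Sum>n=1..N. ?f n) + infsum ?f {N<..}"
      unfolding dirichlet_eval_def
      by (subst u, subst infsum_Un_disjoint) (use abs_summable_summable[OF sN] in auto)
    moreover have "(\<Sum>n=1..N. q n t) = (\<Sum>n=1..N. ?f n) * of_nat m powr (Complex \<sigma> t)"
      unfolding q_def by (rule sum_distrib_right[symmetric])
    ultimately have "H (Complex \<sigma> t) * of_nat m powr (Complex \<sigma> t) - (\<Sum>n=1..N. q n t)
        = infsum ?f {N<..} * of_nat m powr (Complex \<sigma> t)"
      unfolding H by (simp only: distrib_right add_diff_cancel_left')
    then have eq: "cmod (H (Complex \<sigma> t) * of_nat m powr (Complex \<sigma> t) - (\<Sum>n=1..N. q n t)) = cmod (infsum ?f {N<..}) * ?w"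
      by (simp only: norm_mult norm_of_nat_powr[OF m] complex.sel)
    have "cmod (infsum ?f {N<..}) \<le> e / ?w"
    proof -
      have "cmod (infsum ?f {N<..}) \<le> infsum (\<lambda>n. norm (?f n)) {N<..}" by (rule norm_infsum_bound[OF sN])
      also have "\<dots> = infsum (\<lambda>n. cmod (g n) * real n powr (- \<sigma>)) {N<..}"
        by (rule infsum_cong) (use dirichlet_term_norm[of _ g "Complex \<sigma> t"] N m in auto)
      finally show ?thesis using N by simp
    qed
    from mult_right_mono[OF this less_imp_le[OF w]] show ?thesis unfolding eq using w by simp
  qed
  show ?thesis
  proof (rule exI[of _ C], intro allI impI)
    fix T :: real assume T: "T \<ge> 0"
    let ?G = "\<lambda>t. H (Complex \<sigma> t) * of_nat m powr (Complex \<sigma> t)"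
    let ?I = "integral {-T..T}"
    have si: "(\<lambda>t. \<Sum>n=1..N. q n t) integrable_on {-T..T}" by (intro integrable_sum qint T) auto
    have "cmod (?I (\<lambda>t. ?G t - (\<Sum>n=1..N. q n t))) \<le> ?I (\<lambda>t. e)"
      by (rule integral_norm_bound_integral[OF integrable_diff[OF int[OF T] si] integrable_const_ivl tail])
    then have 1: "cmod (?I ?G - ?I (\<lambda>t. \<Sum>n=1..N. q n t)) \<le> 2 * T * e"
      unfolding integral_diff[OF int[OF T] si] using T by simp
    have "?I (\<lambda>t. \<Sum>n=1..N. q n t) = (\<Sum>n=1..N. ?I (q n))"
      by (rule integral_sum) (use qint T in auto)
    also have "\<dots> = ?I (q m) + (\<Sum>n\<in>{1..N} - {m}. ?I (q n))"
      by (rule sum.remove) (use N m in auto)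
    also have "q m = (\<lambda>t. g m)" using qe[OF m] by auto
    also have "?I (\<lambda>t. g m) = of_real (2 * T) * g m" using T by (simp add: scaleR_conv_of_real)
    finally have 2: "?I (\<lambda>t. \<Sum>n=1..N. q n t) - of_real (2 * T) * g m = (\<Sum>n\<in>{1..N} - {m}. ?I (q n))" by simp
    have "cmod (\<Sum>n\<in>{1..N} - {m}. ?I (q n)) \<le> C"
      unfolding C_def
    proof (rule order_trans[OF norm_sum sum_mono])
      fix n assume n: "n \<in> {1..N} - {m}"
      then have n1: "n \<ge> 1" by auto
      have ne: "ln (real m) - ln (real n) \<noteq> 0" using m n by auto
      have "?I (q n) = g n * ?I (\<lambda>t. exp (Complex \<sigma> t * of_real (ln m - ln n)))"
        unfolding qe[OF n1, abs_def] by simp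
      then show "cmod (?I (q n)) \<le> cmod (g n) * (2 * exp (\<sigma> * (ln m - ln n)) / \<bar>ln m - ln n\<bar>)"
        using exp_line_integral_bound(2)[OF ne T, of \<sigma>] by (simp only: norm_mult mult_left_mono norm_ge_zero)
    qed
    from norm_diff_triangle_le[OF 1 this[folded 2]]
    show "cmod (?I ?G - of_real (2 * T) * g m) \<le> C + 2 * T * e" by (simp only: add.commute)
  qed
qed

text \<open>The line is moved from \<open>\<sigma>1\<close>, where the series converges absolutely,
  to any \<open>\<sigma> > 0\<close>. The integrand has a primitive on the half-plane, so the two
  integrals differ by its increments along two horizontal segments, which are bounded independently
  of \<open>T\<close> because \<open>H\<close> is bounded.\<close>

lemma vertical_mean_coefficient:
  assumes hol: "H holomorphic_on {s. Re s > 0}" and M: "\<And>s. Re s > 0 \<Longrightarrow> cmod (H s) \<le> M"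
    and abs: "(\<lambda>n. cmod (g n) * real n powr (- \<sigma>1)) summable_on {1..}" and m: "m \<ge> 1"
    and H: "\<And>t. H (Complex \<sigma>1 t) = dirichlet_eval g (Complex \<sigma>1 t)" and \<sigma>: "\<sigma> > 0" "\<sigma>1 > 0"
  shows "((\<lambda>T. integral {-T..T} (\<lambda>t. H (Complex \<sigma> t) * of_nat m powr (Complex \<sigma> t)) / of_real (2 * T)) \<longlongrightarrow> g m) at_top"
    and "T \<ge> 0 \<Longrightarrow> (\<lambda>t. H (Complex \<sigma> t) * of_nat m powr (Complex \<sigma> t)) integrable_on {-T..T}"
proof -
  let ?S = "{s. Re s > 0}"
  have cv: "convex ?S" "open ?S" by (auto simp: convex_halfspace_Re_gt open_halfspace_Re_gt)
  define G where "G s = H s * of_nat m powr s" for s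
  have "G holomorphic_on ?S" unfolding G_def using m by (intro holomorphic_intros hol) auto
  then obtain \<Phi> where "\<And>x. x \<in> ?S \<Longrightarrow> (\<Phi> has_field_derivative G x) (at x within ?S)"
    using holomorphic_convex_primitive'[OF cv] by blast
  then have \<Phi>: "(\<Phi> has_field_derivative G x) (at x)" if "Re x > 0" for x
    using that cv(2) by (metis at_within_open mem_Collect_eq)
  have int: "((\<lambda>t. G (Complex \<tau> t)) has_integral (\<Phi> (Complex \<tau> T) - \<Phi> (Complex \<tau> (-T))) / \<i>) {-T..T}"
    if "\<tau> > 0" "T \<ge> 0" for \<tau> T
    by (rule vertical_line_has_integral) (use \<Phi> that in auto)
  show "T \<ge> 0 \<Longrightarrow> (\<lambda>t. H (Complex \<sigma> t) * of_nat m powr (Complex \<sigma> t)) integrable_on {-T..T}"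
    using int[OF \<sigma>(1)] unfolding G_def by blast
  have M0: "M \<ge> 0" using order_trans[OF norm_ge_zero M[of 1]] by simp
  define B where "B = M * real m powr (max \<sigma> \<sigma>1) * \<bar>\<sigma> - \<sigma>1\<bar>"
  have shift: "cmod (\<Phi> (Complex \<sigma> t) - \<Phi> (Complex \<sigma>1 t)) \<le> B" for t
  proof -
    let ?S' = "{s. Re s \<ge> min \<sigma> \<sigma>1} \<inter> {s. Re s \<le> max \<sigma> \<sigma>1}"
    have "norm (\<Phi> (Complex \<sigma> t) - \<Phi> (Complex \<sigma>1 t)) \<le> (M * real m powr (max \<sigma> \<sigma>1)) * norm (Complex \<sigma> t - Complex \<sigma>1 t)"
    proof (rule field_differentiable_bound[of ?S' \<Phi> G])
      show "convex ?S'" by (intro convex_Int convex_halfspace_Re_ge convex_halfspace_Re_le)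
      show "(\<Phi> has_field_derivative G z) (at z within ?S')" if "z \<in> ?S'" for z
        by (rule has_field_derivative_at_within[OF \<Phi>]) (use that \<sigma> in auto)
      show "norm (G z) \<le> M * real m powr (max \<sigma> \<sigma>1)" if "z \<in> ?S'" for z
      proof -
        have z: "Re z > 0" "Re z \<le> max \<sigma> \<sigma>1" using that \<sigma> by auto
        show ?thesis unfolding G_def norm_mult norm_of_nat_powr[OF m]
          using M[OF z(1)] M0 m z(2) by (intro mult_mono powr_mono) auto
      qed
    qed (use \<sigma> in auto)
    also have "norm (Complex \<sigma> t - Complex \<sigma>1 t) = \<bar>\<sigma> - \<sigma>1\<bar>"
      by (simp add: complex_diff cmod_def)
    finally show ?thesis unfolding B_def .
  qed
  let ?J = "\<lambda>T. integral {-T..T} (\<lambda>t. H (Complex \<sigma> t) * of_nat m powr (Complex \<sigma> t))"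
  let ?J1 = "\<lambda>T. integral {-T..T} (\<lambda>t. H (Complex \<sigma>1 t) * of_nat m powr (Complex \<sigma>1 t))"
  have JJ: "cmod (?J T - ?J1 T) \<le> 2 * B" if T: "T \<ge> 0" for T
  proof -
    have "?J T - ?J1 T = ((\<Phi> (Complex \<sigma> T) - \<Phi> (Complex \<sigma>1 T)) - (\<Phi> (Complex \<sigma> (-T)) - \<Phi> (Complex \<sigma>1 (-T)))) / \<i>"
      unfolding integral_unique[OF int[OF \<sigma>(1) T], unfolded G_def] integral_unique[OF int[OF \<sigma>(2) T], unfolded G_def]
      by (simp add: algebra_simps)
    then have "cmod (?J T - ?J1 T) = cmod ((\<Phi> (Complex \<sigma> T) - \<Phi> (Complex \<sigma>1 T)) - (\<Phi> (Complex \<sigma> (-T)) - \<Phi> (Complex \<sigma>1 (-T))))"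
      by (simp only: norm_divide norm_ii div_by_1)
    also have "\<dots> \<le> B + B" by (rule order_trans[OF norm_triangle_ineq4 add_mono[OF shift shift]])
    finally show ?thesis by simp
  qed
  show "((\<lambda>T. ?J T / of_real (2 * T)) \<longlongrightarrow> g m) at_top"
  proof (rule tendstoI)
    fix e :: real assume e: "e > 0"
    have i1: "(\<lambda>t. H (Complex \<sigma>1 t) * of_nat m powr (Complex \<sigma>1 t)) integrable_on {-T..T}" if "T \<ge> 0" for T
      using has_integral_integrable[OF int[OF \<sigma>(2) that]] unfolding G_def .
    obtain C where C: "\<forall>T\<ge>0. cmod (?J1 T - of_real (2 * T) * g m) \<le> C + 2 * T * (e / 2)"
      using vertical_integral_coefficient_convergent[OF abs m half_gt_zero[OF e] i1 H] by (rule exE)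
    have "eventually (\<lambda>T::real. T > 0 \<and> T > (C + 2 * B) / e) at_top"
      by (intro eventually_conj eventually_gt_at_top)
    then show "eventually (\<lambda>T. dist (?J T / of_real (2 * T)) (g m) < e) at_top"
    proof eventually_elim
      case (elim T)
      have "cmod (?J T - of_real (2 * T) * g m) \<le> 2 * B + (C + 2 * T * (e / 2))"
        by (rule norm_diff_triangle_le[OF JJ C[rule_format]]) (use elim in auto)
      also have "\<dots> < e * (2 * T)" using elim e by (simp add: field_simps)
      finally have "cmod (?J T - of_real (2 * T) * g m) < e * (2 * T)" .
      moreover have "?J T / of_real (2 * T) - g m = (?J T - of_real (2 * T) * g m) / of_real (2 * T)"
        using elim by (simp add: field_simps)
      ultimately show ?case using elim by (simp add: dist_norm norm_divide field_simps)
    qed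
  qed
qed

text \<open>Bessel's inequality for mean values on vertical lines. With \<open>P\<close> the partial
  sum, \<open>2 * Re (H * cnj P) - (cmod P)^2\<close> is at most \<open>(cmod H)^2\<close>, and its
  mean value is the sum of \<open>(cmod (g n))^2 * n powr (- 2 * \<sigma>)\<close>. Finally
  \<open>\<sigma>\<close> tends to 0.\<close>

theorem bounded_dirichlet_coefficients:
  assumes hol: "H holomorphic_on {s. Re s > 0}" and M: "\<And>s. Re s > 0 \<Longrightarrow> cmod (H s) \<le> M"
    and abs: "(\<lambda>n. cmod (g n) * real n powr (- \<sigma>1)) summable_on {1..}" and \<sigma>1: "\<sigma>1 > 0"
    and H: "\<And>t. H (Complex \<sigma>1 t) = dirichlet_eval g (Complex \<sigma>1 t)"
  shows "(\<Sum>n=1..N. (cmod (g n))\<^sup>2) \<le> M\<^sup>2"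
proof -
  define p where "p n = (if n \<le> N then g n else 0)" for n
  define P where "P s = (\<Sum>n=1..N. g n / of_nat n powr s)" for s
  have M0: "M \<ge> 0" using order_trans[OF norm_ge_zero M[of 1]] by simp
  have pe: "dirichlet_eval p s = P s" for s
  proof -
    have "dirichlet_eval p s = infsum (\<lambda>n. g n / of_nat n powr s) {1..N}"
      unfolding dirichlet_eval_def by (rule infsum_cong_neutral) (auto simp: p_def)
    then show ?thesis by (simp add: P_def)
  qed
  have "(\<lambda>n. cmod (p n) * real n powr (- \<sigma>1)) summable_on {1..}"
    by (rule summable_on_cong_neutral[THEN iffD1, OF _ _ _ summable_on_finite[of "{1..N}" "\<lambda>n. cmod (g n) * real n powr (- \<sigma>1)"]])
      (auto simp: p_def)
  note pabs = this
  have Phol: "P holomorphic_on {s. Re s > 0}"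
    unfolding P_def by (intro holomorphic_intros) auto
  have PM: "cmod (P s) \<le> (\<Sum>n=1..N. cmod (g n))" if "Re s > 0" for s
    unfolding P_def
  proof (rule order_trans[OF norm_sum sum_mono])
    fix n assume n: "n \<in> {1..N}"
    have "real n powr (- Re s) \<le> real n powr 0" using that n by (intro powr_mono) auto
    then have "real n powr (- Re s) \<le> 1" using n by simp
    then show "cmod (g n / of_nat n powr s) \<le> cmod (g n)"
      using n dirichlet_term_norm[of n g s] by (simp add: mult_left_le)
  qed
  have main: "(\<Sum>n=1..N. (cmod (g n))\<^sup>2 * real n powr (- 2 * \<sigma>)) \<le> M\<^sup>2" if \<sigma>: "\<sigma> > 0" for \<sigma>
  proof -
    define h where "h n t = H (Complex \<sigma> t) * of_nat n powr (Complex \<sigma> t)" for n t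
    define k where "k n t = P (Complex \<sigma> t) * of_nat n powr (Complex \<sigma> t)" for n t
    \<comment> \<open>On \<open>Re s = \<sigma>\<close> the conjugate of \<open>n powr (- s)\<close>
      is \<open>n powr (s - 2 * \<sigma>)\<close>, so the \<open>c n\<close> are the coefficients of
      \<open>cnj P\<close> with respect to \<open>n powr s\<close>. This makes \<open>Q\<close>,
      which is \<open>2 * H * cnj P - P * cnj P\<close>, a combination of integrands with known mean
      values.\<close>
    define c where "c n = cnj (g n) * of_real (real n powr (- 2 * \<sigma>))" for n
    define Q where "Q t = (\<Sum>n=1..N. c n * (2 * h n t - k n t))" for t
    have hl: "((\<lambda>T. integral {-T..T} (h n) / of_real (2 * T)) \<longlongrightarrow> g n) at_top"
      and hi: "T \<ge> 0 \<Longrightarrow> h n integrable_on {-T..T}" if "n \<in> {1..N}" for n T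
      using vertical_mean_coefficient[OF hol M abs _ H \<sigma> \<sigma>1, of n] that unfolding h_def[abs_def] by auto
    have kl: "((\<lambda>T. integral {-T..T} (k n) / of_real (2 * T)) \<longlongrightarrow> g n) at_top"
      and ki: "T \<ge> 0 \<Longrightarrow> k n integrable_on {-T..T}" if "n \<in> {1..N}" for n T
      using vertical_mean_coefficient[OF Phol PM pabs _ pe[symmetric] \<sigma> \<sigma>1, of n] that
      unfolding k_def[abs_def] by (auto simp: p_def)
    have Qint: "integral {-T..T} Q = (\<Sum>n=1..N. c n * (2 * integral {-T..T} (h n) - integral {-T..T} (k n)))"
      and Qi: "Q integrable_on {-T..T}" if "T \<ge> 0" for T
    proof -
      have i: "((\<lambda>t. c n * (2 * h n t - k n t)) has_integral c n * (2 * integral {-T..T} (h n) - integral {-T..T} (k n))) {-T..T}"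
        if "n \<in> {1..N}" for n
        using hi[OF that \<open>T \<ge> 0\<close>] ki[OF that \<open>T \<ge> 0\<close>]
        by (intro has_integral_mult_right has_integral_diff integrable_integral)
      have "(Q has_integral (\<Sum>n=1..N. c n * (2 * integral {-T..T} (h n) - integral {-T..T} (k n)))) {-T..T}"
        unfolding Q_def[abs_def] by (rule has_integral_sum) (auto intro: i)
      then show "integral {-T..T} Q = (\<Sum>n=1..N. c n * (2 * integral {-T..T} (h n) - integral {-T..T} (k n)))"
        "Q integrable_on {-T..T}" by (auto simp: has_integral_iff)
    qed
    have cP: "cnj (P (Complex \<sigma> t)) = (\<Sum>n=1..N. c n * of_nat n powr (Complex \<sigma> t))" for t
      unfolding P_def cnj_sum
    proof (rule sum.cong[OF refl])
      fix n assume n: "n \<in> {1..N}"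
      have n1: "n \<ge> 1" using n by auto
      have "of_real (real n powr (- 2 * \<sigma>)) = (exp (of_real (- 2 * \<sigma> * ln (real n))) :: complex)"
        unfolding exp_of_real using n1 by (simp add: powr_def)
      then have "c n * of_nat n powr (Complex \<sigma> t) = cnj (g n) * exp (of_real (- 2 * \<sigma> * ln (real n)) + Complex \<sigma> t * of_real (ln (real n)))"
        unfolding exp_add c_def of_nat_powr_exp[OF n1] by (simp only: mult.assoc)
      also have "of_real (- 2 * \<sigma> * ln (real n)) + Complex \<sigma> t * of_real (ln (real n)) = - (cnj (Complex \<sigma> t) * of_real (ln (real n)))"
        by (simp add: complex_eq_iff)
      also have "exp \<dots> = inverse (cnj (of_nat n powr (Complex \<sigma> t)))"
        using n1 by (simp add: of_nat_powr_exp exp_minus exp_cnj)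
      finally show "cnj (g n / of_nat n powr (Complex \<sigma> t)) = c n * of_nat n powr (Complex \<sigma> t)"
        by (simp add: divide_inverse)
    qed
    \<comment> \<open>Completing the square: \<open>Re (Q t)\<close> is the squared modulus of
      \<open>H\<close> minus that of \<open>H - P\<close>.\<close>
    have QQ: "Re (Q t) \<le> M\<^sup>2" for t
    proof -
      let ?h = "H (Complex \<sigma> t)" and ?p = "P (Complex \<sigma> t)"
      have Q: "Q t = 2 * ?h * cnj ?p - ?p * cnj ?p"
        unfolding cP Q_def h_def k_def by (simp add: sum_distrib_left sum_subtractf algebra_simps)
      have "Re (Q t) = (cmod ?h)\<^sup>2 - (cmod (?h - ?p))\<^sup>2"
        unfolding Q cmod_power2 by (simp add: power2_eq_square algebra_simps)
      also have "\<dots> \<le> (cmod ?h)\<^sup>2" by simp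
      also have "\<dots> \<le> M\<^sup>2" using M[of "Complex \<sigma> t"] \<sigma> by (intro power_mono) auto
      finally show ?thesis .
    qed
    have "Re (integral {-T..T} Q / of_real (2 * T)) \<le> M\<^sup>2" if T: "T > 0" for T
    proof -
      have i: "(Q has_integral integral {-T..T} Q) {-T..T}" using Qi[of T] T by (simp add: integrable_integral)
      have "((Re \<circ> Q) has_integral Re (integral {-T..T} Q)) {-T..T}"
        by (rule has_integral_linear[OF i bounded_linear_Re])
      moreover have "((\<lambda>t. M\<^sup>2) has_integral (M\<^sup>2 * (2 * T))) {-T..T}"
        using has_integral_const_real[of "M\<^sup>2" "-T" T] T by (simp add: mult.commute)
      ultimately have "Re (integral {-T..T} Q) \<le> M\<^sup>2 * (2 * T)"
        by (rule has_integral_le) (use QQ in auto)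
      moreover have "Re (integral {-T..T} Q / of_real (2 * T)) = Re (integral {-T..T} Q) / (2 * T)"
        by (rule Re_divide_of_real)
      ultimately show ?thesis using T by (simp add: field_simps)
    qed
    then have ev: "eventually (\<lambda>T. Re (integral {-T..T} Q / of_real (2 * T)) \<le> M\<^sup>2) at_top"
      by (rule eventually_mono[OF eventually_gt_at_top[of 0]])
    have "((\<lambda>T. \<Sum>n=1..N. c n * (2 * (integral {-T..T} (h n) / of_real (2 * T)) - integral {-T..T} (k n) / of_real (2 * T)))
        \<longlongrightarrow> (\<Sum>n=1..N. c n * (2 * g n - g n))) at_top"
      by (intro tendsto_intros hl kl)
    moreover have "eventually (\<lambda>T. (\<Sum>n=1..N. c n * (2 * (integral {-T..T} (h n) / of_real (2 * T)) - integral {-T..T} (k n) / of_real (2 * T)))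
        = integral {-T..T} Q / of_real (2 * T)) at_top"
      using eventually_gt_at_top[of "0::real"]
      by eventually_elim (simp add: Qint sum_divide_distrib diff_divide_distrib right_diff_distrib)
    ultimately have "((\<lambda>T. integral {-T..T} Q / of_real (2 * T)) \<longlongrightarrow> (\<Sum>n=1..N. c n * (2 * g n - g n))) at_top"
      by (rule Lim_transform_eventually)
    then have "((\<lambda>T. Re (integral {-T..T} Q / of_real (2 * T))) \<longlongrightarrow> Re (\<Sum>n=1..N. c n * (2 * g n - g n))) at_top"
      by (rule tendsto_Re)
    then have "Re (\<Sum>n=1..N. c n * (2 * g n - g n)) \<le> M\<^sup>2"
      by (rule tendsto_upperbound[OF _ ev]) simp
    moreover have "c n * (2 * g n - g n) = of_real ((cmod (g n))\<^sup>2 * real n powr (- 2 * \<sigma>))" for n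
    proof -
      have "c n * (2 * g n - g n) = (g n * cnj (g n)) * of_real (real n powr (- 2 * \<sigma>))" by (simp add: c_def)
      then show ?thesis unfolding complex_norm_square[symmetric] of_real_mult .
    qed
    ultimately show ?thesis by (simp only: Re_sum Re_complex_of_real)
  qed
  have "((\<lambda>\<sigma>. \<Sum>n=1..N. (cmod (g n))\<^sup>2 * real n powr (- 2 * \<sigma>)) \<longlongrightarrow> (\<Sum>n=1..N. (cmod (g n))\<^sup>2 * real n powr (- 2 * 0))) (at_right 0)"
    by (intro tendsto_intros) auto
  moreover have "eventually (\<lambda>\<sigma>. (\<Sum>n=1..N. (cmod (g n))\<^sup>2 * real n powr (- 2 * \<sigma>)) \<le> M\<^sup>2) (at_right 0)"
    by (rule eventually_mono[OF eventually_at_right_less main])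
  ultimately have "(\<Sum>n=1..N. (cmod (g n))\<^sup>2 * real n powr (- 2 * 0)) \<le> M\<^sup>2"
    by (rule tendsto_upperbound) simp
  then show ?thesis by simp
qed

section \<open>Absolutely convergent Dirichlet series\<close>

definition dabs :: "(nat \<Rightarrow> complex) \<Rightarrow> real \<Rightarrow> bool" where
  "dabs f \<sigma> \<longleftrightarrow> (\<lambda>n. cmod (f n) * real n powr (- \<sigma>)) summable_on {1..}"

text \<open>The translation of a series by \<open>s\<close>, carried by its coefficients. Evaluation
  at a point becomes a plain sum, so facts on \<open>l1\<close> and \<open>dconv\<close> apply at
  every point.\<close>

definition tw :: "complex \<Rightarrow> (nat \<Rightarrow> complex) \<Rightarrow> nat \<Rightarrow> complex" where
  "tw s f n = f n / of_nat n powr s"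

lemma dirichlet_eval_tw: "dirichlet_eval f s = infsum (tw s f) {1..}"
  unfolding dirichlet_eval_def tw_def ..

lemma norm_tw: "n \<ge> 1 \<Longrightarrow> cmod (tw s f n) = cmod (f n) * real n powr (- Re s)"
  unfolding tw_def by (rule dirichlet_term_norm)

lemma l1_tw: "l1 (tw s f) \<longleftrightarrow> dabs f (Re s)"
  unfolding l1_def dabs_def by (rule summable_on_cong) (auto intro: norm_tw)

lemma dabs_0: "dabs f 0 \<longleftrightarrow> l1 f"
  unfolding l1_def dabs_def by (rule summable_on_cong) auto

lemma dabs_dominated:
  assumes "dabs g \<sigma>" "\<And>n. n \<ge> 1 \<Longrightarrow> cmod (f n) * real n powr (- \<sigma>') \<le> cmod (g n) * real n powr (- \<sigma>)"
  shows "dabs f \<sigma>'"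
  using assms(1) unfolding dabs_def by (rule summable_on_comparison_test) (use assms(2) in auto)

lemma dabs_mono: assumes "dabs f \<sigma>" "\<sigma> \<le> \<sigma>'" shows "dabs f \<sigma>'"
  by (rule dabs_dominated[OF assms(1)]) (use assms(2) in \<open>auto intro!: mult_left_mono powr_mono\<close>)

lemma dabs_tw: "dabs (tw s f) \<sigma> \<longleftrightarrow> dabs f (\<sigma> + Re s)"
  unfolding dabs_def by (rule summable_on_cong) (auto simp: norm_tw powr_add[symmetric] algebra_simps)

lemma tw_tw: "n \<ge> 1 \<Longrightarrow> tw s (tw t f) n = tw (s + t) f n"
  by (simp add: tw_def powr_add)

lemma dirichlet_eval_of_tw: "dirichlet_eval (tw t f) s = dirichlet_eval f (s + t)"
  unfolding dirichlet_eval_tw by (rule infsum_cong) (simp add: tw_tw)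

lemma dirichlet_eval_cong: "(\<And>n. n \<ge> 1 \<Longrightarrow> f n = g n) \<Longrightarrow> dirichlet_eval f s = dirichlet_eval g s"
  unfolding dirichlet_eval_def by (rule infsum_cong) auto

text \<open>The intended \<open>z\<close> are the reciprocals of \<open>n powr s\<close> and the
  monomials \<open>cm \<zeta>\<close>; both kinds of evaluation become multiplicative through this
  identity.\<close>

lemma dconv_twist:
  assumes "\<And>m n. m \<ge> 1 \<Longrightarrow> n \<ge> 1 \<Longrightarrow> z (m * n) = z m * z n" "n \<ge> 1"
  shows "dconv (\<lambda>n. f n * z n) (\<lambda>n. g n * z n) n = dconv f g n * z n"
proof -
  have "f d * z d * (g (n div d) * z (n div d)) = f d * g (n div d) * z n" if "d dvd n" for d
    using assms(1)[of d "n div d"] divisor_pos[OF assms(2) that] that by simp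
  then show ?thesis unfolding dconv_def sum_distrib_right by (intro sum.cong) auto
qed

lemma of_nat_powr_mult:
  "m \<ge> 1 \<Longrightarrow> n \<ge> 1 \<Longrightarrow> (of_nat (m * n) :: complex) powr s = of_nat m powr s * of_nat n powr s"
  using of_nat_powr_exp[of "m * n" s] of_nat_powr_exp[of m s] of_nat_powr_exp[of n s]
  by (simp add: ln_mult algebra_simps exp_add)

lemma tw_dconv:
  assumes "n \<ge> 1"
  shows "dconv (tw s f) (tw s g) n = tw s (dconv f g) n"
proof -
  have m: "1 / (of_nat (m * n) :: complex) powr s = 1 / of_nat m powr s * (1 / of_nat n powr s)" if "m \<ge> 1" "n \<ge> 1" for m n
    using of_nat_powr_mult[OF that] by (simp add: field_simps)
  show ?thesis
    using dconv_twist[where z = "\<lambda>n. 1 / of_nat n powr s" and f = f and g = g, OF m assms]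
    by (simp add: tw_def[abs_def])
qed

lemma dirichlet_eval_dconv:
  assumes "dabs f (Re s)" "dabs g (Re s)"
  shows "dabs (dconv f g) (Re s)" "dirichlet_eval (dconv f g) s = dirichlet_eval f s * dirichlet_eval g s"
proof -
  have l: "l1 (tw s f)" "l1 (tw s g)" using assms l1_tw by auto
  show "dabs (dconv f g) (Re s)"
    using infsum_dconv(1)[OF l] l1_cong[of "dconv (tw s f) (tw s g)" "tw s (dconv f g)"] tw_dconv l1_tw by blast
  have "dirichlet_eval (dconv f g) s = infsum (dconv (tw s f) (tw s g)) {1..}"
    unfolding dirichlet_eval_tw by (rule infsum_cong) (use tw_dconv in auto)
  then show "dirichlet_eval (dconv f g) s = dirichlet_eval f s * dirichlet_eval g s"
    using infsum_dconv(2)[OF l] by (simp add: dirichlet_eval_tw)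
qed

lemma dabs_summable: "dabs f (Re s) \<Longrightarrow> (tw s f) summable_on {1..}"
  using l1_tw l1_summable by blast

lemma dabs_dconv:
  assumes "dabs f \<sigma>" "dabs g \<sigma>" shows "dabs (dconv f g) \<sigma>"
  using dirichlet_eval_dconv(1)[of f "of_real \<sigma>" g] assms by simp

lemma dirichlet_eval_diff:
  assumes "dabs f (Re s)" "dabs g (Re s)"
  shows "dirichlet_eval (\<lambda>n. f n - g n) s = dirichlet_eval f s - dirichlet_eval g s"
proof -
  have "dirichlet_eval (\<lambda>n. f n - g n) s = infsum (\<lambda>n. tw s f n + - 1 * tw s g n) {1..}"
    unfolding dirichlet_eval_tw by (rule infsum_cong) (simp add: tw_def diff_divide_distrib)
  also have "\<dots> = infsum (tw s f) {1..} + infsum (\<lambda>n. - 1 * tw s g n) {1..}"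
    by (intro infsum_add summable_on_cmult_right dabs_summable assms)
  finally show ?thesis by (simp only: dirichlet_eval_tw infsum_cmult_right') simp
qed

lemma dirichlet_eval_add:
  assumes "dabs f (Re s)" "dabs g (Re s)"
  shows "dirichlet_eval (\<lambda>n. f n + g n) s = dirichlet_eval f s + dirichlet_eval g s"
proof -
  have "dirichlet_eval (\<lambda>n. f n + g n) s = infsum (\<lambda>n. tw s f n + tw s g n) {1..}"
    unfolding dirichlet_eval_tw by (rule infsum_cong) (simp add: tw_def add_divide_distrib)
  also have "\<dots> = infsum (tw s f) {1..} + infsum (tw s g) {1..}"
    by (intro infsum_add dabs_summable assms)
  finally show ?thesis by (simp add: dirichlet_eval_tw)
qed

lemma dirichlet_eval_scale: "dirichlet_eval (\<lambda>n. c * f n) s = c * dirichlet_eval f s"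
proof -
  have "dirichlet_eval (\<lambda>n. c * f n) s = infsum (\<lambda>n. c * tw s f n) {1..}"
    unfolding dirichlet_eval_tw by (rule infsum_cong) (simp add: tw_def)
  then show ?thesis by (simp add: dirichlet_eval_tw infsum_cmult_right')
qed

lemma dabs_add: assumes "dabs f \<sigma>" "dabs g \<sigma>" shows "dabs (\<lambda>n. f n + g n) \<sigma>"
proof -
  have "(\<lambda>n. cmod (f n) * real n powr (- \<sigma>) + cmod (g n) * real n powr (- \<sigma>)) summable_on {1..}"
    using assms unfolding dabs_def by (rule summable_on_add)
  then show ?thesis unfolding dabs_def
    by (rule summable_on_comparison_test)
      (auto simp: distrib_right[symmetric] intro!: mult_right_mono norm_triangle_ineq)
qed

lemma dabs_scale: "dabs f \<sigma> \<Longrightarrow> dabs (\<lambda>n. c * f n) \<sigma>"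
  unfolding dabs_def norm_mult mult.assoc by (rule summable_on_cmult_right)

lemma dirichlet_eval_partial:
  assumes "dabs f \<sigma>" "Re s \<ge> \<sigma>"
  shows "cmod (dirichlet_eval f s - (\<Sum>n=1..N. tw s f n)) \<le> infsum (\<lambda>n. cmod (f n) * real n powr (- \<sigma>)) {N<..}"
proof -
  have u: "{1..} = {1..N} \<union> {N<..}" by auto
  have sa: "(\<lambda>n. norm (tw s f n)) summable_on {1..}"
    using dabs_mono[OF assms] l1_tw unfolding l1_def by blast
  have sN: "(\<lambda>n. norm (tw s f n)) summable_on {N<..}"
    by (rule summable_on_subset_banach[OF sa]) auto
  have sg: "(\<lambda>n. cmod (f n) * real n powr (- \<sigma>)) summable_on {N<..}"
    using assms(1) unfolding dabs_def by (rule summable_on_subset_banach) auto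
  have "dirichlet_eval f s = (\<Sum>n=1..N. tw s f n) + infsum (tw s f) {N<..}"
    unfolding dirichlet_eval_tw
    by (subst u, subst infsum_Un_disjoint) (use abs_summable_summable[OF sN] in auto)
  then have "cmod (dirichlet_eval f s - (\<Sum>n=1..N. tw s f n)) = cmod (infsum (tw s f) {N<..})" by simp
  also have "\<dots> \<le> infsum (\<lambda>n. norm (tw s f n)) {N<..}" by (rule norm_infsum_bound[OF sN])
  also have "\<dots> \<le> infsum (\<lambda>n. cmod (f n) * real n powr (- \<sigma>)) {N<..}"
    by (rule infsum_mono[OF sN sg]) (use assms(2) in \<open>auto simp: norm_tw intro!: mult_left_mono powr_mono\<close>)
  finally show ?thesis .
qed

lemma dirichlet_eval_bound:
  assumes "dabs f \<sigma>" "Re s \<ge> \<sigma>"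
  shows "cmod (dirichlet_eval f s) \<le> infsum (\<lambda>n. cmod (f n) * real n powr (- \<sigma>)) {1..}"
proof -
  have "{0<..} = {1::nat..}" by auto
  then show ?thesis using dirichlet_eval_partial[OF assms, of 0] by simp
qed

lemma summable_tail_tendsto:
  fixes g :: "nat \<Rightarrow> real"
  assumes "\<And>n. g n \<ge> 0" "g summable_on {1..}"
  shows "(\<lambda>N. infsum g {N<..}) \<longlonglongrightarrow> 0"
proof (rule LIMSEQ_I)
  fix e :: real assume e: "e > 0"
  obtain N where N: "infsum g {N<..} < e" using summable_tail_small[OF assms e, of 0] by blast
  have "norm (infsum g {n<..} - 0) < e" if "n \<ge> N" for n
  proof -
    have s: "g summable_on {k<..}" for k by (rule summable_on_subset_banach[OF assms(2)]) auto
    have "infsum g {n<..} \<le> infsum g {N<..}"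
      by (rule infsum_mono2[OF s s]) (use that assms(1) in auto)
    then show ?thesis using N infsum_nonneg[of "{n<..}" g] assms(1) by simp
  qed
  then show "\<exists>no. \<forall>n\<ge>no. norm (infsum g {n<..} - 0) < e" by blast
qed

lemma dirichlet_eval_uniform_limit:
  assumes "dabs f \<sigma>" "A \<subseteq> {s. Re s \<ge> \<sigma>}"
  shows "uniform_limit A (\<lambda>N s. \<Sum>n=1..N. tw s f n) (dirichlet_eval f) sequentially"
proof (rule uniform_limitI)
  fix e :: real assume "e > 0"
  then have "\<forall>\<^sub>F N in sequentially. infsum (\<lambda>n. cmod (f n) * real n powr (- \<sigma>)) {N<..} < e"
    using order_tendstoD(2)[OF summable_tail_tendsto[of "\<lambda>n. cmod (f n) * real n powr (- \<sigma>)"]] assms(1)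
    unfolding dabs_def by auto
  then show "\<forall>\<^sub>F N in sequentially. \<forall>s\<in>A. dist (\<Sum>n=1..N. tw s f n) (dirichlet_eval f s) < e"
  proof eventually_elim
    case (elim N)
    show ?case
    proof
      fix s assume "s \<in> A"
      then have "Re s \<ge> \<sigma>" using assms(2) by auto
      from dirichlet_eval_partial[OF assms(1) this, of N] elim
      show "dist (\<Sum>n=1..N. tw s f n) (dirichlet_eval f s) < e" by (simp add: dist_norm norm_minus_commute)
    qed
  qed
qed

lemma holomorphic_tw: "(\<lambda>s. \<Sum>n=1..N. tw s f n) holomorphic_on A"
  unfolding tw_def by (intro holomorphic_intros) auto

lemma holomorphic_dirichlet_eval:
  assumes "\<And>\<sigma>. \<sigma> > \<sigma>0 \<Longrightarrow> dabs f \<sigma>"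
  shows "dirichlet_eval f holomorphic_on {s. Re s > \<sigma>0}"
proof (rule holomorphic_uniform_sequence[OF open_halfspace_Re_gt holomorphic_tw])
  fix x assume x: "x \<in> {s. Re s > \<sigma>0}"
  define d where "d = (Re x - \<sigma>0) / 2"
  have d: "d > 0" using x by (simp add: d_def)
  have sub: "cball x d \<subseteq> {s. Re s \<ge> \<sigma>0 + d}"
  proof
    fix y assume "y \<in> cball x d"
    then have "Re (x - y) \<le> d" using complex_Re_le_cmod[of "x - y"] by (simp add: dist_norm)
    then show "y \<in> {s. Re s \<ge> \<sigma>0 + d}" by (simp add: d_def field_simps)
  qed
  then show "\<exists>d>0. cball x d \<subseteq> {s. Re s > \<sigma>0} \<and> uniform_limit (cball x d) (\<lambda>N s. \<Sum>n=1..N. tw s f n) (dirichlet_eval f) sequentially"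
    using d dirichlet_eval_uniform_limit[OF assms sub] by (intro exI[of _ d]) auto
qed

text \<open>For \<open>n \<ge> 2\<close> each term decays at least like a power of 2, so the series
  approaches its constant term as \<open>Re s\<close> grows, at a rate independent of
  \<open>Im s\<close>.\<close>

lemma dirichlet_eval_first_coeff:
  assumes "dabs f \<sigma>0" "Re s \<ge> \<sigma>0"
  shows "cmod (dirichlet_eval f s - f 1) \<le> infsum (\<lambda>n. cmod (f n) * real n powr (- \<sigma>0)) {1..} * 2 powr (- (Re s - \<sigma>0))"
proof -
  let ?g = "\<lambda>n. cmod (f n) * real n powr (- \<sigma>0)"
  have s: "?g summable_on {1..}" using assms(1) unfolding dabs_def .
  have s1: "?g summable_on {1<..}" by (rule summable_on_subset_banach[OF s]) auto
  have "cmod (dirichlet_eval f s - (\<Sum>n=1..1. tw s f n)) \<le> infsum (\<lambda>n. cmod (f n) * real n powr (- Re s)) {1<..}"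
    by (rule dirichlet_eval_partial[OF dabs_mono[OF assms]]) simp
  also have "\<dots> \<le> infsum (\<lambda>n. ?g n * 2 powr (- (Re s - \<sigma>0))) {1<..}"
  proof (rule infsum_mono)
    show "(\<lambda>n. cmod (f n) * real n powr (- Re s)) summable_on {1<..}"
      using dabs_mono[OF assms] unfolding dabs_def by (rule summable_on_subset_banach) auto
    show "(\<lambda>n. ?g n * 2 powr (- (Re s - \<sigma>0))) summable_on {1<..}" by (rule summable_on_cmult_left[OF s1])
    fix n :: nat assume n: "n \<in> {1<..}"
    have "real n powr (- Re s) = real n powr (- \<sigma>0) * real n powr (- (Re s - \<sigma>0))"
      using n by (simp add: powr_add[symmetric])
    also have "real n powr (- (Re s - \<sigma>0)) \<le> 2 powr (- (Re s - \<sigma>0))"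
      using n assms(2) by (intro powr_mono2') auto
    finally show "cmod (f n) * real n powr (- Re s) \<le> ?g n * 2 powr (- (Re s - \<sigma>0))"
      by (simp add: mult_left_mono mult.assoc)
  qed
  also have "\<dots> = infsum ?g {1<..} * 2 powr (- (Re s - \<sigma>0))" by (rule infsum_cmult_left') 
  also have "\<dots> \<le> infsum ?g {1..} * 2 powr (- (Re s - \<sigma>0))"
    by (intro mult_right_mono infsum_mono2[OF s1 s]) auto
  finally show ?thesis by (simp add: tw_def)
qed

text \<open>The Bessel bound applied to \<open>H = 0\<close> and \<open>M = 0\<close> forces every
  coefficient to vanish.\<close>

lemma dirichlet_eval_unique:
  assumes "dabs f \<sigma>" "\<And>s. Re s \<ge> \<sigma> \<Longrightarrow> dirichlet_eval f s = 0" "n \<ge> 1"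
  shows "f n = 0"
proof -
  have "(\<Sum>n=1..n. (cmod (f n))\<^sup>2) \<le> 0\<^sup>2"
    by (rule bounded_dirichlet_coefficients[of "\<lambda>s. 0" _ _ "max \<sigma> 1"])
      (use dabs_mono[OF assms(1), of "max \<sigma> 1"] assms(2) in \<open>auto simp: dabs_def\<close>)
  moreover have "(cmod (f n))\<^sup>2 \<le> (\<Sum>n=1..n. (cmod (f n))\<^sup>2)"
    using assms(3) by (intro member_le_sum) auto
  ultimately have "(cmod (f n))\<^sup>2 \<le> 0\<^sup>2" by (rule order_trans[rotated])
  then show ?thesis by simp
qed

section \<open>Square summable series and bounded multipliers\<close>

lemma powr_summable_on:
  assumes "\<sigma> > 1" shows "(\<lambda>n. real n powr (- \<sigma>)) summable_on {1..}"
proof -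
  have "summable (\<lambda>n. real n powr (- \<sigma>))" using assms by (simp add: summable_real_powr_iff)
  then have "(\<lambda>n. real n powr (- \<sigma>)) summable_on UNIV" by (subst summable_on_UNIV_nonneg_real_iff) auto
  then show ?thesis by (rule summable_on_subset_banach) auto
qed

lemma H2_dabs:
  assumes "x \<in> H2" "\<sigma> > 1/2" shows "dabs x \<sigma>"
proof -
  have "(\<lambda>n. of_real (real n powr (- \<sigma>)) :: complex) \<in> H2"
  proof -
    have "(\<lambda>n. real n powr (- (2 * \<sigma>))) summable_on {1..}" by (rule powr_summable_on) (use assms(2) in auto)
    then have "(\<lambda>n. (cmod (of_real (real n powr (- \<sigma>))))\<^sup>2) summable_on {1..}"
      by (simp add: power2_eq_square powr_add[symmetric])
    then show ?thesis unfolding H2_def by simp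
  qed
  from H2_cauchy_schwarz(1)[OF assms(1) this] show ?thesis
    by (simp add: dabs_def norm_mult)
qed

text \<open>The series has to represent \<open>H\<close> only far to the right. Boundedness of
  \<open>H\<close> puts the coefficients in \<open>H2\<close>, so the series converges for
  \<open>Re s > 1/2\<close>, and the identity theorem extends the equality to there. A supremum
  bound thereby becomes a norm bound.\<close>

lemma Hinf_I:
  assumes hol: "H holomorphic_on {s. Re s > 0}" and M: "\<And>s. Re s > 0 \<Longrightarrow> cmod (H s) \<le> M"
    and abs: "dabs g \<sigma>1" and H: "\<And>s. Re s \<ge> \<sigma>1 \<Longrightarrow> Re s > 0 \<Longrightarrow> H s = dirichlet_eval g s"
  shows "g \<in> H2" "h2_norm g \<le> M" "g \<in> Hinf"
proof -
  have M0: "M \<ge> 0" using order_trans[OF norm_ge_zero M[of 1]] by simp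
  define \<sigma>2 where "\<sigma>2 = max \<sigma>1 1"
  have \<sigma>2: "\<sigma>2 \<ge> \<sigma>1" "\<sigma>2 \<ge> 1" by (auto simp: \<sigma>2_def)
  have "(\<Sum>n=1..N. (cmod (g n))\<^sup>2) \<le> M\<^sup>2" for N
    by (rule bounded_dirichlet_coefficients[OF hol M])
      (use dabs_mono[OF abs \<sigma>2(1)] \<sigma>2 H in \<open>auto simp: dabs_def\<close>)
  then show gH: "g \<in> H2" "h2_norm g \<le> M" using H2_I[of g M] M0 by auto
  have eq: "H s = dirichlet_eval g s" if "Re s > 1/2" for s
  proof (rule analytic_continuation_open[of "{s. Re s > \<sigma>2}" "{s. Re s > 1/2}" H "dirichlet_eval g"])
    show "H holomorphic_on {s. Re s > 1/2}" by (rule holomorphic_on_subset[OF hol]) auto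
    show "dirichlet_eval g holomorphic_on {s. Re s > 1/2}"
      by (rule holomorphic_dirichlet_eval) (rule H2_dabs[OF gH(1)])
    have "of_real (\<sigma>2 + 1) \<in> {s. Re s > \<sigma>2}" by simp
    then show "{s. Re s > \<sigma>2} \<noteq> {}" by blast
    show "open {s. Re s > \<sigma>2}" "open {s. Re s > 1/2}" "connected {s. Re s > 1/2}"
      by (intro open_halfspace_Re_gt convex_connected convex_halfspace_Re_gt)+
  qed (use \<sigma>2 H that in auto)
  show "g \<in> Hinf" unfolding Hinf_def
    using gH(1) hol eq M by (auto intro!: exI[of _ H] boundedI[of _ M])
qed

lemma HinfD:
  assumes "h \<in> Hinf"
  obtains H M where "h \<in> H2" "H holomorphic_on {s. Re s > 0}" "\<And>s. Re s > 0 \<Longrightarrow> cmod (H s) \<le> M"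
    "\<And>s. Re s > 1/2 \<Longrightarrow> H s = dirichlet_eval h s"
proof -
  obtain F where F: "h \<in> H2" "F holomorphic_on {s. Re s > 0}" "bounded (F ` {s. Re s > 0})"
    "\<forall>s. Re s > 1/2 \<longrightarrow> F s = dirichlet_eval h s" using assms unfolding Hinf_def by auto
  obtain M where "\<forall>x\<in>F ` {s. Re s > 0}. norm x \<le> M" using F(3) unfolding bounded_iff by blast
  then show ?thesis using that[OF F(1,2), of M] F(4) by auto
qed

lemma l1_Hinf:
  assumes "l1 h" shows "h \<in> Hinf"
proof -
  have d: "dabs h \<sigma>" if "\<sigma> \<ge> 0" for \<sigma> using assms dabs_0 dabs_mono that by blast
  show ?thesis
    by (rule Hinf_I(3)[of "dirichlet_eval h" _ h 0])
      (auto intro!: holomorphic_dirichlet_eval dirichlet_eval_bound[of h 0] d)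
qed

lemma dconv_l1_Hinf:
  assumes "l1 l" "h \<in> Hinf" shows "dconv l h \<in> Hinf"
proof -
  obtain H M where H: "h \<in> H2" "H holomorphic_on {s. Re s > 0}" "\<And>s. Re s > 0 \<Longrightarrow> cmod (H s) \<le> M"
    "\<And>s. Re s > 1/2 \<Longrightarrow> H s = dirichlet_eval h s" using HinfD[OF assms(2)] by metis
  have d: "dabs l \<sigma>" if "\<sigma> \<ge> 0" for \<sigma> using assms dabs_0 dabs_mono that by blast
  have dh: "dabs h \<sigma>" if "\<sigma> \<ge> 1" for \<sigma> using H2_dabs[OF H(1)] that by simp
  let ?K = "infsum (\<lambda>n. cmod (l n) * real n powr (- 0)) {1..}"
  have K: "?K \<ge> 0" by (rule infsum_nonneg) auto
  show ?thesis
  proof (rule Hinf_I(3)[of "\<lambda>s. dirichlet_eval l s * H s" "?K * M" _ 1])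
    show "(\<lambda>s. dirichlet_eval l s * H s) holomorphic_on {s. Re s > 0}"
      by (intro holomorphic_intros H holomorphic_dirichlet_eval d) auto
    show "cmod (dirichlet_eval l s * H s) \<le> ?K * M" if "Re s > 0" for s
      unfolding norm_mult using that d K by (intro mult_mono dirichlet_eval_bound H) auto
    show "dabs (dconv l h) 1" by (rule dabs_dconv) (auto intro: d dh)
    show "dirichlet_eval l s * H s = dirichlet_eval (dconv l h) s" if "Re s \<ge> 1" for s
      using that H(4)[of s] dirichlet_eval_dconv(2)[OF d dh, of s] by simp
  qed
qed

lemma Hinf_add:
  assumes "g \<in> Hinf" "h \<in> Hinf" shows "(\<lambda>n. g n + h n) \<in> Hinf"
proof -
  obtain H M where H: "h \<in> H2" "H holomorphic_on {s. Re s > 0}" "\<And>s. Re s > 0 \<Longrightarrow> cmod (H s) \<le> M"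
    "\<And>s. Re s > 1/2 \<Longrightarrow> H s = dirichlet_eval h s" using HinfD[OF assms(2)] by metis
  obtain G L where G: "g \<in> H2" "G holomorphic_on {s. Re s > 0}" "\<And>s. Re s > 0 \<Longrightarrow> cmod (G s) \<le> L"
    "\<And>s. Re s > 1/2 \<Longrightarrow> G s = dirichlet_eval g s" using HinfD[OF assms(1)] by metis
  have d: "dabs h \<sigma>" "dabs g \<sigma>" if "\<sigma> \<ge> 1" for \<sigma> using H2_dabs[OF H(1)] H2_dabs[OF G(1)] that by simp_all
  show ?thesis
  proof (rule Hinf_I(3)[of "\<lambda>s. G s + H s" "L + M" _ 1])
    show "(\<lambda>s. G s + H s) holomorphic_on {s. Re s > 0}" by (intro holomorphic_intros H G)
    show "cmod (G s + H s) \<le> L + M" if "Re s > 0" for s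
      by (rule order_trans[OF norm_triangle_ineq add_mono[OF G(3)[OF that] H(3)[OF that]]])
    show "dabs (\<lambda>n. g n + h n) 1" by (intro dabs_add d) auto
    show "G s + H s = dirichlet_eval (\<lambda>n. g n + h n) s" if "Re s \<ge> 1" for s
      using that H(4)[of s] G(4)[of s] dirichlet_eval_add[OF d(2) d(1), of s] by simp
  qed
qed

lemma Hinf_scale:
  assumes "h \<in> Hinf" shows "(\<lambda>n. c * h n) \<in> Hinf"
proof -
  obtain H M where H: "h \<in> H2" "H holomorphic_on {s. Re s > 0}" "\<And>s. Re s > 0 \<Longrightarrow> cmod (H s) \<le> M"
    "\<And>s. Re s > 1/2 \<Longrightarrow> H s = dirichlet_eval h s" using HinfD[OF assms] by metis
  have d: "dabs h 1" using H2_dabs[OF H(1)] by simp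
  show ?thesis
  proof (rule Hinf_I(3)[of "\<lambda>s. c * H s" "cmod c * M" _ 1])
    show "cmod (c * H s) \<le> cmod c * M" if "Re s > 0" for s
      unfolding norm_mult by (rule mult_left_mono[OF H(3)[OF that]]) simp
  qed (use H d in \<open>auto intro!: holomorphic_intros dabs_scale simp: dirichlet_eval_scale\<close>)
qed

section \<open>Dirichlet inverses\<close>

lemma dconv_commute: assumes "n \<ge> 1" shows "dconv f g n = dconv g f n"
  unfolding dconv_def
  by (rule sum.reindex_bij_witness[where i = "\<lambda>d. n div d" and j = "\<lambda>d. n div d"])
    (use assms in \<open>auto simp: mult.commute div_dvd_iff_mult\<close>)

lemma dconv_assoc:
  assumes "n \<ge> 1" shows "dconv (dconv f g) h n = dconv f (dconv g h) n"
proof -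
  have fin: "finite {d. d dvd m}" if "m dvd n" for m
    using assms divisor_pos[OF assms that] by (intro finite_divisors_nat) simp
  have fin': "finite {d. d dvd n div m}" if "m dvd n" for m
    using assms divisor_pos[OF assms that] by (intro finite_divisors_nat) simp
  have "dconv (dconv f g) h n = (\<Sum>(d, c)\<in>Sigma {d. d dvd n} (\<lambda>d. {c. c dvd d}). f c * g (d div c) * h (n div d))"
    unfolding dconv_def sum_distrib_right by (rule sum.Sigma) (use fin in auto)
  also have "\<dots> = (\<Sum>(c, m)\<in>Sigma {c. c dvd n} (\<lambda>c. {m. m dvd n div c}). f c * (g m * h (n div c div m)))"
  proof (rule sum.reindex_bij_witness[where j = "\<lambda>(d, c). (c, d div c)" and i = "\<lambda>(c, m). (c * m, c)"])
    fix x assume "x \<in> Sigma {d. d dvd n} (\<lambda>d. {c. c dvd d})"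
    then obtain d c where x: "x = (d, c)" "d dvd n" "c dvd d" by auto
    have c: "c \<ge> 1" "d \<ge> 1" using divisor_pos[OF divisor_pos(1)[OF assms x(2)] x(3)] divisor_pos[OF assms x(2)] by auto
    obtain k where k: "d = c * k" using x(3) by blast
    obtain l where l: "n = d * l" using x(2) by blast
    show "(case case x of (d, c) \<Rightarrow> (c, d div c) of (c, m) \<Rightarrow> (c * m, c)) = x" using x c by auto
    show "(case x of (d, c) \<Rightarrow> (c, d div c)) \<in> Sigma {c. c dvd n} (\<lambda>c. {m. m dvd n div c})"
      using x c k l by (auto simp: mult.assoc)
    show "(case case x of (d, c) \<Rightarrow> (c, d div c) of (c, m) \<Rightarrow> f c * (g m * h (n div c div m))) =
         (case x of (d, c) \<Rightarrow> f c * g (d div c) * h (n div d))"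
      using x c k l by (auto simp: mult.assoc)
  next
    fix x assume "x \<in> Sigma {c. c dvd n} (\<lambda>c. {m. m dvd n div c})"
    then obtain c m where x: "x = (c, m)" "c dvd n" "m dvd n div c" by auto
    have c: "c \<ge> 1" using divisor_pos[OF assms x(2)] by auto
    have cm: "c * m dvd n" using x c by (auto simp: dvd_div_iff_mult mult.commute)
    show "(case case x of (c, m) \<Rightarrow> (c * m, c) of (d, c) \<Rightarrow> (c, d div c)) = x" using x c by auto
    show "(case x of (c, m) \<Rightarrow> (c * m, c)) \<in> Sigma {d. d dvd n} (\<lambda>d. {c. c dvd d})" using x cm by auto
  qed
  also have "\<dots> = dconv f (dconv g h) n"
    unfolding dconv_def sum_distrib_left by (rule sum.Sigma[symmetric]) (use fin fin' assms in auto)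
  finally show ?thesis .
qed

lemma dconv_add_left: "dconv (\<lambda>n. f n + g n) h n = dconv f h n + dconv g h n"
  by (simp add: dconv_def distrib_right sum.distrib)

lemma dconv_scale_left: "dconv (\<lambda>n. c * f n) h n = c * dconv f h n"
  by (simp add: dconv_def sum_distrib_left mult.assoc)

lemma dconv_diff_right: "dconv f (\<lambda>n. g n - h n) n = dconv f g n - dconv f h n"
  by (simp add: dconv_def right_diff_distrib sum_subtractf)

definition dunit :: "nat \<Rightarrow> complex" where "dunit n = (if n = 1 then 1 else 0)"

lemma dconv_dunit_right:
  assumes "n \<ge> 1" shows "dconv f dunit n = f n"
proof -
  have "dconv f dunit n = (\<Sum>d\<in>{d. d dvd n}. if d = n then f n else 0)"
    unfolding dconv_def dunit_def
  proof (rule sum.cong)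
    fix d assume "d \<in> {d. d dvd n}"
    then obtain k where "n = d * k" by blast
    then show "f d * (if n div d = 1 then 1 else 0) = (if d = n then f n else 0)" using assms by auto
  qed simp
  also have "\<dots> = f n" using assms by (simp add: sum.delta)
  finally show ?thesis .
qed

lemma dunit_facts: "l1 dunit" "dunit \<in> H2" "h2_norm dunit \<le> 1" "dabs dunit \<sigma>" "dirichlet_eval dunit s = 1"
proof -
  have 1: "(\<Sum>n=1..N. (cmod (dunit n))\<^sup>2) \<le> 1\<^sup>2" for N
  proof -
    have "(\<Sum>n=1..N. (cmod (dunit n))\<^sup>2) = (\<Sum>n=1..N. if n = 1 then 1 else 0)"
      by (rule sum.cong) (auto simp: dunit_def)
    then show ?thesis by (simp add: sum.delta)
  qed
  then show "dunit \<in> H2" "h2_norm dunit \<le> 1" using H2_I[of dunit 1] by auto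
  have "(\<lambda>n. cmod (dunit n) * real n powr (- \<sigma>)) summable_on {1..}" for \<sigma>
    by (rule finite_nonzero_values_imp_summable_on) (rule finite_subset[of _ "{1}"], auto simp: dunit_def)
  then show "dabs dunit \<sigma>" for \<sigma> unfolding dabs_def .
  from this[of 0] show "l1 dunit" by (simp add: dabs_0)
  have "infsum (tw s dunit) {1..} = infsum (tw s dunit) {1}"
    by (rule infsum_cong_neutral) (auto simp: tw_def dunit_def)
  then show "dirichlet_eval dunit s = 1" by (simp add: dirichlet_eval_tw tw_def dunit_def)
qed

function dinv :: "(nat \<Rightarrow> complex) \<Rightarrow> nat \<Rightarrow> complex" where
  "dinv f n = (if n \<le> 1 then 1 / f 1 else - (\<Sum>d\<in>{d. d dvd n \<and> d < n}. f (n div d) * dinv f d) / f 1)"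
  by auto
termination by (relation "Wellfounded.measure snd") auto
declare dinv.simps[simp del]

lemma dconv_dinv:
  assumes "f 1 \<noteq> 0" "n \<ge> 1" shows "dconv f (dinv f) n = dunit n"
proof (cases "n = 1")
  case True
  then show ?thesis using assms by (simp add: dconv_def dunit_def dinv.simps[of f "Suc 0"])
next
  case False
  have "dconv f (dinv f) n = dconv (dinv f) f n" by (rule dconv_commute[OF assms(2)])
  also have "\<dots> = (\<Sum>d\<in>insert n {d. d dvd n \<and> d < n}. dinv f d * f (n div d))"
    unfolding dconv_def by (rule sum.cong) (use assms(2) in \<open>auto dest: dvd_imp_le\<close>)
  also have "\<dots> = dinv f n * f 1 + (\<Sum>d\<in>{d. d dvd n \<and> d < n}. f (n div d) * dinv f d)"
    using assms(2) by (subst sum.insert) (auto simp: mult.commute)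
  also have "dinv f n * f 1 = - (\<Sum>d\<in>{d. d dvd n \<and> d < n}. f (n div d) * dinv f d)"
    using False assms by (subst dinv.simps) auto
  finally show ?thesis using False by (simp add: dunit_def)
qed

text \<open>Strong induction: if \<open>n\<close> fails \<open>P\<close> and
  \<open>d \<noteq> 1\<close> satisfies it, then \<open>n div d\<close> is smaller and fails
  \<open>P\<close>, so only \<open>d = 1\<close> survives in the convolution. It will keep the
  inverse of a series over smooth integers on smooth integers.\<close>

lemma dirichlet_inverse_support:
  assumes inv: "\<And>n. n \<ge> 1 \<Longrightarrow> dconv f b n = dunit n" and f1: "f 1 \<noteq> 0"
    and P: "P 1" "\<And>m n. P m \<Longrightarrow> P n \<Longrightarrow> P (m * n)" and f: "\<And>n. n \<ge> 1 \<Longrightarrow> \<not> P n \<Longrightarrow> f n = 0"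
  shows "n \<ge> 1 \<Longrightarrow> \<not> P n \<Longrightarrow> b n = 0"
proof (induction n rule: less_induct)
  case (less n)
  have n: "n \<noteq> 1" using less.prems P by auto
  have "0 = dconv f b n" using inv[OF less.prems(1)] n by (simp add: dunit_def)
  also have "\<dots> = (\<Sum>d\<in>{d. d dvd n}. if d = 1 then f 1 * b n else 0)"
    unfolding dconv_def
  proof (rule sum.cong)
    fix d assume "d \<in> {d. d dvd n}"
    then have d: "d dvd n" by simp
    show "f d * b (n div d) = (if d = 1 then f 1 * b n else 0)"
    proof (cases "d = 1 \<or> \<not> P d")
      case True
      then show ?thesis using f divisor_pos(1)[OF less.prems(1) d] by auto
    next
      case False
      have "\<not> P (n div d)" using P(2)[of d "n div d"] False less.prems d by auto
      moreover have "n div d < n" using False less.prems divisor_pos(1)[OF less.prems(1) d] by (intro div_less_dividend) auto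
      ultimately have "b (n div d) = 0" using less.IH divisor_pos(2)[OF less.prems(1) d] by blast
      then show ?thesis using False by simp
    qed
  qed simp
  also have "\<dots> = f 1 * b n" using less.prems by (simp add: sum.delta)
  finally show ?case using f1 by simp
qed

lemma exp_decay_small:
  fixes K c \<sigma>0 :: real assumes "c > 0"
  shows "\<exists>R. \<forall>x\<ge>R. K * 2 powr (- (x - \<sigma>0)) \<le> c"
proof -
  have "((\<lambda>x::real. K * 2 powr (- (x - \<sigma>0))) \<longlongrightarrow> 0) at_top" by real_asymp
  then have "eventually (\<lambda>x. K * 2 powr (- (x - \<sigma>0)) < c) at_top" using assms by (rule order_tendstoD(2))
  then show ?thesis unfolding eventually_at_top_linorder using less_imp_le by metis
qed

text \<open>Once \<open>\<kappa>\<close> is so large that the terms beyond the first sum to at most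
  \<open>cmod (f 1)\<close>, the recursion preserves the bound
  \<open>n powr \<kappa> / cmod (f 1)\<close>. Such a crude abscissa suffices to identify the
  inverse series with the reciprocal on some half-plane.\<close>

lemma dabs_dinv:
  assumes f: "dabs f \<sigma>0" and f1: "f 1 \<noteq> 0"
  shows "\<exists>\<kappa>. dabs (dinv f) \<kappa>"
proof -
  let ?K = "infsum (\<lambda>n. cmod (f n) * real n powr (- \<sigma>0)) {1..}"
  obtain R where R: "\<And>x. x \<ge> R \<Longrightarrow> ?K * 2 powr (- (x - \<sigma>0)) \<le> cmod (f 1)"
    using exp_decay_small[of "cmod (f 1)" ?K \<sigma>0] f1 by auto
  define \<kappa> where "\<kappa> = max R \<sigma>0"
  have \<kappa>: "\<kappa> \<ge> \<sigma>0" "\<kappa> \<ge> R" by (auto simp: \<kappa>_def)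
  let ?g = "\<lambda>n. of_real (cmod (f n)) :: complex"
  have "dabs ?g \<sigma>0" using f by (simp add: dabs_def)
  then have dg: "dabs ?g \<kappa>" by (rule dabs_mono[OF _ \<kappa>(1)])
  have small: "(\<Sum>d\<in>D. cmod (f d) * real d powr (- \<kappa>)) \<le> cmod (f 1)" if D: "finite D" "D \<subseteq> {1<..}" for D
  proof -
    have "(\<Sum>d\<in>D. cmod (f d) * real d powr (- \<kappa>)) \<le> (\<Sum>d\<in>D. cmod (f d) * real d powr (- \<sigma>0) * 2 powr (- (\<kappa> - \<sigma>0)))"
    proof (rule sum_mono)
      fix d assume d: "d \<in> D"
      have "real d powr (- \<kappa>) = real d powr (- \<sigma>0) * real d powr (- (\<kappa> - \<sigma>0))"
        by (simp add: powr_add[symmetric])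
      also have "real d powr (- (\<kappa> - \<sigma>0)) \<le> 2 powr (- (\<kappa> - \<sigma>0))"
        using d D \<kappa> by (intro powr_mono2') auto
      finally show "cmod (f d) * real d powr (- \<kappa>) \<le> cmod (f d) * real d powr (- \<sigma>0) * 2 powr (- (\<kappa> - \<sigma>0))"
        by (simp add: mult_left_mono mult.assoc)
    qed
    also have "\<dots> = (\<Sum>d\<in>D. cmod (f d) * real d powr (- \<sigma>0)) * 2 powr (- (\<kappa> - \<sigma>0))" by (simp add: sum_distrib_right)
    also have "\<dots> \<le> ?K * 2 powr (- (\<kappa> - \<sigma>0))"
      using f D unfolding dabs_def by (intro mult_right_mono finite_sum_le_infsum) auto
    also have "\<dots> \<le> cmod (f 1)" by (rule R[OF \<kappa>(2)])
    finally show ?thesis .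
  qed
  have bound: "cmod (dinv f n) \<le> 1 / cmod (f 1) * real n powr \<kappa>" if "n \<ge> 1" for n
    using that
  proof (induction n rule: less_induct)
    case (less n)
    show ?case
    proof (cases "n = 1")
      case True
      then show ?thesis by (simp add: dinv.simps[of f "Suc 0"] norm_divide)
    next
      case False
      let ?D = "{d. d dvd n \<and> d < n}"
      have "dinv f n = - (\<Sum>d\<in>?D. f (n div d) * dinv f d) / f 1"
        using False less.prems by (subst dinv.simps) auto
      then have "cmod (dinv f n) = cmod (\<Sum>d\<in>?D. f (n div d) * dinv f d) / cmod (f 1)"
        by (simp only: norm_divide norm_minus_cancel)
      also have "cmod (\<Sum>d\<in>?D. f (n div d) * dinv f d) \<le> (\<Sum>d\<in>?D. (cmod (f (n div d)) * real (n div d) powr (- \<kappa>)) * (1 / cmod (f 1) * real n powr \<kappa>))"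
      proof (rule order_trans[OF norm_sum sum_mono])
        fix d assume d: "d \<in> ?D"
        then have dn: "d dvd n" "d < n" by auto
        have d1: "d \<ge> 1" "n div d \<ge> 1" using divisor_pos[OF less.prems dn(1)] by auto
        have "real n = real (n div d) * real d" using dn by (simp flip: of_nat_mult)
        then have "real n powr \<kappa> = real (n div d) powr \<kappa> * real d powr \<kappa>" by (simp add: powr_mult)
        then have e: "real (n div d) powr (- \<kappa>) * real n powr \<kappa> = real d powr \<kappa>"
          using d1 by (simp add: powr_minus field_simps)
        have "cmod (f (n div d) * dinv f d) \<le> cmod (f (n div d)) * (1 / cmod (f 1) * real d powr \<kappa>)"
          unfolding norm_mult by (rule mult_left_mono[OF less.IH[OF dn(2) d1(1)]]) simp
        also have "\<dots> = (cmod (f (n div d)) * real (n div d) powr (- \<kappa>)) * (1 / cmod (f 1) * real n powr \<kappa>)"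
          unfolding e[symmetric] by simp
        finally show "cmod (f (n div d) * dinv f d) \<le> (cmod (f (n div d)) * real (n div d) powr (- \<kappa>)) * (1 / cmod (f 1) * real n powr \<kappa>)" .
      qed
      also have "\<dots> = (\<Sum>d\<in>?D. cmod (f (n div d)) * real (n div d) powr (- \<kappa>)) * (1 / cmod (f 1) * real n powr \<kappa>)"
        by (rule sum_distrib_right[symmetric])
      also have "(\<Sum>d\<in>?D. cmod (f (n div d)) * real (n div d) powr (- \<kappa>)) = (\<Sum>d\<in>(\<lambda>d. n div d) ` ?D. cmod (f d) * real d powr (- \<kappa>))"
      proof (rule sum.reindex_cong[symmetric, where l = "\<lambda>d. n div d"])
        show "inj_on (\<lambda>d. n div d) ?D"
        proof (rule inj_onI)
          fix x y assume "x \<in> ?D" "y \<in> ?D" "n div x = n div y"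
          then show "x = y" using less.prems
            by (metis (no_types, lifting) div_div_eq_right div_mult_self1_is_m dvd_div_mult_self gr0I mem_Collect_eq mult_eq_0_iff nat_mult_eq_cancel1 not_one_le_zero)
        qed
      qed auto
      also have "\<dots> \<le> cmod (f 1)"
      proof (rule small)
        show "(\<lambda>d. n div d) ` ?D \<subseteq> {1<..}"
        proof (rule image_subsetI)
          fix d assume "d \<in> ?D"
          then have d: "d dvd n" "d < n" by auto
          then obtain k where "n = d * k" by blast
          then show "n div d \<in> {1<..}" using d less.prems by (cases "k = 0"; cases "k = 1") auto
        qed
      qed (use less.prems in auto)
      finally show ?thesis using f1 by (simp add: divide_right_mono mult_right_mono field_simps)
    qed
  qed
  \<comment> \<open>The additional 2 leaves the summable weight \<open>n powr (- 2)\<close>.\<close>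
  have "dabs (dinv f) (\<kappa> + 2)" unfolding dabs_def
  proof (rule summable_on_comparison_test)
    show "(\<lambda>n. 1 / cmod (f 1) * real n powr (- 2)) summable_on {1..}"
      by (intro summable_on_cmult_right powr_summable_on) auto
    fix n :: nat assume n: "n \<in> {1..}"
    have "cmod (dinv f n) * real n powr (- (\<kappa> + 2)) \<le> (1 / cmod (f 1) * real n powr \<kappa>) * real n powr (- (\<kappa> + 2))"
      by (rule mult_right_mono[OF bound]) (use n in auto)
    also have "\<dots> = 1 / cmod (f 1) * real n powr (- 2)" by (simp add: powr_add[symmetric])
    finally show "cmod (dinv f n) * real n powr (- (\<kappa> + 2)) \<le> 1 / cmod (f 1) * real n powr (- 2)" .
  qed auto
  then show ?thesis by blast
qed

section \<open>A sufficient criterion for cyclicity\<close>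

lemma dirichlet_large_lower:
  assumes f: "dabs f \<sigma>0" and f1: "f 1 \<noteq> 0"
  shows "\<exists>R. R \<ge> r \<and> (\<forall>s. Re s \<ge> R \<longrightarrow> cmod (f 1) / 2 \<le> cmod (dirichlet_eval f s))"
proof -
  let ?K = "infsum (\<lambda>n. cmod (f n) * real n powr (- \<sigma>0)) {1..}"
  obtain R where R: "\<And>x. x \<ge> R \<Longrightarrow> ?K * 2 powr (- (x - \<sigma>0)) \<le> cmod (f 1) / 2"
    using exp_decay_small[of "cmod (f 1) / 2" ?K \<sigma>0] f1 by auto
  have "cmod (f 1) / 2 \<le> cmod (dirichlet_eval f s)" if s: "Re s \<ge> max r (max R \<sigma>0)" for s
  proof -
    have "cmod (dirichlet_eval f s - f 1) \<le> cmod (f 1) / 2"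
      using dirichlet_eval_first_coeff[OF f, of s] R[of "Re s"] s by simp
    moreover have "cmod (f 1) \<le> cmod (dirichlet_eval f s) + cmod (dirichlet_eval f s - f 1)"
      using norm_triangle_ineq4[of "dirichlet_eval f s" "dirichlet_eval f s - f 1"] by simp
    ultimately show ?thesis by linarith
  qed
  then show ?thesis by (intro exI[of _ "max r (max R \<sigma>0)"]) auto
qed

lemma ball_Re:
  assumes "z \<in> ball c r" shows "Re z > Re c - r"
  using assms complex_Re_le_cmod[of "c - z"] by (simp add: dist_norm)

text \<open>A point with \<open>\<delta> \<le> Re s < R\<close> lies in a disc centred at the same
  height on \<open>Re s = R\<close>. With radius \<open>R - \<delta>/2\<close> the disc stays in
  \<open>Re s > \<delta>/2\<close>, where the series is bounded and zero-free, and its size does not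
  depend on the height.\<close>

lemma dirichlet_lower_bound:
  assumes f: "\<And>\<sigma>. \<sigma> > 0 \<Longrightarrow> dabs f \<sigma>" and f1: "f 1 \<noteq> 0"
    and nz: "\<And>s. Re s > 0 \<Longrightarrow> dirichlet_eval f s \<noteq> 0" and d: "\<delta> > 0"
  shows "\<exists>m>0. \<forall>s. Re s \<ge> \<delta> \<longrightarrow> m \<le> cmod (dirichlet_eval f s)"
proof -
  let ?M = "infsum (\<lambda>n. cmod (f n) * real n powr (- (\<delta>/2))) {1..}"
  let ?m = "cmod (f 1) / 2"
  have d2: "dabs f (\<delta>/2)" using f d by simp
  obtain R where R: "R \<ge> \<delta>" "\<And>s. Re s \<ge> R \<Longrightarrow> ?m \<le> cmod (dirichlet_eval f s)"
    using dirichlet_large_lower[OF d2 f1, of \<delta>] by blast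
  let ?q = "?m * exp (- (2 * (R - \<delta>) / ((R - \<delta>/2) - (R - \<delta>)) * ln (?M / ?m)))"
  have hol: "dirichlet_eval f holomorphic_on {s. Re s > 0}" by (rule holomorphic_dirichlet_eval[OF f])
  have m: "?m > 0" using f1 by simp
  have "min ?m ?q \<le> cmod (dirichlet_eval f s)" if s: "Re s \<ge> \<delta>" for s
  proof (cases "Re s \<ge> R")
    case True
    then show ?thesis using R(2)[of s] by simp
  next
    case False
    let ?c = "Complex R (Im s)"
    have b: "Re z > \<delta>/2" if "z \<in> ball ?c (R - \<delta>/2)" for z using ball_Re[OF that] by simp
    have "?q \<le> cmod (dirichlet_eval f s)"
    proof (rule zero_free_disc_lower_bound[where f = "dirichlet_eval f" and z = s and c = ?c and R = "R - \<delta>/2"])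
      show "dirichlet_eval f holomorphic_on ball ?c (R - \<delta>/2)"
        by (rule holomorphic_on_subset[OF hol]) (use b d in force)
      show "dirichlet_eval f z \<noteq> 0" if "z \<in> ball ?c (R - \<delta>/2)" for z using nz[of z] b[OF that] d by simp
      show "cmod (dirichlet_eval f z) \<le> ?M" if "z \<in> ball ?c (R - \<delta>/2)" for z
        using dirichlet_eval_bound[OF d2, of z] b[OF that] by simp
      show "?m \<le> cmod (dirichlet_eval f ?c)" by (rule R(2)) simp
      have "s - ?c = of_real (Re s - R)" by (simp add: complex_eq_iff)
      then show "cmod (s - ?c) \<le> R - \<delta>" using False s by (simp only: norm_of_real)
      show "R - \<delta> < R - \<delta>/2" using d by simp
    qed (use m in auto)
    then show ?thesis by simp
  qed
  then show ?thesis using m by (intro exI[of _ "min ?m ?q"]) auto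
qed

text \<open>Discs centred far to the right cross \<open>Re s = 0\<close> but stay in
  \<open>Re s > - \<eta>\<close>, where the series is bounded. All its zeros have real part at most
  0, so moving a point of the right half-plane by \<open>\<delta>\<close> to the right takes it
  further from each of them, as \<open>disc_ratio_bound\<close> demands.\<close>

lemma dirichlet_ratio_bound:
  assumes f: "dabs f (- \<eta>)" and eta: "\<eta> > 0" and f1: "f 1 \<noteq> 0"
    and nz: "\<And>s. Re s > 0 \<Longrightarrow> dirichlet_eval f s \<noteq> 0"
  shows "\<exists>C. \<forall>s \<delta>. Re s > 0 \<longrightarrow> 0 < \<delta> \<longrightarrow> \<delta> \<le> 1 \<longrightarrow>
           cmod (dirichlet_eval f s) \<le> C * cmod (dirichlet_eval f (s + of_real \<delta>))"
proof -
  let ?M = "infsum (\<lambda>n. cmod (f n) * real n powr (- (-\<eta>))) {1..}"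
  let ?m = "cmod (f 1) / 2"
  obtain R where R: "R \<ge> 1" "\<And>s. Re s \<ge> R \<Longrightarrow> ?m \<le> cmod (dirichlet_eval f s)"
    using dirichlet_large_lower[OF f f1, of 1] by blast
  have m: "?m > 0" using f1 by simp
  \<comment> \<open>The extra 1 keeps \<open>s + of_real \<delta>\<close> within radius
    \<open>R2\<close>, since \<open>\<delta> \<le> 1\<close>. The radii \<open>R1\<close> and
    \<open>R0\<close> reach past \<open>Re s = 0\<close> by one third and two thirds of
    \<open>\<eta>\<close>.\<close>
  define R2 where "R2 = R + 1"
  define R1 where "R1 = R2 + \<eta>/3"
  define R0 where "R0 = R2 + 2*\<eta>/3"
  have RR: "0 < R2" "R2 < R1" "R1 < R0" using R eta by (auto simp: R2_def R1_def R0_def)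
  \<comment> \<open>\<open>?M\<close> and \<open>?m\<close> serve discs at every height, so one
    \<open>N\<close> and hence one \<open>C\<close> serve them all.\<close>
  obtain N where "?M / ?m < (R0 / R1) ^ N" using real_arch_pow[of "R0 / R1" "?M / ?m"] RR by auto
  then have N: "?M < ?m * (R0 / R1) ^ N" using m f1 by (simp add: field_simps)
  obtain C where "\<forall>f m s s'. f holomorphic_on cball 0 R0 \<longrightarrow> (\<forall>z\<in>cball 0 R0. cmod (f z) \<le> ?M) \<longrightarrow> ?m \<le> m \<longrightarrow>
     m \<le> cmod (f 0) \<longrightarrow> ?M < m * (R0 / R1) ^ N \<longrightarrow> s \<in> cball 0 R2 \<longrightarrow> s' \<in> cball 0 R2 \<longrightarrow>
     (\<forall>\<rho>\<in>cball 0 R1. f \<rho> = 0 \<longrightarrow> cmod (s - \<rho>) \<le> cmod (s' - \<rho>)) \<longrightarrow> cmod (f s) \<le> C * cmod (f s')"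
    using disc_ratio_bound[OF RR m, of ?M N] by (rule exE)
  note C = this[rule_format]
  have up: "cmod (dirichlet_eval f s) \<le> ?M" if "Re s \<ge> - \<eta>" for s by (rule dirichlet_eval_bound[OF f that])
  have M0: "?M \<ge> 0" by (rule infsum_nonneg) auto
  have hol: "dirichlet_eval f holomorphic_on {s. Re s > - \<eta>}"
    by (rule holomorphic_dirichlet_eval) (rule dabs_mono[OF f], simp)
  have "cmod (dirichlet_eval f s) \<le> max (?M / ?m) C * cmod (dirichlet_eval f (s + of_real \<delta>))"
    if s: "Re s > 0" "0 < \<delta>" "\<delta> \<le> 1" for s \<delta>
  proof (cases "Re s \<ge> R")
    case True
    have "cmod (dirichlet_eval f s) \<le> ?M / ?m * ?m" using up[of s] s eta m f1 by simp
    also have "\<dots> \<le> ?M / ?m * cmod (dirichlet_eval f (s + of_real \<delta>))"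
      using True s M0 m by (intro mult_left_mono R(2)) auto
    also have "\<dots> \<le> max (?M / ?m) C * cmod (dirichlet_eval f (s + of_real \<delta>))" by (intro mult_right_mono) auto
    finally show ?thesis .
  next
    case False
    define c where "c = Complex R2 (Im s)"
    define g where "g z = dirichlet_eval f (c + z)" for z
    have b: "Re (c + z) > - \<eta>" if "z \<in> cball 0 R0" for z
      using that complex_Re_le_cmod[of "- z"] eta by (simp add: c_def R0_def)
    have e: "s - c = of_real (Re s - R2)" "s + of_real \<delta> - c = of_real (Re s + \<delta> - R2)"
      by (simp_all add: complex_eq_iff c_def)
    have "cmod (g (s - c)) \<le> C * cmod (g (s + of_real \<delta> - c))"
    proof (rule C[of g ?m])
      show "g holomorphic_on cball 0 R0"
      proof -
        have "(dirichlet_eval f \<circ> (\<lambda>z. c + z)) holomorphic_on cball 0 R0"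
        proof (rule holomorphic_on_compose_gen[OF _ hol])
          show "(\<lambda>z. c + z) ` cball 0 R0 \<subseteq> {s. Re s > - \<eta>}"
            by (rule image_subsetI, rule CollectI, rule b)
        qed (intro holomorphic_intros)
        then show ?thesis by (simp add: g_def[abs_def] o_def)
      qed
      show "cmod (g z) \<le> ?M" if "z \<in> cball 0 R0" for z unfolding g_def using up[of "c + z"] b[OF that] by simp
      show "?m \<le> cmod (g 0)" unfolding g_def by (rule R(2)) (simp add: c_def R2_def)
      show "s - c \<in> cball 0 R2" "s + of_real \<delta> - c \<in> cball 0 R2"
        unfolding e mem_cball_0 norm_of_real abs_le_iff using s False R by (auto simp: R2_def)
      fix z assume z: "z \<in> cball 0 R1" "g z = 0"
      have zr: "Re (c + z) \<le> 0" by (rule ccontr) (use nz[of "c + z"] z(2) in \<open>simp add: g_def\<close>)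
      have "(cmod (s - c - z))\<^sup>2 \<le> (cmod (s + of_real \<delta> - c - z))\<^sup>2"
        unfolding cmod_power2 using zr s by (auto intro!: power_mono)
      then show "cmod (s - c - z) \<le> cmod (s + of_real \<delta> - c - z)"
        by (rule power2_le_imp_le) simp
    qed (use N in auto)
    then have "cmod (dirichlet_eval f s) \<le> C * cmod (dirichlet_eval f (s + of_real \<delta>))" by (simp add: g_def)
    also have "\<dots> \<le> max (?M / ?m) C * cmod (dirichlet_eval f (s + of_real \<delta>))" by (intro mult_right_mono) auto
    finally show ?thesis .
  qed
  then show ?thesis by blast
qed

lemma dirichlet_eval_inverse:
  assumes "dabs f (Re s)" "dabs b (Re s)" "\<And>n. n \<ge> 1 \<Longrightarrow> dconv f b n = dunit n"
  shows "dirichlet_eval f s * dirichlet_eval b s = 1"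
proof -
  have "dirichlet_eval (dconv f b) s = dirichlet_eval dunit s" by (rule dirichlet_eval_cong[OF assms(3)])
  then show ?thesis using dirichlet_eval_dconv(2)[OF assms(1,2)] dunit_facts(5)[of s] by simp
qed

section \<open>Translates of the inverse as multipliers\<close>

lemma translate_holomorphic:
  assumes "g holomorphic_on {s. Re s > 0}" "\<delta> \<ge> 0"
  shows "(\<lambda>s. g (s + of_real \<delta>)) holomorphic_on {s. Re s > 0}"
proof -
  have "(g \<circ> (\<lambda>s. s + of_real \<delta>)) holomorphic_on {s. Re s > 0}"
    by (rule holomorphic_on_compose_gen[OF _ assms(1)]) (use assms(2) in \<open>auto intro!: holomorphic_intros\<close>)
  then show ?thesis by (simp add: o_def)
qed

text \<open>The lower bound on \<open>Re s \<ge> \<delta>\<close> makes the translated reciprocal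
  bounded. It is compared with the series of \<open>b\<close> only where \<open>b\<close> converges
  absolutely; \<open>Hinf_I\<close> does the rest.\<close>

lemma inverse_translate_Hinf:
  assumes f: "\<And>\<sigma>. \<sigma> > 0 \<Longrightarrow> dabs f \<sigma>" and f1: "f 1 \<noteq> 0"
    and nz: "\<And>s. Re s > 0 \<Longrightarrow> dirichlet_eval f s \<noteq> 0" and d: "\<delta> > 0"
    and b: "dabs b \<kappa>" and inv: "\<And>n. n \<ge> 1 \<Longrightarrow> dconv f b n = dunit n"
  shows "tw (of_real \<delta>) b \<in> Hinf"
proof -
  obtain m where m: "m > 0" "\<And>s. Re s \<ge> \<delta> \<Longrightarrow> m \<le> cmod (dirichlet_eval f s)"
    using dirichlet_lower_bound[OF f f1 nz d] by blast
  let ?H = "\<lambda>s. 1 / dirichlet_eval f (s + of_real \<delta>)"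
  have hol: "dirichlet_eval f holomorphic_on {s. Re s > 0}" by (rule holomorphic_dirichlet_eval[OF f])
  show ?thesis
  proof (rule Hinf_I(3)[of ?H "1 / m" _ "max \<kappa> 1"])
    show "?H holomorphic_on {s. Re s > 0}"
      by (intro holomorphic_intros translate_holomorphic[OF hol]) (use d nz in auto)
    show "cmod (?H s) \<le> 1 / m" if "Re s > 0" for s
      using m(2)[of "s + of_real \<delta>"] m(1) that by (simp add: norm_divide frac_le)
    show "dabs (tw (of_real \<delta>) b) (max \<kappa> 1)" unfolding dabs_tw by (rule dabs_mono[OF b]) (use d in simp)
    show "?H s = dirichlet_eval (tw (of_real \<delta>) b) s" if s: "Re s \<ge> max \<kappa> 1" "Re s > 0" for s
    proof -
      have "dirichlet_eval f (s + of_real \<delta>) * dirichlet_eval b (s + of_real \<delta>) = 1"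
        by (rule dirichlet_eval_inverse[OF f dabs_mono[OF b] inv]) (use s d in auto)
      then show ?thesis unfolding dirichlet_eval_of_tw using nz[of "s + of_real \<delta>"] s d
        by (simp add: field_simps)
    qed
  qed
qed

text \<open>The convolution belongs to the quotient of the series by its translate, which is bounded
  with a constant free of \<open>\<delta>\<close>, and a supremum bound dominates the norm in
  \<open>H2\<close>.\<close>

lemma inverse_translate_norm:
  assumes f: "dabs f (- \<eta>)" and eta: "\<eta> > 0" and f1: "f 1 \<noteq> 0"
    and nz: "\<And>s. Re s > 0 \<Longrightarrow> dirichlet_eval f s \<noteq> 0"
    and b: "dabs b \<kappa>" and inv: "\<And>n. n \<ge> 1 \<Longrightarrow> dconv f b n = dunit n"
  shows "\<exists>C. \<forall>\<delta>. 0 < \<delta> \<longrightarrow> \<delta> \<le> 1 \<longrightarrow> dconv (tw (of_real \<delta>) b) f \<in> H2 \<and> h2_norm (dconv (tw (of_real \<delta>) b) f) \<le> C"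
proof -
  obtain C where "\<forall>s \<delta>. Re s > 0 \<longrightarrow> 0 < \<delta> \<longrightarrow> \<delta> \<le> 1 \<longrightarrow>
           cmod (dirichlet_eval f s) \<le> C * cmod (dirichlet_eval f (s + of_real \<delta>))"
    using dirichlet_ratio_bound[OF f eta f1 nz] by (rule exE)
  note C = this[rule_format]
  have f': "dabs f \<sigma>" if "\<sigma> > 0" for \<sigma> by (rule dabs_mono[OF f]) (use that eta in simp)
  have hol: "dirichlet_eval f holomorphic_on {s. Re s > 0}" by (rule holomorphic_dirichlet_eval[OF f'])
  have "dconv (tw (of_real \<delta>) b) f \<in> H2 \<and> h2_norm (dconv (tw (of_real \<delta>) b) f) \<le> C" if d: "0 < \<delta>" "\<delta> \<le> 1" for \<delta>
  proof -
    let ?H = "\<lambda>s. dirichlet_eval f s / dirichlet_eval f (s + of_real \<delta>)"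
    have nz': "dirichlet_eval f (s + of_real \<delta>) \<noteq> 0" if "Re s > 0" for s using nz that d by simp
    have bt: "dabs (tw (of_real \<delta>) b) \<sigma>" if "\<sigma> \<ge> max \<kappa> 1" for \<sigma> unfolding dabs_tw by (rule dabs_mono[OF b]) (use d that in simp)
    have h: "?H holomorphic_on {s. Re s > 0}"
      by (intro holomorphic_intros translate_holomorphic[OF hol] hol) (use d nz' in auto)
    have bd: "cmod (?H s) \<le> C" if "Re s > 0" for s
      using C[OF that d] nz'[OF that] by (simp add: norm_divide field_simps)
    have a: "dabs (dconv (tw (of_real \<delta>) b) f) (max \<kappa> 1)"
      by (rule dabs_dconv) (auto intro: bt f')
    have e: "?H s = dirichlet_eval (dconv (tw (of_real \<delta>) b) f) s" if s: "Re s \<ge> max \<kappa> 1" "Re s > 0" for s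
    proof -
      have 1: "dirichlet_eval f (s + of_real \<delta>) * dirichlet_eval b (s + of_real \<delta>) = 1"
        by (rule dirichlet_eval_inverse[OF f' dabs_mono[OF b] inv]) (use s d in auto)
      have 2: "dirichlet_eval (dconv (tw (of_real \<delta>) b) f) s = dirichlet_eval b (s + of_real \<delta>) * dirichlet_eval f s"
        using dirichlet_eval_dconv(2)[OF bt f', of s] s by (simp add: dirichlet_eval_of_tw)
      show ?thesis unfolding 2 using 1 nz'[OF s(2)] by (simp add: field_simps)
    qed
    show ?thesis using Hinf_I(1,2)[OF h bd a e] by blast
  qed
  then show ?thesis by blast
qed

lemma translate_coeff_tendsto:
  assumes inv: "\<And>n. n \<ge> 1 \<Longrightarrow> dconv f b n = dunit n" and n: "n \<ge> 1"
  shows "(\<lambda>k. dconv (tw (of_real (1 / real (Suc k))) b) f n) \<longlonglongrightarrow> dunit n"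
proof -
  have t: "(\<lambda>k. 1 / real (Suc k)) \<longlonglongrightarrow> 0" by real_asymp
  have "(\<lambda>k. \<Sum>d\<in>{d. d dvd n}. b d / of_nat d powr (complex_of_real (1 / real (Suc k))) * f (n div d))
      \<longlonglongrightarrow> (\<Sum>d\<in>{d. d dvd n}. b d / of_nat d powr (complex_of_real 0) * f (n div d))"
  proof (intro tendsto_sum tendsto_mult tendsto_divide tendsto_const)
    fix d assume "d \<in> {d. d dvd n}"
    then have d: "d \<ge> 1" using divisor_pos[OF n] by simp
    show "(\<lambda>k. (of_nat d :: complex) powr (complex_of_real (1 / real (Suc k)))) \<longlonglongrightarrow> of_nat d powr (complex_of_real 0)"
      unfolding of_nat_powr_exp[OF d] by (intro tendsto_intros t)
    show "(of_nat d :: complex) powr (complex_of_real 0) \<noteq> 0" using d by simp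
  qed
  also have "(\<Sum>d\<in>{d. d dvd n}. b d / of_nat d powr (complex_of_real 0) * f (n div d)) = dconv b f n"
    unfolding dconv_def by (rule sum.cong) (use divisor_pos[OF n] in \<open>auto simp: Suc_le_eq\<close>)
  also have "\<dots> = dunit n" using inv[OF n] dconv_commute[OF n] by metis
  finally show ?thesis by (simp add: dconv_def tw_def)
qed

section \<open>From coefficientwise convergence to norm convergence\<close>

lemma H2_cross_terms_vanish:
  assumes u: "u \<in> H2" and v: "\<And>k. v k \<in> H2" "\<And>k. h2_norm (v k) \<le> C"
    and lim: "\<And>n. n \<ge> 1 \<Longrightarrow> (\<lambda>k. v k n) \<longlonglongrightarrow> 0" and e: "e > 0"
  shows "\<exists>k. \<forall>L. (\<Sum>n=1..L. cmod (u n) * cmod (v k n)) \<le> e"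
proof -
  have C0: "C \<ge> 0" using order_trans[OF h2_norm_nonneg v(2)] .
  \<comment> \<open>\<open>r\<close> bounds the tail of \<open>u\<close>: against the norm of
    \<open>v k\<close>, at most \<open>C\<close>, it contributes at most \<open>e/2\<close>. The
    head has finitely many terms and tends to 0 coefficientwise.\<close>
  define r where "r = e / (2 * (C + 1))"
  have r: "r > 0" using e C0 by (simp add: r_def)
  have us: "(\<lambda>n. (cmod (u n))\<^sup>2) summable_on {1..}" using u by (simp add: H2_def)
  obtain N where N: "infsum (\<lambda>n. (cmod (u n))\<^sup>2) {N<..} < r\<^sup>2"
    using summable_tail_small[OF _ us, of "r\<^sup>2" 0] r by auto
  have "(\<lambda>k. \<Sum>n=1..N. cmod (u n) * cmod (v k n)) \<longlonglongrightarrow> (\<Sum>n=1..N. cmod (u n) * cmod (0::complex))"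
    by (intro tendsto_intros lim) auto
  then have "(\<lambda>k. \<Sum>n=1..N. cmod (u n) * cmod (v k n)) \<longlonglongrightarrow> 0" by simp
  then have "eventually (\<lambda>k. (\<Sum>n=1..N. cmod (u n) * cmod (v k n)) < e/2) sequentially"
    by (rule order_tendstoD(2)) (use e in simp)
  then obtain k where k: "(\<Sum>n=1..N. cmod (u n) * cmod (v k n)) < e/2"
    using eventually_happens'[OF sequentially_bot] by blast
  have "(\<Sum>n=1..L. cmod (u n) * cmod (v k n)) \<le> e" for L
  proof -
    let ?T = "{N<..L}"
    have "(\<Sum>n=1..L. cmod (u n) * cmod (v k n)) \<le> (\<Sum>n\<in>{1..N} \<union> ?T. cmod (u n) * cmod (v k n))"
      by (rule sum_mono2) auto
    also have "\<dots> = (\<Sum>n=1..N. cmod (u n) * cmod (v k n)) + (\<Sum>n\<in>?T. cmod (u n) * cmod (v k n))"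
      by (rule sum.union_disjoint) auto
    also have "(\<Sum>n\<in>?T. cmod (u n) * cmod (v k n)) \<le> sqrt (\<Sum>n\<in>?T. (cmod (u n))\<^sup>2) * sqrt (\<Sum>n\<in>?T. (cmod (v k n))\<^sup>2)"
      using L2_set_mult_ineq[of "\<lambda>n. cmod (u n)" "\<lambda>n. cmod (v k n)" ?T] by (simp add: L2_set_def)
    also have "\<dots> \<le> r * C"
    proof (rule mult_mono)
      have "(\<Sum>n\<in>?T. (cmod (u n))\<^sup>2) \<le> infsum (\<lambda>n. (cmod (u n))\<^sup>2) {N<..}"
        by (rule finite_sum_le_infsum[OF summable_on_subset_banach[OF us]]) auto
      then show "sqrt (\<Sum>n\<in>?T. (cmod (u n))\<^sup>2) \<le> r" using N r by (intro real_le_lsqrt) auto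
      have "(\<Sum>n\<in>?T. (cmod (v k n))\<^sup>2) \<le> (\<Sum>n=1..L. (cmod (v k n))\<^sup>2)" by (rule sum_mono2) auto
      also have "\<dots> \<le> (h2_norm (v k))\<^sup>2" by (rule h2_norm_partial[OF v(1)])
      also have "\<dots> \<le> C\<^sup>2" by (intro power_mono v h2_norm_nonneg)
      finally show "sqrt (\<Sum>n\<in>?T. (cmod (v k n))\<^sup>2) \<le> C" using C0 by (intro real_le_lsqrt)
    qed (use r in \<open>auto intro: sum_nonneg\<close>)
    also have "r * C \<le> e/2" using e C0 by (simp add: r_def field_simps)
    finally show ?thesis using k by simp
  qed
  then show ?thesis by blast
qed

text \<open>Bounded norms and convergent coefficients give only weak convergence of
  \<open>dconv (h k) f\<close> to \<open>dunit\<close>. As in the Banach-Saks theorem, averages over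
  well chosen indices converge in norm, and averages of multipliers are again multipliers.\<close>

lemma approximate_unit_strong:
  assumes h: "\<And>k. h k \<in> Hinf" "\<And>k. dconv (h k) f \<in> H2" "\<And>k. h2_norm (dconv (h k) f) \<le> C"
    and lim: "\<And>n. n \<ge> 1 \<Longrightarrow> (\<lambda>k. dconv (h k) f n) \<longlonglongrightarrow> dunit n" and e: "e > 0"
  shows "\<exists>g\<in>Hinf. dconv g f \<in> H2 \<and> h2_norm (\<lambda>n. dconv g f n - dunit n) < e"
proof -
  have C0: "C \<ge> 0" using order_trans[OF h2_norm_nonneg h(3)] .
  \<comment> \<open>The square bounds the squared norm of \<open>v k\<close>; the added 1 is twice
    the cross term, which is kept below 1/2.\<close>
  define K where "K = (C + 1)\<^sup>2 + 1"
  have K0: "K > 0" by (simp add: K_def add_nonneg_pos)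
  define v where "v k n = dconv (h k) f n - dunit n" for k n
  have v: "v k \<in> H2" "h2_norm (v k) \<le> C + 1" for k
    using H2_diff[OF h(2) dunit_facts(2), of k] h(3)[of k] dunit_facts(3) unfolding v_def[abs_def] by auto
  have vl: "(\<lambda>k. v k n) \<longlonglongrightarrow> 0" if "n \<ge> 1" for n
    using tendsto_diff[OF lim[OF that] tendsto_const[of "dunit n"]] by (simp add: v_def)
  \<comment> \<open>Adding almost orthogonal terms one at a time keeps the squared norm of the sum of \<open>N\<close> terms linear in \<open>N\<close>.\<close>
  have ind: "\<exists>g\<in>Hinf. dconv g f \<in> H2 \<and> (h2_norm (\<lambda>n. dconv g f n - of_nat N * dunit n))\<^sup>2 \<le> real N * K" for N
  proof (induction N)
    case 0
    have z: "dconv (\<lambda>n. 0) f = (\<lambda>n. 0)" by (simp add: dconv_def fun_eq_iff)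
    have zH: "(\<lambda>n. 0) \<in> H2" "h2_norm (\<lambda>n. 0) \<le> 0" using H2_I[of "\<lambda>n. 0" 0] by auto
    have "(\<lambda>n. 0) \<in> Hinf" by (rule l1_Hinf) (simp add: l1_def)
    then show ?case using z zH h2_norm_nonneg[of "\<lambda>n. 0"] by (intro bexI[of _ "\<lambda>n. 0"]) auto
  next
    case (Suc N)
    then obtain g where g: "g \<in> Hinf" "dconv g f \<in> H2" "(h2_norm (\<lambda>n. dconv g f n - of_nat N * dunit n))\<^sup>2 \<le> real N * K" by blast
    define u where "u n = dconv g f n - of_nat N * dunit n" for n
    have u: "u \<in> H2" unfolding u_def by (intro H2_diff H2_scale g dunit_facts)
    obtain k where k: "\<And>L. (\<Sum>n=1..L. cmod (u n) * cmod (v k n)) \<le> 1/2"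
      using H2_cross_terms_vanish[OF u v vl, of "1/2"] by auto
    define g' where "g' n = g n + h k n" for n
    have dg: "dconv g' f n = dconv g f n + dconv (h k) f n" for n unfolding g'_def by (rule dconv_add_left)
    have s: "(\<Sum>n=1..L. (cmod (u n + v k n))\<^sup>2) \<le> (sqrt (real (Suc N) * K))\<^sup>2" for L
    proof -
      have "(\<Sum>n=1..L. (cmod (u n + v k n))\<^sup>2) \<le> (\<Sum>n=1..L. (cmod (u n))\<^sup>2 + (cmod (v k n))\<^sup>2 + 2 * (cmod (u n) * cmod (v k n)))"
      proof (rule sum_mono)
        fix n
        have "(cmod (u n + v k n))\<^sup>2 \<le> (cmod (u n) + cmod (v k n))\<^sup>2" by (intro power_mono norm_triangle_ineq) auto
        then show "(cmod (u n + v k n))\<^sup>2 \<le> (cmod (u n))\<^sup>2 + (cmod (v k n))\<^sup>2 + 2 * (cmod (u n) * cmod (v k n))"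
          by (simp add: power2_sum)
      qed
      also have "\<dots> = (\<Sum>n=1..L. (cmod (u n))\<^sup>2) + (\<Sum>n=1..L. (cmod (v k n))\<^sup>2) + 2 * (\<Sum>n=1..L. cmod (u n) * cmod (v k n))"
        by (simp add: sum.distrib sum_distrib_left)
      also have "\<dots> \<le> real N * K + (C + 1)\<^sup>2 + 2 * (1/2)"
      proof (intro add_mono mult_left_mono k)
        show "(\<Sum>n=1..L. (cmod (u n))\<^sup>2) \<le> real N * K"
          using h2_norm_partial[OF u, of L] g(3) unfolding u_def[abs_def] by linarith
        have "(\<Sum>n=1..L. (cmod (v k n))\<^sup>2) \<le> (h2_norm (v k))\<^sup>2" by (rule h2_norm_partial[OF v(1)])
        also have "\<dots> \<le> (C + 1)\<^sup>2" by (intro power_mono v h2_norm_nonneg)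
        finally show "(\<Sum>n=1..L. (cmod (v k n))\<^sup>2) \<le> (C + 1)\<^sup>2" .
      qed auto
      also have "\<dots> = real (Suc N) * K" by (simp add: K_def algebra_simps)
      finally show ?thesis using K0 by simp
    qed
    have eq: "(\<lambda>n. dconv g' f n - of_nat (Suc N) * dunit n) = (\<lambda>n. u n + v k n)"
      by (simp add: dg u_def v_def algebra_simps fun_eq_iff)
    have "h2_norm (\<lambda>n. u n + v k n) \<le> sqrt (real (Suc N) * K)"
      by (rule H2_I(2)[OF s]) (use K0 in auto)
    then have "(h2_norm (\<lambda>n. u n + v k n))\<^sup>2 \<le> (sqrt (real (Suc N) * K))\<^sup>2"
      by (rule power_mono) (rule h2_norm_nonneg)
    also have "\<dots> = real (Suc N) * K" using K0 by simp
    finally have "(h2_norm (\<lambda>n. dconv g' f n - of_nat (Suc N) * dunit n))\<^sup>2 \<le> real (Suc N) * K" unfolding eq .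
    moreover have "g' \<in> Hinf" unfolding g'_def by (rule Hinf_add[OF g(1) h(1)])
    moreover have "dconv g' f \<in> H2" using H2_add(1)[OF g(2) h(2)] dg by (simp add: fun_eq_iff[symmetric] dg[abs_def])
    ultimately show ?case by blast
  qed
  \<comment> \<open>After division by \<open>N\<close> the squared norm is at most
    \<open>K / N\<close>, which this choice brings below the square of \<open>e\<close>.\<close>
  obtain N :: nat where N: "N > K / e\<^sup>2" using reals_Archimedean2 by blast
  have "K / e\<^sup>2 > 0" using K0 e by simp
  then have N0: "real N > 0" using N by linarith
  obtain g where g: "g \<in> Hinf" "dconv g f \<in> H2" "(h2_norm (\<lambda>n. dconv g f n - of_nat N * dunit n))\<^sup>2 \<le> real N * K" using ind by blast
  define u where "u n = dconv g f n - of_nat N * dunit n" for n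
  have u: "u \<in> H2" unfolding u_def by (intro H2_diff H2_scale g dunit_facts)
  define c :: complex where "c = of_real (1 / real N)"
  have eq: "dconv (\<lambda>n. c * g n) f n - dunit n = c * u n" for n
    unfolding dconv_scale_left u_def using N0 by (simp add: c_def field_simps)
  have "h2_norm (\<lambda>n. c * u n) \<le> cmod c * h2_norm u" by (rule H2_scale(2)[OF u])
  also have "\<dots> < e"
  proof -
    have "(h2_norm u)\<^sup>2 \<le> real N * K" using g(3) unfolding u_def[abs_def] .
    also have "\<dots> < real N * (e\<^sup>2 * real N)" using N N0 e by (intro mult_strict_left_mono) (auto simp: field_simps)
    also have "\<dots> = (e * real N)\<^sup>2" by (simp add: power2_eq_square)
    finally have "h2_norm u < e * real N" by (rule power2_less_imp_less) (use e N0 in auto)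
    then show ?thesis using N0 by (simp add: c_def norm_divide field_simps)
  qed
  finally have "h2_norm (\<lambda>n. dconv (\<lambda>n. c * g n) f n - dunit n) < e" unfolding eq .
  moreover have "dconv (\<lambda>n. c * g n) f \<in> H2"
    using H2_scale(1)[OF g(2), of c] by (simp add: dconv_scale_left[abs_def])
  ultimately show ?thesis using Hinf_scale[OF g(1)] by blast
qed

text \<open>\<open>G\<close> is replaced by a truncation \<open>p\<close>. Convolution with the
  finite \<open>p\<close> is bounded on \<open>H2\<close>, so an approximation
  \<open>dconv g f\<close> of \<open>dunit\<close> turns into an approximation of \<open>p\<close>;
  the required accuracy is dictated by the \<open>l1\<close> norm \<open>K\<close> of
  \<open>p\<close>.\<close>

lemma cyclic_if_approximate_unit:
  assumes f: "f \<in> H2" and h: "\<And>k. h k \<in> Hinf" "\<And>k. dconv (h k) f \<in> H2" "\<And>k. h2_norm (dconv (h k) f) \<le> C"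
    and lim: "\<And>n. n \<ge> 1 \<Longrightarrow> (\<lambda>k. dconv (h k) f n) \<longlonglongrightarrow> dunit n"
  shows "cyclic_H2 f"
  unfolding cyclic_H2_def
proof (intro conjI f ballI allI impI)
  fix G :: "nat \<Rightarrow> complex" and e :: real assume G: "G \<in> H2" and e: "e > 0"
  have Gs: "(\<lambda>n. (cmod (G n))\<^sup>2) summable_on {1..}" using G by (simp add: H2_def)
  obtain N where N: "infsum (\<lambda>n. (cmod (G n))\<^sup>2) {N<..} < (e/2)\<^sup>2"
    using summable_tail_small[OF _ Gs, of "(e/2)\<^sup>2" 0] e by auto
  define p where "p n = (if n \<le> N then G n else 0)" for n
  define K where "K = infsum (\<lambda>n. cmod (p n)) {1..}"
  have K0: "K \<ge> 0" unfolding K_def by (rule infsum_nonneg) auto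
  have p: "l1 p" unfolding l1_def
    by (rule finite_nonzero_values_imp_summable_on) (rule finite_subset[of _ "{..N}"], auto simp: p_def)
  have Gp: "(\<Sum>n=1..L. (cmod (G n - p n))\<^sup>2) \<le> (e/2)\<^sup>2" for L
  proof -
    have "(\<Sum>n=1..L. (cmod (G n - p n))\<^sup>2) = (\<Sum>n\<in>{N<..L}. (cmod (G n))\<^sup>2)"
      by (rule sum.mono_neutral_cong_right) (auto simp: p_def)
    also have "\<dots> \<le> infsum (\<lambda>n. (cmod (G n))\<^sup>2) {N<..}"
      by (rule finite_sum_le_infsum[OF summable_on_subset_banach[OF Gs]]) auto
    finally show ?thesis using N by simp
  qed
  have Gp': "(\<lambda>n. G n - p n) \<in> H2" "h2_norm (\<lambda>n. G n - p n) \<le> e/2" using H2_I[OF Gp] e by auto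
  obtain g where g: "g \<in> Hinf" "dconv g f \<in> H2" "h2_norm (\<lambda>n. dconv g f n - dunit n) < e / (2 * (K + 1))"
    using approximate_unit_strong[OF h lim, of "e / (2 * (K + 1))"] e K0 by auto
  define w where "w n = dconv g f n - dunit n" for n
  have w: "w \<in> H2" unfolding w_def by (intro H2_diff g dunit_facts)
  have as: "dconv (dconv p g) f n = dconv p (dconv g f) n" if "n \<ge> 1" for n by (rule dconv_assoc[OF that])
  have eq: "G n - dconv (dconv p g) f n = (G n - p n) - dconv p w n" if "n \<ge> 1" for n
    using as[OF that] dconv_dunit_right[OF that, of p] unfolding w_def dconv_diff_right by simp
  have pw: "dconv p w \<in> H2" "h2_norm (dconv p w) \<le> K * h2_norm w" unfolding K_def by (rule dconv_l1_H2[OF p w])+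
  have "h2_norm (\<lambda>n. G n - dconv (dconv p g) f n) = h2_norm (\<lambda>n. (G n - p n) - dconv p w n)"
    by (rule H2_cong(2)) (rule eq)
  also have "\<dots> \<le> h2_norm (\<lambda>n. G n - p n) + h2_norm (dconv p w)" by (rule H2_diff(2)[OF Gp'(1) pw(1)])
  also have "\<dots> \<le> e/2 + K * h2_norm w" using Gp' pw by simp
  also have "K * h2_norm w \<le> K * (e / (2 * (K + 1)))" using g(3) K0 unfolding w_def[abs_def] by (intro mult_left_mono) auto
  also have "\<dots> < e/2" using e K0 by (simp add: field_simps)
  finally have "h2_norm (\<lambda>n. G n - dconv (dconv p g) f n) < e" by simp
  moreover have "dconv (dconv p g) f \<in> H2"
    using H2_cong(1)[of "dconv (dconv p g) f" "dconv p (dconv g f)"] as dconv_l1_H2(1)[OF p g(2)] by blast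
  ultimately show "\<exists>h\<in>Hinf. dconv h f \<in> H2 \<and> h2_norm (\<lambda>n. G n - dconv h f n) < e"
    using dconv_l1_Hinf[OF p g(1)] by blast
qed

lemma cyclic_if_absolutely_convergent_beyond:
  assumes f: "dabs f (- \<eta>)" and eta: "\<eta> > 0" and f1: "f 1 \<noteq> 0" and fH: "f \<in> H2"
    and nz: "\<And>s. Re s > 0 \<Longrightarrow> dirichlet_eval f s \<noteq> 0"
  shows "cyclic_H2 f"
proof -
  obtain \<kappa> where b: "dabs (dinv f) \<kappa>" using dabs_dinv[OF f f1] by blast
  have inv: "dconv f (dinv f) n = dunit n" if "n \<ge> 1" for n by (rule dconv_dinv) (use f1 that in auto)
  obtain C where C: "\<And>\<delta>. 0 < \<delta> \<Longrightarrow> \<delta> \<le> 1 \<Longrightarrow> dconv (tw (of_real \<delta>) (dinv f)) f \<in> H2 \<and> h2_norm (dconv (tw (of_real \<delta>) (dinv f)) f) \<le> C"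
    using inverse_translate_norm[OF f eta f1 nz b inv] by blast
  have f': "dabs f \<sigma>" if "\<sigma> > 0" for \<sigma> by (rule dabs_mono[OF f]) (use that eta in simp)
  show ?thesis
  proof (rule cyclic_if_approximate_unit[where h = "\<lambda>k. tw (of_real (1 / real (Suc k))) (dinv f)" and C = C, OF fH])
    fix k
    show "tw (of_real (1 / real (Suc k))) (dinv f) \<in> Hinf"
      by (rule inverse_translate_Hinf[OF f' f1 nz _ b inv]) auto
    show "dconv (tw (of_real (1 / real (Suc k))) (dinv f)) f \<in> H2" "h2_norm (dconv (tw (of_real (1 / real (Suc k))) (dinv f)) f) \<le> C"
      using C[of "1 / real (Suc k)"] by auto
  qed (rule translate_coeff_tendsto[OF inv])
qed

section \<open>Points of the polydisc and the necessity of non-vanishing\<close>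

text \<open>In the Bohr correspondence \<open>\<zeta>\<close> is a point of the polydisc, one coordinate per prime, and
  \<open>\<Sum> f n * cm \<zeta> n\<close> is the value at \<open>\<zeta>\<close> of the power series belonging to \<open>f\<close>.\<close>

definition cm :: "(nat \<Rightarrow> complex) \<Rightarrow> nat \<Rightarrow> complex" where
  "cm \<zeta> n = prod_mset (image_mset \<zeta> (prime_factorization n))"

lemma cm_1 [simp]: "cm \<zeta> 1 = 1" "cm \<zeta> (Suc 0) = 1"
  by (simp_all add: cm_def)

lemma cm_mult: "m \<ge> 1 \<Longrightarrow> n \<ge> 1 \<Longrightarrow> cm \<zeta> (m * n) = cm \<zeta> m * cm \<zeta> n"
  by (simp add: cm_def prime_factorization_mult)

lemma cm_prime: "prime p \<Longrightarrow> cm \<zeta> p = \<zeta> p"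
  by (simp add: cm_def prime_factorization_prime)

lemma cm_cong:
  assumes "\<And>p. prime p \<Longrightarrow> p dvd n \<Longrightarrow> \<zeta> p = \<zeta>' p" shows "cm \<zeta> n = cm \<zeta>' n"
  unfolding cm_def by (rule arg_cong[where f = prod_mset], rule image_mset_cong)
    (use assms in \<open>auto dest: in_prime_factors_imp_prime in_prime_factors_imp_dvd\<close>)

lemma prime_factor_induct [consumes 1, case_names one mult]:
  fixes n :: nat
  assumes "n \<ge> 1" "P 1" "\<And>p m. prime p \<Longrightarrow> m \<ge> 1 \<Longrightarrow> P m \<Longrightarrow> P (p * m)"
  shows "P n"
  using assms(1)
proof (induction n rule: less_induct)
  case (less n)
  show ?case
  proof (cases "n = 1")
    case False
    then obtain p where p: "prime p" "p dvd n" using prime_factor_nat by blast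
    then obtain m where m: "n = p * m" by blast
    have "m \<ge> 1" using m less.prems by (cases m) auto
    moreover have "m < n" using m p prime_gt_1_nat[OF p(1)] \<open>m \<ge> 1\<close> by simp
    ultimately show ?thesis using less.IH assms(3)[OF p(1)] m by blast
  qed (use assms(2) in simp)
qed

lemma cm_completely_multiplicative:
  assumes "g 1 = 1" "\<And>m n. m \<ge> 1 \<Longrightarrow> n \<ge> 1 \<Longrightarrow> g (m * n) = g m * g n" "n \<ge> 1"
  shows "cm g n = g n"
  using assms(3)
proof (induction rule: prime_factor_induct)
  case one
  then show ?case using assms(1) by simp
next
  case (mult p m)
  have "p \<ge> 1" using prime_ge_1_nat[OF mult(1)] .
  then show ?case using mult cm_mult[of p m g] assms(2)[of p m] cm_prime[OF mult(1)] by simp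
qed

lemma cm_distrib: "cm (\<lambda>p. \<zeta> p * \<eta> p) n = cm \<zeta> n * cm \<eta> n"
  by (simp add: cm_def prod_mset.distrib)

lemma cm_powr: "n \<ge> 1 \<Longrightarrow> cm (\<lambda>p. of_nat p powr s) n = of_nat n powr s"
  by (rule cm_completely_multiplicative) (use of_nat_powr_mult in auto)

lemma norm_cm_le_1:
  assumes "\<And>p. prime p \<Longrightarrow> cmod (\<zeta> p) \<le> 1" "n \<ge> 1" shows "cmod (cm \<zeta> n) \<le> 1"
  using assms(2)
proof (induction rule: prime_factor_induct)
  case (mult p m)
  have "p \<ge> 1" using prime_ge_1_nat[OF mult(1)] .
  then show ?case using mult cm_mult[of p m \<zeta>] cm_prime[OF mult(1), of \<zeta>] assms(1)[OF mult(1)]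
    by (simp add: norm_mult mult_le_one)
qed simp

lemma sum_split_dvd:
  fixes g :: "nat \<Rightarrow> 'a::comm_monoid_add"
  assumes "p \<ge> 1"
  shows "(\<Sum>n=1..L. g n) = (\<Sum>n\<in>{n\<in>{1..L}. \<not> p dvd n}. g n) + (\<Sum>m=1..L div p. g (p * m))"
proof -
  have "(\<Sum>n=1..L. g n) = (\<Sum>n\<in>{n\<in>{1..L}. \<not> p dvd n} \<union> {n\<in>{1..L}. p dvd n}. g n)"
    by (rule sum.cong) auto
  also have "\<dots> = (\<Sum>n\<in>{n\<in>{1..L}. \<not> p dvd n}. g n) + (\<Sum>n\<in>{n\<in>{1..L}. p dvd n}. g n)"
    by (rule sum.union_disjoint) auto
  also have "(\<Sum>n\<in>{n\<in>{1..L}. p dvd n}. g n) = (\<Sum>m=1..L div p. g (p * m))"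
    by (rule sum.reindex_bij_witness[where i = "\<lambda>m. p * m" and j = "\<lambda>n. n div p"])
      (use assms in \<open>auto simp: less_eq_div_iff_mult_less_eq div_le_mono mult.commute Suc_le_eq elim!: dvdE\<close>)
  finally show ?thesis .
qed

text \<open>One prime is added at a time. Splitting by divisibility by \<open>p\<close> gives
  \<open>S L \<le> ?K + cmod (\<zeta> p) * S L\<close>, which can be solved for the finite number
  \<open>S L\<close> because \<open>cmod (\<zeta> p) < 1\<close>.\<close>

lemma l1_cm:
  assumes "finite P" "\<And>p. p \<in> P \<Longrightarrow> prime p \<and> cmod (\<zeta> p) < 1" "\<And>p. prime p \<Longrightarrow> p \<notin> P \<Longrightarrow> \<zeta> p = 0"
  shows "l1 (cm \<zeta>)"
  using assms
proof (induction P arbitrary: \<zeta> rule: finite_induct)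
  case empty
  have "cm \<zeta> n = dunit n" if "n \<ge> 1" for n
    using that
  proof (induction rule: prime_factor_induct)
    case (mult p m)
    have p: "p > 1" using prime_gt_1_nat[OF mult(1)] .
    have "cm \<zeta> (p * m) = 0" using cm_mult[of p m \<zeta>] cm_prime[OF mult(1), of \<zeta>] empty(2)[OF mult(1)] p mult by simp
    then show ?case using p by (simp add: dunit_def)
  qed (simp add: dunit_def)
  then show ?case using l1_cong[of "cm \<zeta>" dunit] dunit_facts(1) by blast
next
  case (insert p P)
  have p: "prime p" "cmod (\<zeta> p) < 1" using insert.prems(1) by auto
  have p1: "p \<ge> 1" using prime_ge_1_nat[OF p(1)] .
  define \<zeta>' where "\<zeta>' = \<zeta>(p := 0)"
  have l': "l1 (cm \<zeta>')" by (rule insert.IH) (use insert in \<open>auto simp: \<zeta>'_def\<close>)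
  let ?K = "infsum (\<lambda>n. cmod (cm \<zeta>' n)) {1..}"
  define S where "S L = (\<Sum>n=1..L. cmod (cm \<zeta> n))" for L
  have "S L \<le> ?K + cmod (\<zeta> p) * S L" for L
  proof -
    have "S L = (\<Sum>n\<in>{n\<in>{1..L}. \<not> p dvd n}. cmod (cm \<zeta> n)) + (\<Sum>m=1..L div p. cmod (cm \<zeta> (p * m)))"
      unfolding S_def by (rule sum_split_dvd[OF p1])
    also have "(\<Sum>n\<in>{n\<in>{1..L}. \<not> p dvd n}. cmod (cm \<zeta> n)) = (\<Sum>n\<in>{n\<in>{1..L}. \<not> p dvd n}. cmod (cm \<zeta>' n))"
    proof (rule sum.cong[OF refl])
      fix n assume "n \<in> {n\<in>{1..L}. \<not> p dvd n}"
      then have "\<not> p dvd n" by simp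
      then show "cmod (cm \<zeta> n) = cmod (cm \<zeta>' n)"
        by (intro arg_cong[where f = cmod] cm_cong) (auto simp: \<zeta>'_def)
    qed
    also have "\<dots> \<le> ?K" using l' unfolding l1_def by (intro finite_sum_le_infsum) auto
    also have "(\<Sum>m=1..L div p. cmod (cm \<zeta> (p * m))) = cmod (\<zeta> p) * S (L div p)"
      unfolding S_def sum_distrib_left
      by (rule sum.cong) (use cm_mult[OF p1, of _ \<zeta>] cm_prime[OF p(1), of \<zeta>] in \<open>auto simp: norm_mult\<close>)
    finally have "S L \<le> ?K + cmod (\<zeta> p) * S (L div p)" by simp
    moreover have "S (L div p) \<le> S L" unfolding S_def by (rule sum_mono2) (auto intro: order_trans[OF _ div_le_dividend])
    ultimately show ?thesis using mult_left_mono[of "S (L div p)" "S L" "cmod (\<zeta> p)"] by simp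
  qed
  then have "S L \<le> ?K / (1 - cmod (\<zeta> p))" for L
    using p(2) by (simp add: field_simps)
  then show ?case unfolding l1_def S_def by (intro nonneg_partial_sums_bounded) auto
qed

text \<open>At such points the monomials \<open>cm \<zeta>\<close> are absolutely and hence square
  summable, so every element of \<open>H2\<close> can be evaluated there.\<close>

definition finsupp :: "nat set \<Rightarrow> (nat \<Rightarrow> complex) \<Rightarrow> bool" where
  "finsupp P \<zeta> \<longleftrightarrow> finite P \<and> (\<forall>p\<in>P. prime p \<and> cmod (\<zeta> p) < 1) \<and> (\<forall>p. prime p \<longrightarrow> p \<notin> P \<longrightarrow> \<zeta> p = 0)"

lemma finsupp_l1: "finsupp P \<zeta> \<Longrightarrow> l1 (cm \<zeta>)"
  using l1_cm[of P \<zeta>] unfolding finsupp_def by blast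

lemma finsupp_norm: "finsupp P \<zeta> \<Longrightarrow> n \<ge> 1 \<Longrightarrow> cmod (cm \<zeta> n) \<le> 1"
  by (rule norm_cm_le_1) (auto simp: finsupp_def, metis less_imp_le norm_zero zero_le_one)

lemma finsupp_H2: assumes "finsupp P \<zeta>" shows "cm \<zeta> \<in> H2"
  unfolding H2_def mem_Collect_eq
proof (rule summable_on_comparison_test)
  show "(\<lambda>n. cmod (cm \<zeta> n)) summable_on {1..}" using finsupp_l1[OF assms] by (simp add: l1_def)
  fix n :: nat assume "n \<in> {1..}"
  then show "(cmod (cm \<zeta> n))\<^sup>2 \<le> cmod (cm \<zeta> n)"
    using finsupp_norm[OF assms, of n] by (simp add: power2_eq_square mult_left_le)
qed auto

text \<open>Finitely many coordinates remain in the open disc under a small dilation. Thus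
  \<open>\<zeta>\<close> is the translate by \<open>\<delta>\<close> of another admissible point,
  and evaluation at \<open>\<zeta>\<close> involves \<open>f\<close> only after a translation to the
  right.\<close>

lemma finsupp_scale:
  assumes "finsupp P \<zeta>"
  shows "\<exists>\<delta>>0. finsupp P (\<lambda>p. \<zeta> p * of_nat p powr (of_real \<delta>))"
proof -
  have "eventually (\<lambda>\<delta>. cmod (\<zeta> p) * real p powr \<delta> < 1) (at_right 0)" if "p \<in> P" for p
  proof -
    have p: "prime p" "cmod (\<zeta> p) < 1" using assms that by (auto simp: finsupp_def)
    have "((\<lambda>\<delta>. cmod (\<zeta> p) * real p powr \<delta>) \<longlongrightarrow> cmod (\<zeta> p) * real p powr 0) (at_right 0)"
      using prime_gt_0_nat[OF p(1)] by (intro tendsto_intros) auto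
    then show ?thesis by (rule order_tendstoD(2)) (use p prime_gt_0_nat[OF p(1)] in simp)
  qed
  then have "eventually (\<lambda>\<delta>. \<forall>p\<in>P. cmod (\<zeta> p) * real p powr \<delta> < 1) (at_right 0)"
    using assms by (intro eventually_ball_finite) (auto simp: finsupp_def)
  then have "eventually (\<lambda>\<delta>::real. \<delta> > 0 \<and> (\<forall>p\<in>P. cmod (\<zeta> p) * real p powr \<delta> < 1)) (at_right 0)"
    using eventually_conj[OF eventually_at_right_less[of "0::real"]] by blast
  then obtain \<delta> :: real where d: "\<delta> > 0" "\<forall>p\<in>P. cmod (\<zeta> p) * real p powr \<delta> < 1"
    using eventually_happens'[OF trivial_limit_at_right_real] by blast
  have "finsupp P (\<lambda>p. \<zeta> p * of_nat p powr (of_real \<delta>))"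
    unfolding finsupp_def
  proof (intro conjI ballI allI impI)
    fix p assume p: "p \<in> P"
    then show "prime p" using assms by (simp add: finsupp_def)
    then show "cmod (\<zeta> p * of_nat p powr (of_real \<delta>)) < 1"
      using d(2) p norm_of_nat_powr[OF prime_ge_1_nat, of p "of_real \<delta>"] by (simp add: norm_mult)
  qed (use assms in \<open>auto simp: finsupp_def\<close>)
  then show ?thesis using d by blast
qed

lemma l1_times_H2: "x \<in> H2 \<Longrightarrow> finsupp P \<zeta> \<Longrightarrow> l1 (\<lambda>n. x n * cm \<zeta> n)"
  unfolding l1_def using H2_cauchy_schwarz(1)[OF _ finsupp_H2] by blast

lemma infsum_dconv_cm:
  assumes "l1 (\<lambda>n. f n * cm \<zeta> n)" "l1 (\<lambda>n. g n * cm \<zeta> n)"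
  shows "infsum (\<lambda>n. dconv f g n * cm \<zeta> n) {1..} = infsum (\<lambda>n. f n * cm \<zeta> n) {1..} * infsum (\<lambda>n. g n * cm \<zeta> n) {1..}"
proof -
  have "infsum (\<lambda>n. dconv f g n * cm \<zeta> n) {1..} = infsum (dconv (\<lambda>n. f n * cm \<zeta> n) (\<lambda>n. g n * cm \<zeta> n)) {1..}"
    by (rule infsum_cong) (use dconv_twist[where z = "cm \<zeta>", OF cm_mult] in auto)
  then show ?thesis using infsum_dconv(2)[OF assms] by simp
qed

lemma infsum_dunit: "infsum (\<lambda>n. dunit n * cm \<zeta> n) {1..} = 1"
proof -
  have "infsum (\<lambda>n. dunit n * cm \<zeta> n) {1..} = infsum (\<lambda>n. dunit n * cm \<zeta> n) {1}"
    by (rule infsum_cong_neutral) (auto simp: dunit_def)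
  then show ?thesis by (simp add: dunit_def)
qed

lemma polydisc_l1:
  assumes f: "\<And>\<sigma>. \<sigma> > 0 \<Longrightarrow> dabs f \<sigma>" and \<zeta>: "finsupp P \<zeta>"
  shows "l1 (\<lambda>n. f n * cm \<zeta> n)"
proof -
  obtain \<delta> where d: "\<delta> > 0" "finsupp P (\<lambda>p. \<zeta> p * of_nat p powr (of_real \<delta>))" using finsupp_scale[OF \<zeta>] by blast
  have l: "l1 (tw (of_real \<delta>) f)" using f[OF d(1)] l1_tw by simp
  show ?thesis
  proof (rule l1_dominated[OF l])
    fix n :: nat assume n: "n \<ge> 1"
    have "cmod (cm \<zeta> n * of_nat n powr (of_real \<delta>)) \<le> 1"
      using finsupp_norm[OF d(2) n] cm_powr[OF n] by (simp add: cm_distrib)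
    then have "cmod (cm \<zeta> n) \<le> 1 / real n powr \<delta>"
      using norm_of_nat_powr[OF n, of "of_real \<delta>"] n by (simp add: norm_mult field_simps)
    then have "cmod (f n) * cmod (cm \<zeta> n) \<le> cmod (f n) * (1 / real n powr \<delta>)"
      by (rule mult_left_mono) simp
    then show "cmod (f n * cm \<zeta> n) \<le> cmod (tw (of_real \<delta>) f n)"
      by (simp add: norm_tw[OF n] norm_mult powr_minus_divide)
  qed
qed

text \<open>The inverse of \<open>f\<close>, translated by \<open>\<delta>\<close>, is square
  summable and can be evaluated at the dilated point. Undoing the dilation, the inverse itself
  converges at \<open>\<zeta>\<close>, and the two values multiply to 1.\<close>

lemma polydisc_nonvanishing:
  assumes f: "\<And>\<sigma>. \<sigma> > 0 \<Longrightarrow> dabs f \<sigma>" and f1: "f 1 \<noteq> 0"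
    and nz: "\<And>s. Re s > 0 \<Longrightarrow> dirichlet_eval f s \<noteq> 0" and \<zeta>: "finsupp P \<zeta>"
  shows "infsum (\<lambda>n. f n * cm \<zeta> n) {1..} \<noteq> 0"
proof -
  obtain \<delta> where d: "\<delta> > 0" "finsupp P (\<lambda>p. \<zeta> p * of_nat p powr (of_real \<delta>))" using finsupp_scale[OF \<zeta>] by blast
  obtain \<kappa> where b: "dabs (dinv f) \<kappa>" using dabs_dinv[OF f f1, of 1] by auto
  have inv: "dconv f (dinv f) n = dunit n" if "n \<ge> 1" for n by (rule dconv_dinv) (use f1 that in auto)
  have "tw (of_real \<delta>) (dinv f) \<in> Hinf" by (rule inverse_translate_Hinf[OF f f1 nz d(1) b inv])
  then have "tw (of_real \<delta>) (dinv f) \<in> H2" by (simp add: Hinf_def)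
  then have "l1 (\<lambda>n. tw (of_real \<delta>) (dinv f) n * cm (\<lambda>p. \<zeta> p * of_nat p powr (of_real \<delta>)) n)"
    by (rule l1_times_H2[OF _ d(2)])
  then have lb: "l1 (\<lambda>n. dinv f n * cm \<zeta> n)"
    by (subst l1_cong) (auto simp: tw_def cm_distrib cm_powr)
  have "infsum (\<lambda>n. dconv f (dinv f) n * cm \<zeta> n) {1..} = infsum (\<lambda>n. dunit n * cm \<zeta> n) {1..}"
    by (rule infsum_cong) (simp add: inv)
  then have "infsum (\<lambda>n. f n * cm \<zeta> n) {1..} * infsum (\<lambda>n. dinv f n * cm \<zeta> n) {1..} = 1"
    using infsum_dconv_cm[OF polydisc_l1[OF f \<zeta>] lb] infsum_dunit by simp
  then show ?thesis by auto
qed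

lemma cyclic_polydisc_nonvanishing:
  assumes c: "cyclic_H2 f" and \<zeta>: "finsupp P \<zeta>"
  shows "infsum (\<lambda>n. f n * cm \<zeta> n) {1..} \<noteq> 0"
proof
  assume z: "infsum (\<lambda>n. f n * cm \<zeta> n) {1..} = 0"
  let ?Z = "h2_norm (cm \<zeta>)"
  have Z: "?Z \<ge> 0" by (rule h2_norm_nonneg)
  have f: "f \<in> H2" using c by (simp add: cyclic_H2_def)
  \<comment> \<open>By Cauchy-Schwarz, evaluation at \<open>\<zeta>\<close> has norm at most
    \<open>?Z\<close>. This accuracy makes the value of \<open>dunit - dconv h f\<close> smaller
    than 1, whereas it equals 1 if \<open>f\<close> vanishes at \<open>\<zeta>\<close>.\<close>
  have "1 / (?Z + 1) > 0" using Z by simp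
  then obtain h where h: "h \<in> Hinf" "dconv h f \<in> H2" "h2_norm (\<lambda>n. dunit n - dconv h f n) < 1 / (?Z + 1)"
    using c dunit_facts(2) unfolding cyclic_H2_def by metis
  have hH: "h \<in> H2" using h(1) by (simp add: Hinf_def)
  define x where "x n = dunit n - dconv h f n" for n
  have x: "x \<in> H2" unfolding x_def by (intro H2_diff dunit_facts h)
  have lu: "l1 (\<lambda>n. dunit n * cm \<zeta> n)" "l1 (\<lambda>n. dconv h f n * cm \<zeta> n)" "l1 (\<lambda>n. x n * cm \<zeta> n)"
    by (intro l1_times_H2[OF _ \<zeta>] dunit_facts h x)+
  have 0: "infsum (\<lambda>n. dconv h f n * cm \<zeta> n) {1..} = 0"
    using infsum_dconv_cm[OF l1_times_H2[OF hH \<zeta>] l1_times_H2[OF f \<zeta>]] z by simp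
  have "infsum (\<lambda>n. x n * cm \<zeta> n + dconv h f n * cm \<zeta> n) {1..} = infsum (\<lambda>n. x n * cm \<zeta> n) {1..} + 0"
    unfolding 0[symmetric] by (rule infsum_add) (use lu l1_summable in auto)
  moreover have "(\<lambda>n. x n * cm \<zeta> n + dconv h f n * cm \<zeta> n) = (\<lambda>n. dunit n * cm \<zeta> n)"
    by (simp add: x_def algebra_simps)
  ultimately have "infsum (\<lambda>n. x n * cm \<zeta> n) {1..} = 1" using infsum_dunit by simp
  then have "1 \<le> infsum (\<lambda>n. cmod (x n * cm \<zeta> n)) {1..}"
    using norm_infsum_bound[of "\<lambda>n. x n * cm \<zeta> n" "{1..}"] lu(3) unfolding l1_def by simp
  also have "\<dots> \<le> h2_norm x * ?Z" by (rule H2_cauchy_schwarz(2)[OF x finsupp_H2[OF \<zeta>]])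
  also have "\<dots> \<le> 1 / (?Z + 1) * ?Z" using h(3) Z unfolding x_def[abs_def] by (intro mult_right_mono) auto
  also have "\<dots> < 1" using Z by simp
  finally show False by simp
qed

section \<open>Smooth integers and the passage to the half-plane\<close>

definition smooth :: "nat \<Rightarrow> nat \<Rightarrow> bool" where
  "smooth N n \<longleftrightarrow> (\<forall>p. prime p \<longrightarrow> p dvd n \<longrightarrow> p \<le> N)"

definition smooth_pt :: "nat \<Rightarrow> complex \<Rightarrow> nat \<Rightarrow> complex" where
  "smooth_pt N s p = (if p \<le> N then 1 / of_nat p powr s else 0)"

lemma finsupp_smooth_pt:
  assumes "Re s > 0" shows "finsupp {p. prime p \<and> p \<le> N} (smooth_pt N s)"
proof -
  have "finite {p. prime p \<and> p \<le> N}" by (rule finite_subset[of _ "{..N}"]) auto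
  moreover have "cmod (1 / of_nat p powr s) < 1" if "prime p" for p
  proof -
    have "real p powr Re s > real p powr 0" using prime_gt_1_nat[OF that] assms by (intro powr_less_mono) auto
    then show ?thesis using norm_of_nat_powr[OF prime_ge_1_nat[OF that], of s] prime_gt_0_nat[OF that]
      by (simp add: norm_divide)
  qed
  ultimately show ?thesis by (auto simp: finsupp_def smooth_pt_def)
qed

lemma cm_smooth_pt:
  assumes "n \<ge> 1" shows "cm (smooth_pt N s) n = (if smooth N n then 1 / of_nat n powr s else 0)"
  using assms
proof (induction rule: prime_factor_induct)
  case one
  then show ?case by (simp add: smooth_def)
next
  case (mult p m)
  have p1: "p \<ge> 1" using prime_ge_1_nat[OF mult(1)] .
  have sm: "smooth N (p * m) \<longleftrightarrow> p \<le> N \<and> smooth N m"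
    using mult(1) by (auto simp: smooth_def prime_dvd_mult_iff dest: primes_dvd_imp_eq)
  have "cm (smooth_pt N s) (p * m) = smooth_pt N s p * cm (smooth_pt N s) m"
    using cm_mult[OF p1 mult(2)] cm_prime[OF mult(1)] by simp
  also have "\<dots> = (if smooth N (p * m) then 1 / of_nat (p * m) powr s else 0)"
    unfolding sm mult(3) of_nat_powr_mult[OF p1 mult(2)] by (simp add: smooth_pt_def)
  finally show ?case .
qed

definition smooth_part :: "nat \<Rightarrow> (nat \<Rightarrow> complex) \<Rightarrow> nat \<Rightarrow> complex" where
  "smooth_part N f n = (if smooth N n then f n else 0)"

lemma infsum_smooth_pt: "infsum (\<lambda>n. f n * cm (smooth_pt N s) n) {1..} = dirichlet_eval (smooth_part N f) s"
  unfolding dirichlet_eval_def by (rule infsum_cong) (simp add: cm_smooth_pt smooth_part_def)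

lemma smooth_part_dabs: "dabs f \<sigma> \<Longrightarrow> dabs (smooth_part N f) \<sigma>"
  by (erule dabs_dominated) (simp add: smooth_part_def)

text \<open>Every positive \<open>n \<le> N\<close> is \<open>N\<close>-smooth, so only a tail of
  the series is affected. The bound holds for all \<open>Re s \<ge> \<sigma>\<close> at once and
  supplies the locally uniform convergence for Hurwitz' theorem.\<close>

lemma smooth_part_approx:
  assumes f: "dabs f \<sigma>" and s: "Re s \<ge> \<sigma>"
  shows "cmod (dirichlet_eval (smooth_part N f) s - dirichlet_eval f s) \<le> infsum (\<lambda>n. cmod (f n) * real n powr (- \<sigma>)) {N<..}"
proof -
  define g where "g n = smooth_part N f n - f n" for n
  have gle: "cmod (g n) \<le> (if n > N then cmod (f n) else 0)" if "n \<ge> 1" for n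
  proof -
    have "smooth N n" if "n \<le> N" using that \<open>n \<ge> 1\<close> by (auto simp: smooth_def dest!: dvd_imp_le)
    then show ?thesis by (auto simp: g_def smooth_part_def)
  qed
  have dg: "dabs g \<sigma>" by (rule dabs_dominated[OF f]) (use gle in \<open>auto intro!: mult_right_mono simp: less_imp_le split: if_splits\<close>, smt (verit) norm_ge_zero gle)
  have fs: "(\<lambda>n. cmod (f n) * real n powr (- \<sigma>)) summable_on {N<..}"
    using f unfolding dabs_def by (rule summable_on_subset_banach) auto
  have "dirichlet_eval (smooth_part N f) s - dirichlet_eval f s = dirichlet_eval g s"
    unfolding g_def by (rule dirichlet_eval_diff[symmetric]) (use dabs_mono[OF _ s] f smooth_part_dabs in auto)
  then have "cmod (dirichlet_eval (smooth_part N f) s - dirichlet_eval f s) \<le> infsum (\<lambda>n. cmod (g n) * real n powr (- \<sigma>)) {1..}"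
    using dirichlet_eval_bound[OF dg s] by simp
  also have "\<dots> \<le> infsum (\<lambda>n. cmod (f n) * real n powr (- \<sigma>)) {N<..}"
  proof (rule infsum_mono_neutral)
    show "(\<lambda>n. cmod (g n) * real n powr (- \<sigma>)) summable_on {1..}" using dg by (simp add: dabs_def)
    fix n assume n: "n \<in> {1..} \<inter> {N<..}"
    then show "cmod (g n) * real n powr (- \<sigma>) \<le> cmod (f n) * real n powr (- \<sigma>)"
      using gle[of n] by (intro mult_right_mono) auto
  next
    fix n assume "n \<in> {1..} - {N<..}"
    then show "cmod (g n) * real n powr (- \<sigma>) \<le> 0" using gle[of n] by auto
  qed (use fs in auto)
  finally show ?thesis .
qed

lemma smooth_part_tendsto:
  assumes f: "dabs f (Re s)"
  shows "(\<lambda>N. dirichlet_eval (smooth_part N f) s) \<longlonglongrightarrow> dirichlet_eval f s"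
proof -
  have "(\<lambda>N. infsum (\<lambda>n. cmod (f n) * real n powr (- Re s)) {N<..}) \<longlonglongrightarrow> 0"
    by (rule summable_tail_tendsto) (use f in \<open>auto simp: dabs_def\<close>)
  then have "(\<lambda>N. dirichlet_eval (smooth_part N f) s - dirichlet_eval f s) \<longlonglongrightarrow> 0"
    by (rule Lim_null_comparison[rotated]) (use smooth_part_approx[OF f] in auto)
  then show ?thesis by (rule LIM_zero_cancel)
qed

theorem cyclic_imp_nonvanishing:
  assumes c: "cyclic_H2 f" and f: "\<And>\<sigma>. \<sigma> > 0 \<Longrightarrow> dabs f \<sigma>"
  shows "f 1 \<noteq> 0" and "\<And>s. Re s > 0 \<Longrightarrow> dirichlet_eval f s \<noteq> 0"
proof -
  show f1: "f 1 \<noteq> 0"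
  proof -
    \<comment> \<open>The origin of the polydisc, where the value is the constant term.\<close>
    have fs: "finsupp {} (\<lambda>p. 0)" by (simp add: finsupp_def)
    have "cm (\<lambda>p. 0) n = dunit n" if "n \<ge> 1" for n
      using that by (induction rule: prime_factor_induct) (auto simp: dunit_def cm_mult cm_prime Suc_le_eq prime_gt_0_nat)
    then have "infsum (\<lambda>n. f n * cm (\<lambda>p. 0) n) {1..} = infsum (\<lambda>n. f n * cm (\<lambda>p. 0) n) {1}"
      by (intro infsum_cong_neutral) (auto simp: dunit_def)
    then show ?thesis using cyclic_polydisc_nonvanishing[OF c fs] by auto
  qed
  fix s :: complex assume s: "Re s > 0"
  have hol: "dirichlet_eval f holomorphic_on {s. Re s > 0}" by (rule holomorphic_dirichlet_eval[OF f])
  have nz: "dirichlet_eval (smooth_part N f) w \<noteq> 0" if "Re w > 0" for N w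
    using cyclic_polydisc_nonvanishing[OF c finsupp_smooth_pt[OF that, of N]] unfolding infsum_smooth_pt .
  obtain R where R: "\<And>w. Re w \<ge> R \<Longrightarrow> cmod (f 1) / 2 \<le> cmod (dirichlet_eval f w)"
    using dirichlet_large_lower[OF f f1, of 1 0] by auto
  show "dirichlet_eval f s \<noteq> 0"
  \<comment> \<open>Hurwitz' theorem is stated for non-constant limits. A constant equals its value
    far to the right, which is close to \<open>f 1\<close>.\<close>
  proof (cases "dirichlet_eval f constant_on {s. Re s > 0}")
    case True
    then have "dirichlet_eval f s = dirichlet_eval f (of_real (max R 1))" using s unfolding constant_on_def by auto
    moreover have "cmod (f 1) / 2 \<le> cmod (dirichlet_eval f (of_real (max R 1)))" by (rule R) simp
    ultimately show ?thesis using f1 by auto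
  next
    case False
    show ?thesis
    proof (rule Hurwitz_no_zeros[OF open_halfspace_Re_gt convex_connected[OF convex_halfspace_Re_gt] _ hol _ False])
      show "dirichlet_eval (smooth_part N f) holomorphic_on {s. Re s > 0}" for N
        by (intro holomorphic_dirichlet_eval smooth_part_dabs f)
      fix K assume K: "compact K" "K \<subseteq> {s. Re s > 0}"
      show "uniform_limit K (\<lambda>N. dirichlet_eval (smooth_part N f)) (dirichlet_eval f) sequentially"
      proof (cases "K = {}")
        case False
        have "continuous_on K Re" by (intro continuous_intros)
        from continuous_attains_inf[OF K(1) False this] obtain x where x: "x \<in> K" "\<And>y. y \<in> K \<Longrightarrow> Re x \<le> Re y" by blast
        have x0: "Re x > 0" using x K by auto
        show ?thesis
        proof (rule uniform_limitI)
          fix e :: real assume "e > 0"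
          then have "\<forall>\<^sub>F N in sequentially. infsum (\<lambda>n. cmod (f n) * real n powr (- Re x)) {N<..} < e"
            using order_tendstoD(2)[OF summable_tail_tendsto[of "\<lambda>n. cmod (f n) * real n powr (- Re x)"]] f[OF x0]
            unfolding dabs_def by auto
          then show "\<forall>\<^sub>F N in sequentially. \<forall>w\<in>K. dist (dirichlet_eval (smooth_part N f) w) (dirichlet_eval f w) < e"
          proof eventually_elim
            case (elim N)
            then show ?case using smooth_part_approx[OF f[OF x0] x(2), of _ N] unfolding dist_norm by force
          qed
        qed
      qed simp
    qed (use nz s in auto)
  qed
qed

section \<open>Periodic coefficients and Fourier analysis along a residue class\<close>

text \<open>The quantities \<open>x p\<close> subtracted in the factors sum to exactly
  \<open>y\<close>, and the logarithm of the product differs from this sum by at most twice the sum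
  of their squares. That error is of order \<open>1 / T J\<close>, since the square of
  \<open>1 / p\<close> is at most \<open>1 / p\<close>.\<close>

lemma prod_tendsto_exp:
  fixes S :: "nat \<Rightarrow> nat set"
  assumes fin: "\<And>J. finite (S J)" and pos: "\<And>J p. p \<in> S J \<Longrightarrow> p \<ge> 1"
    and T: "filterlim (\<lambda>J. \<Sum>p\<in>S J. 1 / real p) at_top sequentially"
  shows "uniform_limit (cball (0::complex) R) (\<lambda>J y. \<Prod>p\<in>S J. 1 / (1 - y / (of_real (\<Sum>p\<in>S J. 1 / real p) * of_nat p))) exp sequentially"
proof (rule uniform_limitI)
  fix e :: real assume e: "e > 0"
  define T where "T J = (\<Sum>p\<in>S J. 1 / real p)" for J
  define R' where "R' = max R 1"
  have R': "R' \<ge> 1" "R' \<ge> R" by (auto simp: R'_def)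
  have "isCont exp (0::complex)" by (rule isCont_exp)
  then obtain d where d: "d > 0" "\<And>w::complex. cmod w < d \<Longrightarrow> cmod (exp w - 1) < e / exp R'"
    using e unfolding isCont_def LIM_eq
    by (metis (no_types, opaque_lifting) diff_zero divide_pos_pos exp_gt_zero exp_zero norm_zero diff_self)
  have "\<forall>\<^sub>F J in sequentially. T J > max (2 * R') (2 * R'\<^sup>2 / d)"
    using T unfolding T_def filterlim_at_top_dense by blast
  then show "\<forall>\<^sub>F J in sequentially. \<forall>y\<in>cball (0::complex) R. dist (\<Prod>p\<in>S J. 1 / (1 - y / (of_real (\<Sum>p\<in>S J. 1 / real p) * of_nat p))) (exp y) < e"
  proof eventually_elim
    case (elim J)
    \<comment> \<open>The first threshold gives \<open>cmod (x p) \<le> 1/2\<close>, as required for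
      the linear approximation of \<open>Ln\<close>; the second pushes the total error below
      \<open>d\<close>.\<close>
    have TJ: "T J > 2 * R'" "T J > 2 * R'\<^sup>2 / d" using elim by auto
    have T0: "T J > 0" using TJ R' by linarith
    show ?case
    proof
      fix y :: complex assume "y \<in> cball 0 R"
      then have y: "cmod y \<le> R'" using R' by simp
      define x where "x p = y / (of_real (T J) * of_nat p)" for p :: nat
      have xn: "cmod (x p) = cmod y / T J * (1 / real p)" for p
        using T0 by (simp add: x_def norm_divide norm_mult)
      have xh: "cmod (x p) \<le> 1/2" if "p \<in> S J" for p
      proof -
        have "cmod y / T J \<le> 1/2" using y TJ T0 by (simp add: field_simps)
        moreover have "1 / real p \<le> 1" using pos[OF that] by simp
        ultimately have "cmod y / T J * (1 / real p) \<le> 1/2 * 1" by (intro mult_mono) auto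
        then show ?thesis unfolding xn by simp
      qed
      have ne: "1 - x p \<noteq> 0" if "p \<in> S J" for p using xh[OF that] by auto
      define L where "L = (\<Sum>p\<in>S J. - Ln (1 - x p))"
      have "exp L = (\<Prod>p\<in>S J. exp (- Ln (1 - x p)))" unfolding L_def by (rule exp_sum[OF fin])
      also have "\<dots> = (\<Prod>p\<in>S J. 1 / (1 - x p))"
        by (rule prod.cong) (use ne in \<open>auto simp: exp_minus divide_inverse\<close>)
      finally have eL: "exp L = (\<Prod>p\<in>S J. 1 / (1 - x p))" .
      have sx: "(\<Sum>p\<in>S J. x p) = y"
      proof -
        have "(\<Sum>p\<in>S J. x p) = y / of_real (T J) * of_real (T J)"
          unfolding x_def T_def by (simp add: sum_distrib_left divide_inverse mult.assoc)
        then show ?thesis using T0 by simp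
      qed
      have "cmod (L - y) = cmod (\<Sum>p\<in>S J. - Ln (1 - x p) - x p)" unfolding L_def sx[symmetric] by (simp add: sum_subtractf)
      also have "\<dots> \<le> (\<Sum>p\<in>S J. 2 * (cmod (x p))\<^sup>2)"
      proof (rule order_trans[OF norm_sum sum_mono])
        fix p assume p: "p \<in> S J"
        have "cmod (Ln (1 + (- x p)) - (- x p)) \<le> (cmod (- x p))\<^sup>2 / (1 - cmod (- x p))"
          by (rule Ln_approx_linear) (use xh[OF p] in simp)
        also have "\<dots> \<le> (cmod (x p))\<^sup>2 / (1/2)" using xh[OF p] by (intro frac_le) auto
        finally have "cmod (Ln (1 - x p) + x p) \<le> 2 * (cmod (x p))\<^sup>2" by simp
        moreover have "- Ln (1 - x p) - x p = - (Ln (1 - x p) + x p)" by simp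
        ultimately show "cmod (- Ln (1 - x p) - x p) \<le> 2 * (cmod (x p))\<^sup>2" by (simp only: norm_minus_cancel)
      qed
      also have "\<dots> \<le> (\<Sum>p\<in>S J. 2 * (R'\<^sup>2 / (T J)\<^sup>2) * (1 / real p))"
      proof (rule sum_mono)
        fix p assume p: "p \<in> S J"
        have "(cmod (x p))\<^sup>2 = (cmod y / T J)\<^sup>2 * ((1 / real p) * (1 / real p))" unfolding xn by (simp add: power2_eq_square)
        also have "\<dots> \<le> (R' / T J)\<^sup>2 * (1 * (1 / real p))"
          using y T0 R' pos[OF p] by (intro mult_mono power_mono divide_right_mono) auto
        finally show "2 * (cmod (x p))\<^sup>2 \<le> 2 * (R'\<^sup>2 / (T J)\<^sup>2) * (1 / real p)" by (simp add: power_divide)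
      qed
      also have "\<dots> = 2 * (R'\<^sup>2 / (T J)\<^sup>2) * T J" unfolding T_def by (simp only: sum_distrib_left)
      also have "\<dots> = 2 * R'\<^sup>2 / T J" using T0 by (simp add: power2_eq_square)
      also have "\<dots> < d" using TJ(2) T0 d(1) by (simp add: field_simps)
      finally have "cmod (exp (L - y) - 1) < e / exp R'" by (rule d(2))
      then have "cmod (exp y) * cmod (exp (L - y) - 1) < exp R' * (e / exp R')"
        using y complex_Re_le_cmod[of y] by (intro mult_le_less_imp_less) auto
      then have "cmod (exp y * (exp (L - y) - 1)) < e" by (simp add: norm_mult)
      moreover have "exp y * (exp (L - y) - 1) = exp L - exp y" by (simp add: right_diff_distrib flip: exp_add)
      ultimately show "dist (\<Prod>p\<in>S J. 1 / (1 - y / (of_real (\<Sum>p\<in>S J. 1 / real p) * of_nat p))) (exp y) < e"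
        unfolding eL by (simp add: dist_norm x_def T_def)
    qed
  qed
qed

text \<open>Orthogonality of the characters of the integers modulo \<open>r\<close>.\<close>

lemma sum_roots_inverse_powers:
  fixes r :: nat assumes "j < r" "i < r"
  defines "w \<equiv> cis (2 * pi / real r)"
  shows "(\<Sum>u<r. (w ^ u) ^ i * inverse ((w ^ u) ^ j)) = (if i = j then of_nat r else 0)"
proof -
  have w0: "w \<noteq> 0" by (simp add: w_def)
  have "w ^ r = cis (real r * (2 * pi / real r))" unfolding w_def by (rule Complex.DeMoivre)
  then have wr: "w ^ r = 1" using assms(1) by simp
  define x where "x = w ^ i * inverse (w ^ j)"
  have powers: "(w ^ u) ^ i * inverse ((w ^ u) ^ j) = x ^ u" for u
    by (simp add: x_def power_mult_distrib power_inverse mult.commute flip: power_mult)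
  have xr: "x ^ r = 1"
  proof -
    have "x ^ r = (w ^ r) ^ i * inverse ((w ^ r) ^ j)"
      by (simp add: x_def power_mult_distrib power_inverse mult.commute flip: power_mult)
    then show ?thesis using wr by simp
  qed
  show ?thesis
  proof (cases "i = j")
    case True
    then have "x = 1" using w0 by (simp add: x_def)
    then show ?thesis using True unfolding powers by simp
  next
    case False
    have inj: "inj_on (\<lambda>k. cis (2 * pi * real k / real r)) {..<r}"
      using Complex.bij_betw_roots_unity[of r] assms(1) by (auto simp: bij_betw_def)
    have "w ^ i \<noteq> w ^ j"
    proof
      assume "w ^ i = w ^ j"
      then have "cis (2 * pi * real i / real r) = cis (2 * pi * real j / real r)"
        by (simp add: w_def Complex.DeMoivre mult.commute mult.left_commute)
      then show False using inj_onD[OF inj] assms False by auto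
    qed
    then have "x \<noteq> 1" using w0 by (auto simp: x_def field_simps)
    then have "(\<Sum>u<r. x ^ u) = 0" using xr by (simp add: sum_gp_strict)
    then show ?thesis using False unfolding powers by simp
  qed
qed

text \<open>The sum is zero-free of exponential type, hence a constant times
  \<open>exp (b * t)\<close>. Its derivative of order \<open>r\<close> at 0 equals its value because
  \<open>w u ^ r = 1\<close>, so \<open>b ^ r = 1\<close>; and its first derivative at 0 is
  \<open>b\<close> times its value. As \<open>b\<close> may be any root of unity of order dividing
  \<open>r\<close>, only the \<open>r\<close>-th powers are compared.\<close>

lemma exponential_sum_nonvanishing:
  fixes C w :: "nat \<Rightarrow> complex"
  assumes wr: "\<And>u. u < r \<Longrightarrow> w u ^ r = 1" and nz: "\<And>t. (\<Sum>u<r. C u * exp (w u * t)) \<noteq> 0" and r: "r \<ge> 1"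
  shows "(\<Sum>u<r. C u * w u) ^ r = (\<Sum>u<r. C u) ^ r"
proof -
  define E where "E i t = (\<Sum>u<r. C u * w u ^ i * exp (w u * t))" for i t
  have wn: "cmod (w u) = 1" if "u < r" for u
    using wr[OF that] r by (metis norm_one norm_power power_eq_1_iff norm_ge_zero not_one_le_zero)
  have "\<exists>b. \<forall>z. E 0 z = E 0 0 * exp (b * z)"
  proof (rule entire_nonvanishing_exponential_type[where A = "\<Sum>u<r. cmod (C u)" and B = 1])
    show "E 0 holomorphic_on UNIV" unfolding E_def by (intro holomorphic_intros)
    show "E 0 z \<noteq> 0" for z using nz by (simp add: E_def)
    show "cmod (E 0 z) \<le> (\<Sum>u<r. cmod (C u)) * exp (1 * cmod z)" for z
      unfolding E_def sum_distrib_right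
    proof (rule order_trans[OF norm_sum sum_mono])
      fix u assume "u \<in> {..<r}"
      then have "Re (w u * z) \<le> cmod z" using complex_Re_le_cmod[of "w u * z"] wn[of u] by (simp add: norm_mult)
      then show "cmod (C u * w u ^ 0 * exp (w u * z)) \<le> cmod (C u) * exp (1 * cmod z)"
        by (simp add: norm_mult mult_left_mono)
    qed
  qed simp
  then obtain b where b: "\<And>z. E 0 z = E 0 0 * exp (b * z)" by blast
  have der: "(E i has_field_derivative E (Suc i) t) (at t)" for i t
    unfolding E_def by (auto intro!: derivative_eq_intros sum.cong simp: algebra_simps)
  have Ei: "E i t = E 0 0 * b ^ i * exp (b * t)" for i t
  proof (induction i arbitrary: t)
    case 0
    show ?case using b[of t] by simp
  next
    case (Suc i)
    have "E i = (\<lambda>t. E 0 0 * b ^ i * exp (b * t))" using Suc by auto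
    moreover have "((\<lambda>t. E 0 0 * b ^ i * exp (b * t)) has_field_derivative E 0 0 * b ^ Suc i * exp (b * t)) (at t)"
      by (auto intro!: derivative_eq_intros simp: algebra_simps)
    ultimately show ?case using DERIV_unique[OF der[of i t]] by simp
  qed
  have E00: "E 0 0 \<noteq> 0" using nz[of 0] by (simp add: E_def)
  have "E r 0 = E 0 0" unfolding E_def by (rule sum.cong) (use wr in auto)
  then have br: "b ^ r = 1" using Ei[of r 0] E00 by simp
  have "E 1 0 = E 0 0 * b" using Ei[of 1 0] by simp
  then have "E 1 0 ^ r = E 0 0 ^ r" using br by (simp add: power_mult_distrib)
  then show ?thesis by (simp add: E_def)
qed

section \<open>The series with periodic coefficients\<close>

locale periodic_series =
  fixes a :: "nat \<Rightarrow> complex" and q :: nat and \<alpha> :: complex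
  assumes q: "q > 0" and per: "\<And>n. n \<ge> 1 \<Longrightarrow> a (n + q) = a n" and \<alpha>: "Re \<alpha> \<ge> 1"
begin

lemma periodic_add_mult: "n \<ge> 1 \<Longrightarrow> a (n + k * q) = a n"
proof (induction k)
  case (Suc k)
  then show ?case using per[of "n + k * q"] by (simp add: algebra_simps)
qed simp

lemma periodic_cong: assumes "m \<ge> 1" "n \<ge> 1" "[m = n] (mod q)" shows "a m = a n"
proof -
  have le: "a m = a n" if "m \<ge> 1" "m \<le> n" "[m = n] (mod q)" for m n
  proof -
    have "q dvd n - m" using that by (metis cong_altdef_nat cong_sym)
    then obtain k where "n - m = q * k" by blast
    then have "n = m + k * q" using that by (simp add: mult.commute)
    then show ?thesis using periodic_add_mult[OF that(1)] by simp
  qed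
  show ?thesis
  proof (cases "m \<le> n")
    case False
    then have "a n = a m" by (intro le) (use assms(2) cong_sym[OF assms(3)] in auto)
    then show ?thesis ..
  qed (use assms le in auto)
qed

lemma a_bounded: "\<exists>B. \<forall>n\<ge>1. cmod (a n) \<le> B"
proof -
  have "cmod (a n) \<le> (\<Sum>k=1..q. cmod (a k))" if n: "n \<ge> 1" for n
  proof -
    define k where "k = (n - 1) mod q + 1"
    have "[k = n] (mod q)"
    proof -
      have "[(n - 1) mod q + 1 = (n - 1) + 1] (mod q)" by (intro cong_add) (auto simp: cong_def)
      then show ?thesis using n by (simp add: k_def)
    qed
    moreover have k: "k \<in> {1..q}" using q by (simp add: k_def Suc_leI)
    ultimately have "a n = a k" using periodic_cong[of k n] n by simp
    then show ?thesis using member_le_sum[of k "{1..q}" "\<lambda>k. cmod (a k)"] k by simp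
  qed
  then show ?thesis by blast
qed

definition f :: "nat \<Rightarrow> complex" where "f n = a n / of_nat n powr \<alpha>"

lemma dabs_bounded_periodic:
  assumes "\<And>n. n \<ge> 1 \<Longrightarrow> cmod (x n) \<le> B" "\<sigma> > 1 - Re \<alpha>"
  shows "dabs (\<lambda>n. x n / of_nat n powr \<alpha>) \<sigma>"
  unfolding dabs_def
proof (rule summable_on_comparison_test)
  show "(\<lambda>n. B * real n powr (- (Re \<alpha> + \<sigma>))) summable_on {1..}"
    by (intro summable_on_cmult_right powr_summable_on) (use assms(2) in simp)
  fix n :: nat assume n: "n \<in> {1..}"
  have "cmod (x n / of_nat n powr \<alpha>) * real n powr (- \<sigma>) = cmod (x n) * real n powr (- (Re \<alpha> + \<sigma>))"
    using n dirichlet_term_norm[of n x \<alpha>] by (simp add: powr_add[symmetric])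
  also have "\<dots> \<le> B * real n powr (- (Re \<alpha> + \<sigma>))" using assms(1)[of n] n by (intro mult_right_mono) auto
  finally show "cmod (x n / of_nat n powr \<alpha>) * real n powr (- \<sigma>) \<le> B * real n powr (- (Re \<alpha> + \<sigma>))" .
qed auto

lemma dabs_f: "\<sigma> > 1 - Re \<alpha> \<Longrightarrow> dabs f \<sigma>"
proof -
  assume s: "\<sigma> > 1 - Re \<alpha>"
  obtain B where "\<forall>n\<ge>1. cmod (a n) \<le> B" using a_bounded by (rule exE)
  then show ?thesis unfolding f_def[abs_def] by (intro dabs_bounded_periodic[OF _ s]) auto
qed

lemma dabs_shift: "c \<ge> 1 \<Longrightarrow> \<sigma> > 1 - Re \<alpha> \<Longrightarrow> dabs (\<lambda>n. a (c * n) / of_nat n powr \<alpha>) \<sigma>"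
proof -
  assume c: "c \<ge> 1" and s: "\<sigma> > 1 - Re \<alpha>"
  obtain B where "\<forall>n\<ge>1. cmod (a n) \<le> B" using a_bounded by (rule exE)
  then show ?thesis using c by (intro dabs_bounded_periodic[where B = B, OF _ s]) (auto simp: Suc_le_eq)
qed

end

locale nonvanishing_on_line = periodic_series +
  assumes \<alpha>1: "Re \<alpha> = 1" and a1: "a 1 \<noteq> 0" and nonzero: "\<And>s. Re s > 0 \<Longrightarrow> dirichlet_eval f s \<noteq> 0"
begin

lemma polydisc: "finsupp P \<zeta> \<Longrightarrow> infsum (\<lambda>n. f n * cm \<zeta> n) {1..} \<noteq> 0"
  by (rule polydisc_nonvanishing[OF dabs_f _ nonzero]) (use \<alpha> a1 in \<open>auto simp: f_def\<close>)

text \<open>Pulling a prime congruent to \<open>c\<close> out of \<open>n\<close> replaces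
  \<open>i\<close> by \<open>i + 1\<close>, because \<open>a\<close> depends only on residues modulo
  \<open>q\<close>. The family over \<open>i\<close> is therefore closed under changes of the
  coordinates at such primes.\<close>

definition W :: "nat \<Rightarrow> nat \<Rightarrow> (nat \<Rightarrow> complex) \<Rightarrow> complex" where
  "W c i \<zeta> = infsum (\<lambda>n. a (c ^ i * n) / of_nat n powr \<alpha> * cm \<zeta> n) {1..}"

lemma W_l1:
  assumes "c \<ge> 1" "finsupp P \<zeta>"
  shows "l1 (\<lambda>n. a (c ^ i * n) / of_nat n powr \<alpha> * cm \<zeta> n)"
  by (rule polydisc_l1[OF dabs_shift assms(2)]) (use assms \<alpha> in auto)

lemma W_0: "W c 0 \<zeta> = infsum (\<lambda>n. f n * cm \<zeta> n) {1..}"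
  by (simp add: W_def f_def)

lemma W_periodic:
  assumes "c \<ge> 1" "[c ^ r = 1] (mod q)" shows "W c (i + r) \<zeta> = W c i \<zeta>"
  unfolding W_def
proof (rule infsum_cong)
  fix n :: nat assume n: "n \<in> {1..}"
  have "[c ^ i * n * c ^ r = c ^ i * n * 1] (mod q)" by (rule cong_mult[OF cong_refl assms(2)])
  then have "a (c ^ i * n * c ^ r) = a (c ^ i * n * 1)" using assms(1) n by (intro periodic_cong) (auto simp: Suc_le_eq)
  then show "a (c ^ (i + r) * n) / of_nat n powr \<alpha> * cm \<zeta> n = a (c ^ i * n) / of_nat n powr \<alpha> * cm \<zeta> n"
    by (simp add: power_add mult.commute mult.left_commute)
qed

text \<open>Terms with \<open>n\<close> prime to \<open>p\<close> give the value at the old point;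
  the others are \<open>n = p * m\<close>. The new point reappears on the right because
  \<open>m\<close> may again contain \<open>p\<close>, so this is an implicit form of the geometric
  series in \<open>y\<close>.\<close>

lemma W_add_prime:
  assumes c: "c \<ge> 1" and p: "prime p" "[p = c] (mod q)" and \<zeta>: "\<zeta> p = 0" "finsupp P \<zeta>" and y: "cmod y < 1"
  shows "W c i (\<zeta>(p := y)) = W c i \<zeta> + y / of_nat p powr \<alpha> * W c (Suc i) (\<zeta>(p := y))"
proof -
  let ?\<zeta> = "\<zeta>(p := y)"
  let ?g = "\<lambda>n. a (c ^ i * n) / of_nat n powr \<alpha> * cm ?\<zeta> n"
  have p1: "p \<ge> 1" using prime_ge_1_nat[OF p(1)] .
  have fs: "finsupp (insert p P) ?\<zeta>" using \<zeta> p y by (auto simp: finsupp_def)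
  have u: "{1..} = {n. n \<ge> 1 \<and> \<not> p dvd n} \<union> {n. n \<ge> 1 \<and> p dvd n}" by auto
  have s: "?g summable_on {1..}" by (rule l1_summable[OF W_l1[OF c fs]])
  have "W c i ?\<zeta> = infsum ?g {n. n \<ge> 1 \<and> \<not> p dvd n} + infsum ?g {n. n \<ge> 1 \<and> p dvd n}"
    unfolding W_def
    by (subst u, rule infsum_Un_disjoint[OF summable_on_subset_banach[OF s] summable_on_subset_banach[OF s]]) auto
  also have "infsum ?g {n. n \<ge> 1 \<and> \<not> p dvd n} = W c i \<zeta>"
    unfolding W_def
  proof (rule infsum_cong_neutral)
    fix n assume n: "n \<in> {1..} - {n. n \<ge> 1 \<and> \<not> p dvd n}"
    then obtain m where m: "n = p * m" by auto
    then have "m \<ge> 1" using n by (cases m) auto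
    then have "cm \<zeta> n = 0" using cm_mult[OF p1, of m \<zeta>] cm_prime[OF p(1), of \<zeta>] \<zeta>(1) m by simp
    then show "a (c ^ i * n) / of_nat n powr \<alpha> * cm \<zeta> n = 0" by simp
  next
    fix n assume n: "n \<in> {n. n \<ge> 1 \<and> \<not> p dvd n} \<inter> {1..}"
    have "cm ?\<zeta> n = cm \<zeta> n" by (rule cm_cong) (use n in auto)
    then show "?g n = a (c ^ i * n) / of_nat n powr \<alpha> * cm \<zeta> n" by simp
  qed auto
  also have "infsum ?g {n. n \<ge> 1 \<and> p dvd n} = infsum (\<lambda>m. ?g (p * m)) {1..}"
    by (rule infsum_reindex_bij_witness[where i = "\<lambda>m. p * m" and j = "\<lambda>n. n div p"])
      (use p1 in \<open>auto simp: Suc_le_eq elim!: dvdE\<close>)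
  also have "\<dots> = infsum (\<lambda>m. y / of_nat p powr \<alpha> * (a (c ^ Suc i * m) / of_nat m powr \<alpha> * cm ?\<zeta> m)) {1..}"
  proof (rule infsum_cong)
    fix m :: nat assume m: "m \<in> {1..}"
    then have m1: "m \<ge> 1" by simp
    have "[c ^ i * (p * m) = c ^ i * (c * m)] (mod q)" using p(2) by (intro cong_mult cong_refl)
    then have e: "a (c ^ i * (p * m)) = a (c ^ Suc i * m)"
      using periodic_cong[of "c ^ i * (p * m)" "c ^ i * (c * m)"] c p1 m1 by (simp add: Suc_le_eq mult.assoc mult.left_commute)
    show "?g (p * m) = y / of_nat p powr \<alpha> * (a (c ^ Suc i * m) / of_nat m powr \<alpha> * cm ?\<zeta> m)"
      unfolding e of_nat_powr_mult[OF p1 m1] cm_mult[OF p1 m1] cm_prime[OF p(1)] by simp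
  qed
  also have "\<dots> = y / of_nat p powr \<alpha> * W c (Suc i) ?\<zeta>" unfolding W_def by (rule infsum_cmult_right')
  finally show ?thesis .
qed

text \<open>Discrete Fourier transform in \<open>i\<close>: it diagonalises the effect of a new prime on \<open>W c i\<close>.\<close>

definition Wh :: "nat \<Rightarrow> nat \<Rightarrow> complex \<Rightarrow> (nat \<Rightarrow> complex) \<Rightarrow> complex" where
  "Wh c r w \<zeta> = (\<Sum>i<r. inverse (w ^ i) * W c i \<zeta>)"

text \<open>The shift of \<open>i\<close> is cyclic of length \<open>r\<close>, for \<open>W\<close>
  as well as for the powers of \<open>w\<close>, so the transform turns it into multiplication by
  \<open>w\<close>. The new coordinate thus enters through a single Euler factor.\<close>

lemma Wh_add_prime:
  assumes c: "c \<ge> 1" "[c ^ r = 1] (mod q)" and r: "r \<ge> 1" and w: "w ^ r = 1"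
    and p: "prime p" "[p = c] (mod q)" and \<zeta>: "\<zeta> p = 0" "finsupp P \<zeta>" and y: "cmod y < 1"
  shows "Wh c r w (\<zeta>(p := y)) * (1 - w * (y / of_nat p powr \<alpha>)) = Wh c r w \<zeta>"
proof -
  let ?\<zeta> = "\<zeta>(p := y)" and ?x = "y / of_nat p powr \<alpha>"
  have w0: "w \<noteq> 0" by (rule notI) (use w r in \<open>simp add: power_0_left\<close>)
  let ?h = "\<lambda>i. inverse (w ^ i) * W c i ?\<zeta>"
  have cyc: "(\<Sum>i<r. ?h (Suc i)) = (\<Sum>i<r. ?h i)"
  proof -
    have "?h r = ?h 0" using W_periodic[OF c, of 0 ?\<zeta>] w by simp
    then show ?thesis using sum.lessThan_Suc_shift[of ?h r] sum.lessThan_Suc[of ?h r] by simp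
  qed
  have "Wh c r w ?\<zeta> = (\<Sum>i<r. inverse (w ^ i) * (W c i \<zeta> + ?x * W c (Suc i) ?\<zeta>))"
    unfolding Wh_def by (intro sum.cong refl arg_cong2[where f = "(*)"] W_add_prime[OF c(1) p \<zeta> y])
  also have "\<dots> = Wh c r w \<zeta> + (\<Sum>i<r. w * ?x * ?h (Suc i))"
    unfolding Wh_def sum.distrib[symmetric] by (rule sum.cong[OF refl]) (use w0 in \<open>simp add: field_simps\<close>)
  also have "(\<Sum>i<r. w * ?x * ?h (Suc i)) = w * ?x * Wh c r w ?\<zeta>"
    unfolding sum_distrib_left[symmetric] cyc Wh_def ..
  finally have eq: "Wh c r w ?\<zeta> = Wh c r w \<zeta> + w * ?x * Wh c r w ?\<zeta>" .
  have "X * (1 - k) = A" if "X = A + k * X" for X A k :: complex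
    using that by (simp add: algebra_simps)
  from this[OF eq] show ?thesis .
qed

lemma W_inversion:
  assumes "i < r"
  shows "W c i \<zeta> = (\<Sum>u<r. Wh c r (cis (2 * pi / real r) ^ u) \<zeta> / of_nat r * (cis (2 * pi / real r) ^ u) ^ i)"
proof -
  let ?w = "\<lambda>u. cis (2 * pi / real r) ^ u"
  have "(\<Sum>u<r. Wh c r (?w u) \<zeta> / of_nat r * ?w u ^ i) = (\<Sum>u<r. \<Sum>j<r. W c j \<zeta> / of_nat r * (?w u ^ i * inverse (?w u ^ j)))"
    unfolding Wh_def sum_divide_distrib sum_distrib_right by (intro sum.cong refl) (simp add: field_simps)
  also have "\<dots> = (\<Sum>j<r. W c j \<zeta> / of_nat r * (\<Sum>u<r. ?w u ^ i * inverse (?w u ^ j)))"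
    by (subst sum.swap) (simp add: sum_distrib_left)
  also have "\<dots> = (\<Sum>j<r. if j = i then W c i \<zeta> else 0)"
    by (rule sum.cong[OF refl]) (use assms sum_roots_inverse_powers[of _ r i] in auto)
  also have "\<dots> = W c i \<zeta>" using assms by (simp add: sum.delta)
  finally show ?thesis by simp
qed

end

section \<open>Residue classes with many primes\<close>

lemma uniform_limit_finite_sum:
  fixes g :: "'i \<Rightarrow> 'a \<Rightarrow> 'b::real_normed_vector"
  assumes "finite I" "\<And>i. i \<in> I \<Longrightarrow> uniform_limit K (h i) (g i) F"
  shows "uniform_limit K (\<lambda>n x. \<Sum>i\<in>I. h i n x) (\<lambda>x. \<Sum>i\<in>I. g i x) F"
  using assms
proof (induction I rule: finite_induct)
  case (insert i I)
  have "uniform_limit K (\<lambda>n x. h i n x + (\<Sum>i\<in>I. h i n x)) (\<lambda>x. g i x + (\<Sum>i\<in>I. g i x)) F"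
    by (rule uniform_limit_add) (use insert in auto)
  then show ?case using insert by simp
qed (simp add: uniform_limit_const)

context nonvanishing_on_line
begin

text \<open>Primes above \<open>N\<close> have coordinate 0 in \<open>smooth_pt N s\<close>, so
  their coordinates can be set one after another, each contributing its own Euler factor.\<close>

lemma Wh_steer:
  assumes c: "c \<ge> 1" "[c ^ r = 1] (mod q)" and r: "r \<ge> 1" and w: "w ^ r = 1" and s: "Re s > 0"
    and A: "finite A" "\<And>p. p \<in> A \<Longrightarrow> prime p \<and> N < p \<and> [p = c] (mod q)" and y: "\<And>p. p \<in> A \<Longrightarrow> cmod (y p) < 1"
  shows "finsupp (A \<union> {p. prime p \<and> p \<le> N}) (\<lambda>p. if p \<in> A then y p else smooth_pt N s p)"
    and "Wh c r w (\<lambda>p. if p \<in> A then y p else smooth_pt N s p) * (\<Prod>p\<in>A. 1 - w * (y p / of_nat p powr \<alpha>))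
      = Wh c r w (smooth_pt N s)"
proof -
  have fs: "finsupp (B \<union> {p. prime p \<and> p \<le> N}) (\<lambda>p. if p \<in> B then y p else smooth_pt N s p)" if B: "finite B" "B \<subseteq> A" for B
  proof -
    have "finsupp {p. prime p \<and> p \<le> N} (smooth_pt N s)" by (rule finsupp_smooth_pt[OF s])
    then show ?thesis unfolding finsupp_def using B A(2) y by auto
  qed
  show "finsupp (A \<union> {p. prime p \<and> p \<le> N}) (\<lambda>p. if p \<in> A then y p else smooth_pt N s p)"
    using fs[OF A(1)] by simp
  have "B \<subseteq> A \<Longrightarrow> Wh c r w (\<lambda>p. if p \<in> B then y p else smooth_pt N s p) * (\<Prod>p\<in>B. 1 - w * (y p / of_nat p powr \<alpha>))
      = Wh c r w (smooth_pt N s)" if "finite B" for B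
    using that
  proof (induction B rule: finite_induct)
    case (insert p B)
    let ?\<zeta> = "\<lambda>p. if p \<in> B then y p else smooth_pt N s p"
    have p: "prime p" "N < p" "[p = c] (mod q)" using A(2)[of p] insert.prems by auto
    have e: "(\<lambda>x. if x \<in> insert p B then y x else smooth_pt N s x) = ?\<zeta>(p := y p)" by auto
    have "Wh c r w (?\<zeta>(p := y p)) * (1 - w * (y p / of_nat p powr \<alpha>)) = Wh c r w ?\<zeta>"
    proof (rule Wh_add_prime[OF c r w p(1,3) _ fs])
      show "?\<zeta> p = 0" using insert.hyps p by (simp add: smooth_pt_def)
    qed (use insert y in auto)
    then show ?case unfolding e using insert by (simp add: mult.assoc[symmetric])
  qed simp
  from this[OF A(1)] show "Wh c r w (\<lambda>p. if p \<in> A then y p else smooth_pt N s p) * (\<Prod>p\<in>A. 1 - w * (y p / of_nat p powr \<alpha>))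
      = Wh c r w (smooth_pt N s)" by simp
qed

text \<open>The primes \<open>p = c\<close> modulo \<open>q\<close> with \<open>N < p \<le> J\<close> get the value \<open>t * p powr (\<alpha> - 1) / T J\<close>, where \<open>T J\<close> is
  their reciprocal sum, so that their Euler factors multiply to approximately \<open>exp (w * t)\<close>.\<close>

lemma steered_exponential_nonzero:
  assumes c: "c \<ge> 1" "[c ^ r = 1] (mod q)" and r: "r \<ge> 1" and s: "Re s > 0"
    and div: "filterlim (\<lambda>J. \<Sum>p\<in>{p. prime p \<and> p \<le> J \<and> [p = c] (mod q)}. 1 / real p) at_top sequentially"
  shows "(\<Sum>u<r. Wh c r (cis (2 * pi / real r) ^ u) (smooth_pt N s) / of_nat r * exp (cis (2 * pi / real r) ^ u * t)) \<noteq> 0"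
proof -
  define w where "w u = cis (2 * pi / real r) ^ u" for u
  have "cis (2 * pi / real r) ^ r = cis (real r * (2 * pi / real r))" by (rule Complex.DeMoivre)
  then have c1: "cis (2 * pi / real r) ^ r = 1" using r by simp
  have wr: "w u ^ r = 1" for u
    unfolding w_def power_mult[symmetric] mult.commute[of u] power_mult c1 by simp
  have wn: "cmod (w u) = 1" for u by (simp add: w_def norm_power)
  define C where "C u = Wh c r (w u) (smooth_pt N s) / of_nat r" for u
  define S where "S J = {p. prime p \<and> N < p \<and> p \<le> J \<and> [p = c] (mod q)}" for J
  define T where "T J = (\<Sum>p\<in>S J. 1 / real p)" for J
  have finS: "finite (S J)" for J by (rule finite_subset[of _ "{..J}"]) (auto simp: S_def)
  have posS: "p \<ge> 1" if "p \<in> S J" for p J using that prime_ge_1_nat by (auto simp: S_def)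
  \<comment> \<open>Discarding the primes up to \<open>N\<close> lowers the reciprocal sums by at
    most \<open>K\<close>, so they still diverge.\<close>
  define K where "K = (\<Sum>p\<in>{1..N}. 1 / real p)"
  have T: "filterlim T at_top sequentially"
  proof -
    have le: "(\<Sum>p\<in>{p. prime p \<and> p \<le> J \<and> [p = c] (mod q)}. 1 / real p) \<le> T J + K" for J
    proof -
      have "(\<Sum>p\<in>{p. prime p \<and> p \<le> J \<and> [p = c] (mod q)}. 1 / real p) \<le> (\<Sum>p\<in>S J \<union> {1..N}. 1 / real p)"
        by (rule sum_mono2) (use finS prime_ge_1_nat in \<open>auto simp: S_def\<close>)
      also have "\<dots> = T J + K" unfolding T_def K_def by (rule sum.union_disjoint) (use finS in \<open>auto simp: S_def\<close>)
      finally show ?thesis .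
    qed
    have "filterlim (\<lambda>J. T J + K) at_top sequentially"
      by (rule filterlim_at_top_mono[OF div]) (use le in auto)
    then have "filterlim (\<lambda>J. - K + (T J + K)) at_top sequentially"
      by (rule filterlim_tendsto_add_at_top[OF tendsto_const])
    then show ?thesis by simp
  qed
  \<comment> \<open>\<open>R\<close> exceeds \<open>cmod t\<close>, so \<open>t\<close> is interior
    to the ball. The condition \<open>T J > R\<close> keeps the steered coordinates in the unit disc
    and the denominators of \<open>P\<close> away from 0.\<close>
  define R where "R = cmod t + 1"
  have R0: "R > 0" by (simp add: R_def add_nonneg_pos)
  have "\<forall>\<^sub>F J in sequentially. T J > R" using T unfolding filterlim_at_top_dense by (rule spec)
  then obtain J0 where J0: "\<And>J. J \<ge> J0 \<Longrightarrow> T J > R" unfolding eventually_sequentially by metis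
  define P where "P J y = (\<Prod>p\<in>S J. 1 / (1 - y / (of_real (T J) * of_nat p)))" for J and y :: complex
  \<comment> \<open>\<open>F k\<close> approximates the exponential sum and is identified below with
    a value of the series at a point of the polydisc, hence is non-zero on the ball. The offset
    \<open>J0\<close> ensures \<open>T (k + J0) > R\<close>.\<close>
  define F where "F k t = (\<Sum>u<r. C u * P (k + J0) (w u * t))" for k t
  have small: "1 - y / (of_real (T J) * of_nat p) \<noteq> 0" if "cmod y < R" "J \<ge> J0" "p \<in> S J" for y J p
  proof
    assume "1 - y / (of_real (T J) * of_nat p) = 0"
    then have "cmod (y / (of_real (T J) * of_nat p)) = 1" by simp
    moreover have T0: "T J > 0" using less_trans[OF R0 J0[OF that(2)]] .
    ultimately have "cmod y = T J * real p" using posS[OF that(3)] by (simp add: norm_divide norm_mult field_simps)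
    moreover have "T J * 1 \<le> T J * real p" using posS[OF that(3)] T0 by (intro mult_left_mono) auto
    ultimately show False using that(1) J0[OF that(2)] by simp
  qed
  have "(\<Sum>u<r. C u * exp (w u * t)) \<noteq> 0"
  proof (cases "(\<lambda>t. \<Sum>u<r. C u * exp (w u * t)) constant_on ball 0 R")
    \<comment> \<open>A constant sum equals its value at \<open>t = 0\<close>, which by Fourier
      inversion is the value of the series at \<open>smooth_pt N s\<close>.\<close>
    case True
    have "(\<Sum>u<r. C u * exp (w u * t)) = (\<Sum>u<r. C u * exp (w u * 0))"
      using True unfolding constant_on_def R_def by (metis centre_in_ball dist_0_norm less_add_one mem_ball norm_ge_zero add_nonneg_pos zero_less_one)
    also have "\<dots> = W c 0 (smooth_pt N s)"
      using W_inversion[of 0 r c "smooth_pt N s"] r by (simp add: C_def w_def)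
    also have "\<dots> \<noteq> 0" unfolding W_0 by (rule polydisc[OF finsupp_smooth_pt[OF s]])
    finally show ?thesis .
  next
    case False
    show ?thesis
    proof (rule Hurwitz_no_zeros[OF open_ball connected_ball _ _ _ False, of F])
      show "F k holomorphic_on ball 0 R" for k
        unfolding F_def P_def
      proof (intro holomorphic_intros)
        fix u p :: nat and x :: complex assume x: "x \<in> ball 0 R" and p: "p \<in> S (k + J0)"
        have "cmod (w u * x) < R" using x wn by (simp add: norm_mult)
        then show "1 - w u * x / (of_real (T (k + J0)) * of_nat p) \<noteq> 0" by (rule small) (use p in auto)
        have "T (k + J0) > 0" using J0[of "k + J0"] R0 by (intro less_trans[OF R0]) simp
        then show "of_real (T (k + J0)) * of_nat p \<noteq> (0::complex)" using posS[OF p] by auto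
      qed
      show "(\<lambda>t. \<Sum>u<r. C u * exp (w u * t)) holomorphic_on ball 0 R" by (intro holomorphic_intros)
      show "t \<in> ball 0 R" by (simp add: R_def)
      fix k :: nat and z :: complex assume z: "z \<in> ball 0 R"
      let ?J = "k + J0"
      have TJ: "T ?J > R" by (rule J0) simp
      have T0: "T ?J > 0" using less_trans[OF R0 TJ] .
      define y where "y p = z / of_real (T ?J) * of_nat p powr (\<alpha> - 1)" for p :: nat
      \<comment> \<open>\<open>Re \<alpha> = 1\<close> enters here:
        \<open>p powr (\<alpha> - 1)\<close> has modulus 1, so all steered coordinates have the same
        modulus \<open>cmod z / T ?J\<close>.\<close>
      have yn: "cmod (y p) < 1" if "p \<in> S ?J" for p
      proof -
        have "cmod (of_nat p powr (\<alpha> - 1)) = 1" using norm_of_nat_powr[OF posS[OF that], of "\<alpha> - 1"] \<alpha>1 posS[OF that] by simp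
        then show ?thesis using z TJ T0 by (simp add: y_def norm_mult norm_divide)
      qed
      have ya: "y p / of_nat p powr \<alpha> = z / (of_real (T ?J) * of_nat p)" if "p \<in> S ?J" for p
        using posS[OF that] by (simp add: y_def powr_diff)
      let ?\<zeta> = "\<lambda>p. if p \<in> S ?J then y p else smooth_pt N s p"
      have SJ: "prime p \<and> N < p \<and> [p = c] (mod q)" if "p \<in> S ?J" for p using that by (simp add: S_def)
      have "C u * P ?J (w u * z) = Wh c r (w u) ?\<zeta> / of_nat r" for u
      proof -
        have e1: "Wh c r (w u) ?\<zeta> * (\<Prod>p\<in>S ?J. 1 - w u * (y p / of_nat p powr \<alpha>)) = Wh c r (w u) (smooth_pt N s)"
          by (rule Wh_steer(2)[OF c r wr s finS SJ yn])
        have e2: "(\<Prod>p\<in>S ?J. 1 - w u * (y p / of_nat p powr \<alpha>)) = (\<Prod>p\<in>S ?J. 1 - w u * z / (of_real (T ?J) * of_nat p))"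
          by (rule prod.cong) (use ya in auto)
        have "cmod (w u * z) < R" using z wn by (simp add: norm_mult)
        then have ne: "(\<Prod>p\<in>S ?J. 1 - w u * z / (of_real (T ?J) * of_nat p)) \<noteq> 0"
          unfolding prod_zero_iff[OF finS] using small[of "w u * z" ?J] by auto
        have e3: "P ?J (w u * z) = 1 / (\<Prod>p\<in>S ?J. 1 - w u * z / (of_real (T ?J) * of_nat p))"
          unfolding P_def by (simp add: prod_dividef)
        show ?thesis unfolding C_def e3 e1[symmetric] e2 using ne by simp
      qed
      then have "F k z = (\<Sum>u<r. Wh c r (w u) ?\<zeta> / of_nat r)" by (simp add: F_def)
      also have "\<dots> = W c 0 ?\<zeta>" using W_inversion[of 0 r c ?\<zeta>] r by (simp add: w_def)
      also have "\<dots> \<noteq> 0" unfolding W_0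
        by (rule polydisc[OF Wh_steer(1)[OF c r wr[of 0] s finS SJ yn]])
      finally show "F k z \<noteq> 0" .
    next
      fix K' :: "complex set" assume K': "compact K'" "K' \<subseteq> ball 0 R"
      have ul: "uniform_limit (cball 0 R) P exp sequentially"
        unfolding P_def[abs_def] T_def by (rule prod_tendsto_exp[OF finS posS T[unfolded T_def[abs_def]]])
      show "uniform_limit K' F (\<lambda>t. \<Sum>u<r. C u * exp (w u * t)) sequentially"
        unfolding F_def[abs_def]
      proof (rule uniform_limit_finite_sum[OF finite_lessThan])
        fix u
        have "uniform_limit K' (\<lambda>k t. P (k + J0) (w u * t)) (\<lambda>t. exp (w u * t)) sequentially"
        proof (rule uniform_limitI)
          fix e :: real assume "e > 0"
          then have "\<forall>\<^sub>F J in sequentially. \<forall>y\<in>cball 0 R. dist (P J y) (exp y) < e" by (rule uniform_limitD[OF ul])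
          then have "\<forall>\<^sub>F k in sequentially. \<forall>y\<in>cball 0 R. dist (P (k + J0) y) (exp y) < e"
            by (rule eventually_sequentially_seg[THEN iffD2])
          then show "\<forall>\<^sub>F k in sequentially. \<forall>x\<in>K'. dist (P (k + J0) (w u * x)) (exp (w u * x)) < e"
          proof eventually_elim
            case (elim k)
            show ?case
            proof
              fix x assume "x \<in> K'"
              then have "w u * x \<in> cball 0 R" using K'(2) wn by (auto simp: norm_mult less_imp_le)
              then show "dist (P (k + J0) (w u * x)) (exp (w u * x)) < e" using elim by blast
            qed
          qed
        qed
        then show "uniform_limit K' (\<lambda>k t. C u * P (k + J0) (w u * t)) (\<lambda>t. C u * exp (w u * t)) sequentially"
          by (rule bounded_linear.uniform_limit[OF bounded_linear_mult_right])
      qed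
    qed
  qed
  then show ?thesis by (simp add: C_def w_def)
qed

text \<open>Letting \<open>N\<close> grow gives \<open>D 1 s ^ r = D 0 s ^ r\<close>. The quotient
  is continuous with values among finitely many roots of unity, hence constant on the half-plane,
  and uniqueness of coefficients transfers the proportionality to \<open>a\<close>.\<close>

lemma divergent_class_good:
  assumes c: "c \<ge> 1" "coprime c q"
    and div: "filterlim (\<lambda>J. \<Sum>p\<in>{p. prime p \<and> p \<le> J \<and> [p = c] (mod q)}. 1 / real p) at_top sequentially"
  shows "\<exists>l. \<forall>n\<ge>1. a (c * n) = l * a n"
proof -
  \<comment> \<open>Doubling Euler's exponent ensures \<open>r \<ge> 2\<close>, so that the index 1
    lies in the range of the transform even if \<open>totient q = 1\<close>.\<close>
  define r where "r = 2 * totient q"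
  have r2: "r \<ge> 2" using q by (simp add: r_def Suc_le_eq)
  have "[c ^ totient q = 1] (mod q)" by (rule euler_theorem[OF c(2)])
  then have "[(c ^ totient q) ^ 2 = 1 ^ 2] (mod q)" by (rule cong_pow)
  then have cr: "[c ^ r = 1] (mod q)" by (simp add: r_def power_mult[symmetric] mult.commute)
  define D where "D i = dirichlet_eval (\<lambda>n. a (c ^ i * n) / of_nat n powr \<alpha>)" for i
  have dab: "dabs (\<lambda>n. a (c ^ i * n) / of_nat n powr \<alpha>) \<sigma>" if "\<sigma> > 0" for i \<sigma>
    by (rule dabs_shift) (use c that \<alpha>1 in auto)
  have D0: "D 0 = dirichlet_eval f" unfolding D_def f_def by simp
  have eq: "D 1 s ^ r = D 0 s ^ r" if s: "Re s > 0" for s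
  proof -
    have lim: "(\<lambda>N. W c i (smooth_pt N s)) \<longlonglongrightarrow> D i s" for i
      unfolding W_def infsum_smooth_pt D_def by (rule smooth_part_tendsto[OF dab[OF s]])
    have "W c 1 (smooth_pt N s) ^ r = W c 0 (smooth_pt N s) ^ r" for N
    proof -
      let ?w = "\<lambda>u. cis (2 * pi / real r) ^ u"
      have "cis (2 * pi / real r) ^ r = cis (real r * (2 * pi / real r))" by (rule Complex.DeMoivre)
      then have c1: "cis (2 * pi / real r) ^ r = 1" using r2 by simp
      have "(\<Sum>u<r. Wh c r (?w u) (smooth_pt N s) / of_nat r * ?w u) ^ r = (\<Sum>u<r. Wh c r (?w u) (smooth_pt N s) / of_nat r) ^ r"
      proof (rule exponential_sum_nonvanishing)
        show "?w u ^ r = 1" for u unfolding power_mult[symmetric] mult.commute[of u] power_mult c1 by simp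
        show "(\<Sum>u<r. Wh c r (?w u) (smooth_pt N s) / of_nat r * exp (?w u * t)) \<noteq> 0" for t
          by (rule steered_exponential_nonzero[OF c(1) cr _ s div]) (use r2 in simp)
      qed (use r2 in simp)
      then show ?thesis using W_inversion[of 1 r c "smooth_pt N s"] W_inversion[of 0 r c "smooth_pt N s"] r2 by simp
    qed
    then have "(\<lambda>N. W c 0 (smooth_pt N s) ^ r) \<longlonglongrightarrow> D 1 s ^ r" using tendsto_power[OF lim[of 1], of r] by simp
    then show ?thesis using LIMSEQ_unique tendsto_power[OF lim[of 0], of r] by blast
  qed
  let ?H = "{s. Re s > 0}"
  define \<rho> where "\<rho> s = D 1 s / D 0 s" for s
  have nz: "D 0 s \<noteq> 0" if "Re s > 0" for s unfolding D0 by (rule nonzero[OF that])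
  have "\<rho> constant_on ?H"
  proof (rule continuous_finite_range_constant_eq[THEN iffD1, rule_format, OF _ conjI])
    show "connected ?H" by (rule convex_connected[OF convex_halfspace_Re_gt])
    have h: "D i holomorphic_on ?H" for i unfolding D_def by (rule holomorphic_dirichlet_eval[OF dab])
    show "continuous_on ?H \<rho>" unfolding \<rho>_def
      by (intro continuous_on_divide holomorphic_on_imp_continuous_on h) (use nz in auto)
    have "\<rho> ` ?H \<subseteq> {z. z ^ r = 1}" using eq nz by (auto simp: \<rho>_def power_divide)
    moreover have "finite {z::complex. z ^ r = 1}" by (rule finite_roots_unity) (use r2 in simp)
    ultimately show "finite (\<rho> ` ?H)" by (rule finite_subset)
  qed
  then obtain l where l: "\<And>s. Re s > 0 \<Longrightarrow> \<rho> s = l" unfolding constant_on_def by auto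
  define g where "g n = a (c * n) / of_nat n powr \<alpha> - l * f n" for n
  have df: "dabs (\<lambda>n. l * f n) \<sigma>" if "\<sigma> > 0" for \<sigma> by (rule dabs_scale[OF dabs_f]) (use that \<alpha>1 in simp)
  have dc: "dabs (\<lambda>n. a (c * n) / of_nat n powr \<alpha>) \<sigma>" if "\<sigma> > 0" for \<sigma> using dab[OF that, of 1] by simp
  have dg: "dabs g 1" using dabs_add[OF dc[of 1] dabs_scale[OF df[of 1], of "-1"]] by (simp add: g_def[abs_def])
  have "g n = 0" if n: "n \<ge> 1" for n
  proof (rule dirichlet_eval_unique[OF dg _ n])
    fix s :: complex assume s: "Re s \<ge> 1"
    have "dirichlet_eval g s = dirichlet_eval (\<lambda>n. a (c * n) / of_nat n powr \<alpha>) s - dirichlet_eval (\<lambda>n. l * f n) s"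
      unfolding g_def by (rule dirichlet_eval_diff[OF dc df]) (use s in auto)
    also have "\<dots> = D 1 s - l * D 0 s" unfolding dirichlet_eval_scale D0 by (simp add: D_def)
    also have "\<dots> = 0" using l[of s] nz[of s] s by (simp add: \<rho>_def field_simps)
    finally show "dirichlet_eval g s = 0" .
  qed
  then have "a (c * n) = l * a n" if "n \<ge> 1" for n
    using that by (auto simp: g_def f_def)
  then show ?thesis by blast
qed

end

section \<open>Every residue class prime to the period is good\<close>

lemma sum_by_residues:
  fixes g :: "nat \<Rightarrow> real"
  assumes per: "\<And>x j. x \<ge> 1 \<Longrightarrow> x \<le> Q \<Longrightarrow> P (j * Q + x) \<longleftrightarrow> P x"
  shows "(\<Sum>n\<in>{n\<in>{1..J * Q}. P n}. g n) = (\<Sum>x\<in>{x\<in>{1..Q}. P x}. \<Sum>j<J. g (j * Q + x))"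
proof (induction J)
  case (Suc J)
  have "{n\<in>{1..Suc J * Q}. P n} = {n\<in>{1..J * Q}. P n} \<union> (\<lambda>x. J * Q + x) ` {x\<in>{1..Q}. P x}"
  proof (intro equalityI subsetI)
    fix n assume n: "n \<in> {n\<in>{1..Suc J * Q}. P n}"
    show "n \<in> {n\<in>{1..J * Q}. P n} \<union> (\<lambda>x. J * Q + x) ` {x\<in>{1..Q}. P x}"
    proof (cases "n \<le> J * Q")
      case False
      define x where "x = n - J * Q"
      have x: "n = J * Q + x" "x \<ge> 1" "x \<le> Q" using False n by (auto simp: x_def)
      then have "P x" using per[of x J] n by auto
      then show ?thesis using x by auto
    qed (use n in auto)
  next
    fix n assume "n \<in> {n\<in>{1..J * Q}. P n} \<union> (\<lambda>x. J * Q + x) ` {x\<in>{1..Q}. P x}"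
    then show "n \<in> {n\<in>{1..Suc J * Q}. P n}"
    proof
      assume "n \<in> (\<lambda>x. J * Q + x) ` {x\<in>{1..Q}. P x}"
      then obtain x where x: "n = J * Q + x" "x \<ge> 1" "x \<le> Q" "P x" by auto
      then show ?thesis using per[of x J] by simp
    qed auto
  qed
  then have "(\<Sum>n\<in>{n\<in>{1..Suc J * Q}. P n}. g n) = (\<Sum>n\<in>{n\<in>{1..J * Q}. P n}. g n) + (\<Sum>n\<in>(\<lambda>x. J * Q + x) ` {x\<in>{1..Q}. P x}. g n)"
    by (simp only:, intro sum.union_disjoint) auto
  also have "(\<Sum>n\<in>(\<lambda>x. J * Q + x) ` {x\<in>{1..Q}. P x}. g n) = (\<Sum>x\<in>{x\<in>{1..Q}. P x}. g (J * Q + x))"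
    by (subst sum.reindex) (auto simp: inj_on_def)
  finally show ?case unfolding Suc.IH by (simp add: sum.distrib)
qed simp

context nonvanishing_on_line
begin

text \<open>\<open>a\<close> is an eigenvector of dilation by \<open>m\<close>. This depends only on
  the residue class of a positive \<open>m\<close> modulo \<open>q\<close>.\<close>

definition good :: "nat \<Rightarrow> bool" where
  "good m \<longleftrightarrow> (\<exists>l. \<forall>n\<ge>1. a (m * n) = l * a n)"

lemma good_1: "good 1" unfolding good_def by (intro exI[of _ 1]) simp

lemma good_mult: assumes "good m" "good n" "n \<ge> 1" shows "good (m * n)"
proof -
  obtain l where l: "\<And>k. k \<ge> 1 \<Longrightarrow> a (m * k) = l * a k" using assms(1) unfolding good_def by blast
  obtain l' where l': "\<And>k. k \<ge> 1 \<Longrightarrow> a (n * k) = l' * a k" using assms(2) unfolding good_def by blast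
  have "a (m * n * k) = l * l' * a k" if "k \<ge> 1" for k
    using l[of "n * k"] l'[OF that] assms(3) that by (simp add: mult.assoc Suc_le_eq)
  then show ?thesis unfolding good_def by blast
qed

lemma good_cong: assumes "[m = m'] (mod q)" "m \<ge> 1" "m' \<ge> 1" shows "good m \<longleftrightarrow> good m'"
proof -
  have "a (m * n) = a (m' * n)" if "n \<ge> 1" for n
    by (rule periodic_cong) (use assms that in \<open>auto simp: Suc_le_eq intro: cong_mult\<close>)
  then show ?thesis unfolding good_def by auto
qed

text \<open>Some power of \<open>h\<close> is congruent to 1 and \<open>a 1\<close> is non-zero, so
  the eigenvalue \<open>l'\<close> is a root of unity and can be divided out.\<close>

lemma good_cancel:
  assumes "good (m * h)" "good h" "coprime h q" "m \<ge> 1" "h \<ge> 1"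
  shows "good m"
proof -
  obtain l where l: "\<And>k. k \<ge> 1 \<Longrightarrow> a (m * h * k) = l * a k" using assms(1) unfolding good_def by blast
  obtain l' where l': "\<And>k. k \<ge> 1 \<Longrightarrow> a (h * k) = l' * a k" using assms(2) unfolding good_def by blast
  have pow: "a (h ^ j) = l' ^ j * a 1" for j
  proof (induction j)
    case (Suc j)
    have "a (h ^ Suc j) = l' * a (h ^ j)" using l'[of "h ^ j"] assms(5) by (simp add: Suc_le_eq)
    then show ?case using Suc by simp
  qed simp
  have "a (h ^ totient q) = a 1"
    by (rule periodic_cong) (use assms euler_theorem[OF assms(3)] in \<open>auto simp: Suc_le_eq\<close>)
  then have "l' ^ totient q = 1" using pow[of "totient q"] a1 by simp
  moreover have "totient q \<noteq> 0" using q by simp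
  ultimately have l0: "l' \<noteq> 0" by (auto simp: power_0_left)
  have "a (m * k) = l / l' * a k" if "k \<ge> 1" for k
  proof -
    have "l * a k = l' * a (m * k)"
      using l[OF that] l'[of "m * k"] assms that by (simp add: mult.assoc mult.left_commute Suc_le_eq)
    then show ?thesis using l0 by (simp add: field_simps)
  qed
  then show ?thesis unfolding good_def by blast
qed

definition bad :: "nat set" where "bad = {p. prime p \<and> (p dvd q \<or> \<not> good p)}"

text \<open>A class prime to \<open>q\<close> with divergent reciprocal sum over its primes is good,
  so each of the finitely many other classes contributes a bounded amount. The primes dividing
  \<open>q\<close> lie in \<open>{1..q}\<close> and are covered by \<open>real q\<close>.\<close>

lemma bad_summable: "(\<lambda>n. if n \<in> bad then 1 / real n else 0) summable_on {1..}"
proof -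
  define S where "S c J = (\<Sum>p\<in>{p. prime p \<and> p \<le> J \<and> [p = c] (mod q)}. 1 / real p)" for c J :: nat
  have fin: "finite {p. prime p \<and> p \<le> J \<and> [p = c] (mod q)}" for c J :: nat
    by (rule finite_subset[of _ "{..J}"]) auto
  have Smono: "S c J \<le> S c J'" if "J \<le> J'" for c J J'
    unfolding S_def by (rule sum_mono2[OF fin]) (use that in auto)
  have "\<exists>B. \<forall>J. S c J \<le> B" if c: "c \<ge> 1" "coprime c q" "\<not> good c" for c
  proof (rule ccontr)
    assume "\<nexists>B. \<forall>J. S c J \<le> B"
    then have un: "\<exists>J. S c J > B" for B by (meson not_le)
    have "filterlim (S c) at_top sequentially"
      unfolding filterlim_at_top_dense
    proof
      fix Z :: real
      obtain J where J: "S c J > Z" using un by blast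
      have "S c k > Z" if "k \<ge> J" for k using J Smono[OF that, of c] by linarith
      then show "\<forall>\<^sub>F k in sequentially. Z < S c k" unfolding eventually_sequentially by blast
    qed
    then have "good c" unfolding good_def S_def[abs_def] by (rule divergent_class_good[OF c(1,2)])
    then show False using c by blast
  qed
  then have "\<forall>c. \<exists>B. c \<ge> 1 \<and> coprime c q \<and> \<not> good c \<longrightarrow> (\<forall>J. S c J \<le> B)" by blast
  then obtain B where B: "\<And>c J. c \<ge> 1 \<Longrightarrow> coprime c q \<Longrightarrow> \<not> good c \<Longrightarrow> S c J \<le> B c" by metis
  \<comment> \<open>Residues are taken in \<open>{1..q}\<close>, since periodicity is available only
    at positive arguments.\<close>
  define cl where "cl p = (p - 1) mod q + 1" for p :: nat
  have cl: "[p = cl p] (mod q)" "cl p \<in> {1..q}" if "p \<ge> 1" for p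
  proof -
    have "[(p - 1) + 1 = cl p] (mod q)" unfolding cl_def by (intro cong_add) (auto simp: cong_def)
    then show "[p = cl p] (mod q)" using that by simp
    show "cl p \<in> {1..q}" using q by (simp add: cl_def Suc_leI)
  qed
  let ?g = "\<lambda>n. if n \<in> bad then 1 / real n else 0 :: real"
  have "(\<Sum>n=1..J. ?g n) \<le> real q + (\<Sum>c=1..q. \<bar>B c\<bar>)" for J
  proof -
    let ?A = "{p\<in>{1..J}. prime p \<and> \<not> p dvd q \<and> \<not> good p}"
    have finA: "finite ?A" by simp
    have "(\<Sum>n=1..J. ?g n) = (\<Sum>n\<in>{p\<in>{1..J}. p \<in> bad}. 1 / real n)" by (rule sum.inter_filter[symmetric]) simp
    also have "\<dots> \<le> (\<Sum>n\<in>{1..q} \<union> ?A. 1 / real n)"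
      by (rule sum_mono2) (use q in \<open>auto simp: bad_def dest: dvd_imp_le\<close>)
    finally have 1: "(\<Sum>n=1..J. ?g n) \<le> (\<Sum>n\<in>{1..q} \<union> ?A. 1 / real n)" .
    have 2: "(\<Sum>n\<in>{1..q} \<union> ?A. 1 / real n) + (\<Sum>n\<in>{1..q} \<inter> ?A. 1 / real n) = (\<Sum>n\<in>{1..q}. 1 / real n) + (\<Sum>n\<in>?A. 1 / real n)"
      by (rule sum.union_inter) auto
    have 3: "(\<Sum>n\<in>{1..q} \<inter> ?A. 1 / real n) \<ge> 0" by (rule sum_nonneg) simp
    have "(\<Sum>n\<in>{1..q}. 1 / real n) \<le> (\<Sum>n\<in>{1..q}. 1)" by (rule sum_mono) simp
    then have 4: "(\<Sum>n\<in>{1..q}. 1 / real n) \<le> real q" by simp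
    have im: "cl ` ?A \<subseteq> {1..q}" by (rule image_subsetI, rule cl(2)) simp
    have 5: "(\<Sum>n\<in>?A. 1 / real n) = (\<Sum>c=1..q. \<Sum>n\<in>{x\<in>?A. cl x = c}. 1 / real n)"
      by (rule sum.group[OF finA finite_atLeastAtMost im, symmetric])
    have 6: "(\<Sum>c=1..q. \<Sum>n\<in>{x\<in>?A. cl x = c}. 1 / real n) \<le> (\<Sum>c=1..q. \<bar>B c\<bar>)"
    proof (rule sum_mono)
      fix c assume c: "c \<in> {1..q}"
      show "(\<Sum>n\<in>{x\<in>?A. cl x = c}. 1 / real n) \<le> \<bar>B c\<bar>"
      proof (cases "{x\<in>?A. cl x = c} = {}")
        case True
        then show ?thesis by (simp only: sum.empty abs_ge_zero)
      next
        case False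
        then obtain p where p: "p \<ge> 1" "prime p" "\<not> p dvd q" "\<not> good p" "cl p = c" by auto
        have pc: "[p = c] (mod q)" using cl(1)[OF p(1)] p(5) by simp
        have "coprime p q" using p by (simp add: prime_imp_coprime)
        then have cq: "coprime c q" using pc cong_imp_coprime[of p c q] by simp
        have "\<not> good c" using good_cong[OF pc p(1)] p c by simp
        have "(\<Sum>n\<in>{x\<in>?A. cl x = c}. 1 / real n) \<le> S c J" unfolding S_def
          by (rule sum_mono2[OF fin]) (use cl(1) in auto)
        also have "\<dots> \<le> B c" by (rule B) (use c cq \<open>\<not> good c\<close> in auto)
        finally show ?thesis by simp
      qed
    qed
    show ?thesis using 1 2 3 4 5 6 by linarith
  qed
  then show ?thesis by (intro nonneg_partial_sums_bounded(1)[where C = "real q + (\<Sum>c=1..q. \<bar>B c\<bar>)"]) auto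
qed

text \<open>Among the integers prime to \<open>q\<close> and to the bad primes up to \<open>M\<close>, at least three quarters (in the
  sense of reciprocal sums) are good, while the coset \<open>n0 * good\<close> has the same density and
  contains no good element.\<close>

lemma all_primes_good:
  assumes p0: "prime p0" "\<not> p0 dvd q"
  shows "good p0"
proof (rule ccontr)
  assume ng: "\<not> good p0"
  let ?g = "\<lambda>n. if n \<in> bad then 1 / real n else 0 :: real"
  \<comment> \<open>At least \<open>p0 + q\<close>, so that \<open>p0\<close> and all prime divisors
    of \<open>q\<close> fall into \<open>B\<close>. The bound 1/4 is counted twice in the final
    comparison and still leaves half of \<open>X\<close>.\<close>
  have "\<exists>N\<ge>p0 + q. infsum ?g {N<..} < 1/4" by (rule summable_tail_small[OF _ bad_summable]) auto
  then obtain M where M: "M \<ge> p0 + q" "infsum ?g {M<..} < 1/4" by blast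
  define B where "B = {p\<in>bad. p \<le> M}"
  have fB: "finite B" by (rule finite_subset[of _ "{..M}"]) (auto simp: B_def)
  have pB: "prime p" if "p \<in> B" for p using that by (simp add: B_def bad_def)
  have p0B: "p0 \<in> B" using p0 ng M by (simp add: B_def bad_def)
  define Q where "Q = q * \<Prod>B"
  have "0 \<notin> B" using pB[of 0] by auto
  then have "\<Prod>B \<noteq> 0" using fB by simp
  then have Q0: "Q > 0" using q by (simp add: Q_def)
  have cop: "coprime n Q \<longleftrightarrow> (\<forall>p\<in>B. \<not> p dvd n)" for n
  proof
    assume c: "coprime n Q"
    show "\<forall>p\<in>B. \<not> p dvd n"
    proof
      fix p assume p: "p \<in> B"
      have "p dvd Q" unfolding Q_def using dvd_prodI[OF fB p, of "\<lambda>x. x"] by simp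
      then show "\<not> p dvd n" using c pB[OF p] by (meson coprime_common_divisor not_prime_unit)
    qed
  next
    assume a: "\<forall>p\<in>B. \<not> p dvd n"
    show "coprime n Q"
    proof (rule ccontr)
      assume "\<not> coprime n Q"
      then have "gcd n Q \<noteq> 1" by (simp only: coprime_iff_gcd_eq_1 not_False_eq_True)
      then obtain p where p: "prime p" "p dvd n" "p dvd Q" using prime_factor_nat[of "gcd n Q"] by auto
      then have "p dvd q \<or> p dvd \<Prod>B" by (simp add: Q_def prime_dvd_mult_iff)
      then show False
      proof
        assume "p dvd q"
        then have "p \<in> B" using p M q by (auto simp: B_def bad_def dest: dvd_imp_le)
        then show False using a p by blast
      next
        assume "p dvd \<Prod>B"
        then obtain b where "b \<in> B" "p dvd b" using prime_dvd_prod_iff[OF fB p(1), of "\<lambda>x. x"] by auto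
        then have "p \<in> B" using primes_dvd_imp_eq[OF p(1) pB] by blast
        then show False using a p by blast
      qed
    qed
  qed
  \<comment> \<open>\<open>p0\<close> divides \<open>Q\<close>, so it is replaced by a congruent
    integer prime to \<open>Q\<close>: every other element of \<open>B\<close> divides the added
    product but not \<open>p0\<close>, and \<open>p0\<close> does not divide the product.\<close>
  define n0 where "n0 = p0 + q * \<Prod>{p\<in>B. \<not> p dvd q \<and> p \<noteq> p0}"
  have n01: "n0 \<ge> 1" using prime_ge_1_nat[OF p0(1)] by (simp add: n0_def)
  have n0q: "[n0 = p0] (mod q)" by (simp add: n0_def cong_def)
  have n0Q: "coprime n0 Q"
    unfolding cop
  proof
    fix p assume p: "p \<in> B"
    let ?C = "{p\<in>B. \<not> p dvd q \<and> p \<noteq> p0}"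
    have fC: "finite ?C" using fB by simp
    show "\<not> p dvd n0"
    proof (cases "p = p0")
      case True
      have "\<not> p0 dvd q * \<Prod>?C"
      proof
        assume "p0 dvd q * \<Prod>?C"
        then have "p0 dvd \<Prod>?C" using p0 by (simp add: prime_dvd_mult_iff)
        then obtain b where "b \<in> ?C" "p0 dvd b" using prime_dvd_prod_iff[OF fC p0(1), of "\<lambda>x. x"] by auto
        then show False using primes_dvd_imp_eq[OF p0(1) pB, of b] by auto
      qed
      then show ?thesis using True by (simp add: n0_def dvd_add_right_iff)
    next
      case False
      have "p dvd q * \<Prod>?C"
      proof (cases "p dvd q")
        case np: False
        then have "p \<in> ?C" using p False by simp
        then show ?thesis using dvd_prodI[OF fC, of p "\<lambda>x. x"] by simp
      qed simp
      moreover have "\<not> p dvd p0" using primes_dvd_imp_eq[OF pB[OF p] p0(1)] False by blast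
      ultimately show ?thesis by (simp add: n0_def dvd_add_left_iff)
    qed
  qed
  \<comment> \<open>Membership in the coset of \<open>n0\<close>, tested modulo \<open>q\<close>
    only and therefore periodic modulo \<open>Q\<close>. Cancelling \<open>h\<close> shows that a
    good element of the coset would make \<open>n0\<close>, and so \<open>p0\<close>, good.\<close>
  define good' where "good' x \<longleftrightarrow> (\<exists>h\<ge>1. coprime h q \<and> good h \<and> [x = n0 * h] (mod q))" for x
  have cQq: "coprime n q" if "coprime n Q" for n using that by (simp add: Q_def)
  have qQ: "q dvd Q" by (simp add: Q_def)
  have excl: "\<not> good x" if g': "good' x" and x1: "x \<ge> 1" for x
  proof
    assume gx: "good x"
    obtain h where "h \<ge> 1 \<and> coprime h q \<and> good h \<and> [x = n0 * h] (mod q)"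
      using g' unfolding good'_def by (rule exE)
    then have h: "h \<ge> 1" "coprime h q" "good h" "[x = n0 * h] (mod q)" by auto
    have "good (n0 * h)" using good_cong[OF h(4) x1] gx n01 h(1) by (simp add: Suc_le_eq)
    then have "good n0" by (rule good_cancel[OF _ h(3,2) n01 h(1)])
    then show False using good_cong[OF n0q n01 prime_ge_1_nat[OF p0(1)]] ng by simp
  qed
  define R1 where "R1 = {x\<in>{1..Q}. coprime x Q \<and> good x}"
  define R2 where "R2 = {x\<in>{1..Q}. coprime x Q \<and> good' x}"
  \<comment> \<open>Multiplication by \<open>n0\<close> is injective on residues prime to
    \<open>Q\<close> and maps good ones into the coset. Subtracting and adding 1 selects the
    representative in \<open>{1..Q}\<close>.\<close>
  have cardR: "card R1 \<le> card R2"
  proof (rule card_inj_on_le[where f = "\<lambda>x. (n0 * x - 1) mod Q + 1"])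
    have eqQ: "[(n0 * x - 1) mod Q + 1 = n0 * x] (mod Q)" if "x \<ge> 1" for x
    proof -
      have "[(n0 * x - 1) mod Q + 1 = (n0 * x - 1) + 1] (mod Q)" by (intro cong_add) (auto simp: cong_def)
      then show ?thesis using n01 that by (simp add: Suc_le_eq)
    qed
    show "inj_on (\<lambda>x. (n0 * x - 1) mod Q + 1) R1"
    proof (rule inj_onI)
      fix x y assume x: "x \<in> R1" and y: "y \<in> R1" and e: "(n0 * x - 1) mod Q + 1 = (n0 * y - 1) mod Q + 1"
      have x1: "x \<ge> 1" and y1: "y \<ge> 1" using x y by (auto simp: R1_def)
      have "[n0 * x = n0 * y] (mod Q)" by (rule cong_trans[OF cong_sym[OF eqQ[OF x1]] eqQ[OF y1, folded e]])
      then have "[x = y] (mod Q)" using n0Q by (simp add: cong_mult_lcancel_nat)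
      then have "[x - 1 + 1 = y - 1 + 1] (mod Q)" using x y by (simp add: R1_def)
      then have "[x - 1 = y - 1] (mod Q)" by (simp only: cong_add_rcancel_nat)
      then have "x - 1 = y - 1" using x y Q0 by (intro cong_less_modulus_unique_nat[of _ _ Q]) (auto simp: R1_def)
      then show "x = y" using x y by (auto simp: R1_def)
    qed
    show "(\<lambda>x. (n0 * x - 1) mod Q + 1) ` R1 \<subseteq> R2"
    proof (rule image_subsetI)
      fix x assume x: "x \<in> R1"
      then have x1: "x \<ge> 1" "coprime x Q" "good x" by (auto simp: R1_def)
      let ?y = "(n0 * x - 1) mod Q + 1"
      have "coprime (n0 * x) Q" using n0Q x1 by simp
      then have "coprime ?y Q" using cong_imp_coprime[OF cong_sym[OF eqQ[OF x1(1)]]] by blast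
      moreover have "[?y = n0 * x] (mod q)" using eqQ[OF x1(1)] qQ by (rule cong_dvd_modulus_nat)
      then have "good' ?y" unfolding good'_def using x1 cQq[OF x1(2)] by (intro exI[of _ x]) simp
      ultimately show "?y \<in> R2" using Q0 by (simp add: R2_def Suc_leI)
    qed
  qed (simp add: R2_def)
  have coper: "coprime (j * Q + x) Q \<longleftrightarrow> coprime x Q" for j x
  proof -
    have c: "[j * Q + x = x] (mod Q)" by (simp add: cong_def)
    show ?thesis using cong_imp_coprime[OF c] cong_imp_coprime[OF cong_sym[OF c]] by (rule iffI)
  qed
  have gper: "good (j * Q + x) \<longleftrightarrow> good x" if "x \<ge> 1" for j x
  proof (rule good_cong)
    show "[j * Q + x = x] (mod q)" by (rule cong_dvd_modulus_nat[OF _ qQ]) (simp add: cong_def)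
  qed (use that in auto)
  have g'per: "good' (j * Q + x) \<longleftrightarrow> good' x" for j x
  proof -
    have "[j * Q + x = x] (mod q)" by (rule cong_dvd_modulus_nat[OF _ qQ]) (simp add: cong_def)
    then show ?thesis unfolding good'_def cong_def by (simp only:)
  qed
  have main: "(\<Sum>j<J. 1 / real (j * Q + 1)) \<le> 2 * real Q" for J
  proof -
    define h where "h x = (\<Sum>j<J. 1 / real (j * Q + x))" for x
    define U where "U = {n\<in>{1..J * Q}. coprime n Q}"
    define V where "V = {n\<in>{1..J * Q}. coprime n Q \<and> good n}"
    define V' where "V' = {n\<in>{1..J * Q}. coprime n Q \<and> good' n}"
    define X where "X = (\<Sum>n\<in>U. 1 / real n)"
    have V: "(\<Sum>n\<in>V. 1 / real n) = (\<Sum>x\<in>R1. h x)" unfolding V_def R1_def h_def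
      by (rule sum_by_residues) (simp add: coper gper)
    have V': "(\<Sum>n\<in>V'. 1 / real n) = (\<Sum>x\<in>R2. h x)" unfolding V'_def R2_def h_def
      by (rule sum_by_residues) (simp add: coper g'per)
    have X: "X = (\<Sum>x\<in>{x\<in>{1..Q}. coprime x Q}. h x)" unfolding X_def U_def h_def
      by (rule sum_by_residues) (simp add: coper)
    have recip: "1 / real n \<le> 1 / real m" if "1 \<le> m" "m \<le> n" for m n :: nat
      using that by (intro frac_le) auto
    have h0: "h x \<ge> 0" for x unfolding h_def by (simp add: sum_nonneg)
    have hup: "h x \<le> h 1" if "x \<ge> 1" for x unfolding h_def
      by (rule sum_mono, rule recip) (use that in auto)
    \<comment> \<open>Moving the progression of 1 by one term bounds the progression of
      \<open>Q\<close> from below. Hence \<open>h x\<close> lies between \<open>h 1 - 1\<close> and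
      \<open>h 1\<close> for all residues, and numbers of residues can be converted into reciprocal
      sums.\<close>
    have tele: "(\<Sum>j<J'. 1 / real (j * Q + 1)) - 1 \<le> (\<Sum>j<J'. 1 / real (Suc j * Q)) - 1 / real (J' * Q + 1)" for J'
    proof (induction J')
      case (Suc k)
      have "1 / real (Suc k * Q + 1) \<le> 1 / real (Suc k * Q)" using Q0 by (intro recip) auto
      then show ?case using Suc by simp
    qed simp
    have hlow: "h 1 - 1 \<le> h x" if "x \<le> Q" "x \<ge> 1" for x
    proof -
      have "(\<Sum>j<J. 1 / real (Suc j * Q)) \<le> h x" unfolding h_def
        by (rule sum_mono, rule recip) (use that in auto)
      moreover have "1 / real (J * Q + 1) \<ge> 0" by simp
      ultimately show ?thesis using tele[of J] unfolding h_def by linarith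
    qed
    have "(\<Sum>x\<in>R1. h x) \<le> (\<Sum>x\<in>R1. h 1)" by (rule sum_mono, rule hup) (simp add: R1_def)
    also have "\<dots> \<le> real (card R2) * h 1" using cardR h0 by (simp add: mult_right_mono)
    also have "\<dots> = (\<Sum>x\<in>R2. (h 1 - 1)) + real (card R2)" by (simp add: algebra_simps)
    also have "(\<Sum>x\<in>R2. (h 1 - 1)) \<le> (\<Sum>x\<in>R2. h x)" by (rule sum_mono, rule hlow) (simp_all add: R2_def)
    also have "real (card R2) \<le> real Q" using card_mono[of "{1..Q}" R2] by (simp add: R2_def subset_eq)
    finally have VV: "(\<Sum>n\<in>V. 1 / real n) \<le> (\<Sum>n\<in>V'. 1 / real n) + real Q" unfolding V V' by simp
    have finU: "finite U" by (simp add: U_def)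
    \<comment> \<open>An element of \<open>U\<close> that is not good has a bad prime factor, which
      exceeds \<open>M\<close> because the smaller ones divide \<open>Q\<close>. Its cofactor is
      again in \<open>U\<close>, so the sum is at most a tail of the bad reciprocals times
      \<open>X\<close>.\<close>
    have notgood: "(\<Sum>n\<in>U - V. 1 / real n) \<le> 1/4 * X"
    proof -
      let ?P = "{p\<in>bad. M < p \<and> p \<le> J * Q}"
      have fP: "finite ?P" by (rule finite_subset[of _ "{..J * Q}"]) auto
      have sub: "U - V \<subseteq> (\<lambda>(p, m). p * m) ` (?P \<times> U)"
      proof
        fix n assume n: "n \<in> U - V"
        then have n1: "n \<ge> 1" "n \<le> J * Q" "coprime n Q" "\<not> good n" by (auto simp: U_def V_def)
        have "\<exists>p. prime p \<and> p dvd n \<and> \<not> good p"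
        proof (rule ccontr)
          assume no: "\<nexists>p. prime p \<and> p dvd n \<and> \<not> good p"
          have "k dvd n \<longrightarrow> good k" if "k \<ge> 1" for k
            using that
          proof (induction rule: prime_factor_induct)
            case (mult p m)
            then show ?case using no good_mult[of p m] by (meson dvd_mult_left dvd_mult_right)
          qed (use good_1 in simp)
          then show False using n1 by auto
        qed
        then obtain p where p: "prime p" "p dvd n" "\<not> good p" by blast
        have "p \<in> bad" using p by (simp add: bad_def)
        moreover have "M < p"
        proof (rule ccontr)
          assume "\<not> M < p"
          then have "p \<in> B" using \<open>p \<in> bad\<close> by (simp add: B_def)
          then show False using n1(3) p(2) cop by blast
        qed
        moreover have "p \<le> J * Q" using dvd_imp_le[OF p(2)] n1 by simp
        moreover obtain m where m: "n = p * m" using p(2) by blast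
        moreover have "m \<in> U"
        proof -
          have "m \<ge> 1" using m n1 by (cases m) auto
          moreover have "m \<le> n" using m prime_ge_1_nat[OF p(1)] by simp
          then have "m \<le> J * Q" using n1(2) by simp
          moreover have "coprime m Q" using n1(3) m by simp
          ultimately show ?thesis by (simp add: U_def)
        qed
        ultimately show "n \<in> (\<lambda>(p, m). p * m) ` (?P \<times> U)" by force
      qed
      have "(\<Sum>n\<in>U - V. 1 / real n) \<le> (\<Sum>n\<in>(\<lambda>(p, m). p * m) ` (?P \<times> U). 1 / real n)"
        by (rule sum_mono2) (use fP finU sub in auto)
      also have "\<dots> \<le> sum ((\<lambda>n. 1 / real n) \<circ> (\<lambda>(p, m). p * m)) (?P \<times> U)"
        by (rule sum_image_le) (use fP finU in auto)
      also have "\<dots> = (\<Sum>p\<in>?P. \<Sum>m\<in>U. 1 / real p * (1 / real m))"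
        by (simp add: sum.cartesian_product case_prod_unfold)
      also have "\<dots> = (\<Sum>p\<in>?P. 1 / real p) * X" unfolding X_def by (simp add: sum_product)
      also have "\<dots> \<le> 1/4 * X"
      proof (rule mult_right_mono)
        have "(\<Sum>p\<in>?P. 1 / real p) = (\<Sum>p\<in>?P. ?g p)" by (rule sum.cong) auto
        also have "\<dots> \<le> infsum ?g {M<..}"
          by (rule finite_sum_le_infsum[OF summable_on_subset_banach[OF bad_summable] fP]) auto
        finally show "(\<Sum>p\<in>?P. 1 / real p) \<le> 1/4" using M(2) by simp
        show "X \<ge> 0" unfolding X_def by (simp add: sum_nonneg)
      qed
      finally show ?thesis .
    qed
    \<comment> \<open>The coset lies in \<open>U - V\<close>, so \<open>X\<close> is at most two
      quarters of itself plus \<open>Q\<close>. This bound does not involve \<open>J\<close>,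
      although \<open>X\<close> dominates a harmonic progression.\<close>
    have "X = (\<Sum>n\<in>U - V. 1 / real n) + (\<Sum>n\<in>V. 1 / real n)"
      unfolding X_def by (rule sum.subset_diff) (auto simp: U_def V_def)
    moreover have "(\<Sum>n\<in>V'. 1 / real n) \<le> (\<Sum>n\<in>U - V. 1 / real n)"
      by (rule sum_mono2) (use excl in \<open>auto simp: U_def V_def V'_def\<close>)
    ultimately have "X \<le> 2 * real Q" using VV notgood by linarith
    moreover have "h 1 \<le> X" unfolding X by (rule member_le_sum) (use h0 Q0 in auto)
    ultimately show ?thesis unfolding h_def by simp
  qed
  have "summable (\<lambda>j. 1 / real (j * Q + 1))"
  proof (rule bounded_imp_summable[of _ "2 * real Q"])
    show "(\<Sum>j\<le>n. 1 / real (j * Q + 1)) \<le> 2 * real Q" for n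
      using main[of "Suc n"] by (simp only: lessThan_Suc_atMost)
  qed simp
  then have smm: "summable (\<lambda>j. real Q * (1 / real (j * Q + 1)))" by (rule summable_mult)
  have le: "norm (inverse (real (Suc j))) \<le> real Q * (1 / real (j * Q + 1))" for j
  proof -
    have "j * Q + 1 \<le> Suc j * Q" using Q0 by simp
    then have "real (j * Q + 1) \<le> real (Suc j) * real Q" by (metis of_nat_le_iff of_nat_mult)
    moreover have "real (j * Q + 1) > 0" "real (Suc j) * real Q > 0" using Q0 by (simp_all only: of_nat_0_less_iff mult_pos_pos)
    ultimately have "real Q / (real (Suc j) * real Q) \<le> real Q / real (j * Q + 1)"
      using Q0 by (intro divide_left_mono mult_pos_pos) auto
    moreover have "real Q / (real (Suc j) * real Q) = inverse (real (Suc j))" using Q0 by (simp add: divide_inverse)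
    ultimately show ?thesis by simp
  qed
  have "summable (\<lambda>j. inverse (real (Suc j)))" by (rule summable_comparison_test'[OF smm, of 0]) (rule le)
  then have "summable (\<lambda>j. inverse (real j))" by (subst (asm) summable_Suc_iff)
  then show False using not_summable_harmonic[where 'a = real] by simp
qed

end

section \<open>Cyclicity on the critical line and the main theorem\<close>

text \<open>Multiplication by \<open>1 - x * p powr (- s)\<close>, the reciprocal of an Euler
  factor, in terms of coefficients.\<close>

lemma dconv_one_minus_prime:
  fixes p :: nat
  assumes "n \<ge> 1" "p \<noteq> 1"
  shows "dconv (\<lambda>n. if n = 1 then 1 else if n = p then - x else 0) g n = g n - (if p dvd n then x * g (n div p) else 0)"
proof -
  let ?e = "\<lambda>n. if n = 1 then 1 else if n = p then - x else 0"
  have "dconv ?e g n = (\<Sum>d\<in>{d. d dvd n}. (if d = 1 then g n else 0) + (if d = p then - x * g (n div p) else 0))"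
    unfolding dconv_def by (rule sum.cong) (use assms(2) in auto)
  also have "\<dots> = g n + (if p dvd n then - x * g (n div p) else 0)"
    using assms(1) by (simp add: sum.distrib sum.delta)
  finally show ?thesis by simp
qed

context periodic_series
begin

lemma f_H2: "f \<in> H2"
proof -
  obtain B where B: "\<forall>n\<ge>1. cmod (a n) \<le> B" using a_bounded by (rule exE)
  have "(\<lambda>n. (cmod (f n))\<^sup>2) summable_on {1..}"
  proof (rule summable_on_comparison_test)
    show "(\<lambda>n. B\<^sup>2 * real n powr (- 2)) summable_on {1..}"
      by (intro summable_on_cmult_right powr_summable_on) simp
    fix n :: nat assume n: "n \<in> {1..}"
    have "cmod (f n) = cmod (a n) * real n powr (- Re \<alpha>)"
      unfolding f_def by (rule dirichlet_term_norm) (use n in simp)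
    also have "\<dots> \<le> B * real n powr (- 1)"
      using B n \<alpha> by (intro mult_mono powr_mono) (auto intro: order_trans[OF norm_ge_zero])
    finally have "(cmod (f n))\<^sup>2 \<le> (B * real n powr (- 1))\<^sup>2" by (rule power_mono) simp
    also have "\<dots> = B\<^sup>2 * real n powr (- 2)"
      unfolding power_mult_distrib power2_eq_square[of "real n powr (- 1)"] powr_add[symmetric] by simp
    finally show "(cmod (f n))\<^sup>2 \<le> B\<^sup>2 * real n powr (- 2)" .
  qed auto
  then show ?thesis by (simp add: H2_def)
qed

end

context nonvanishing_on_line
begin

text \<open>A prime above \<open>q\<close> does not divide \<open>q\<close>, hence is good, and
  \<open>f (p * m) = x * f m\<close> for a constant \<open>x\<close>. Multiplication by
  \<open>1 - x * p powr (- s)\<close> then deletes exactly the multiples of \<open>p\<close> and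
  leaves the condition at the other primes intact.\<close>

lemma remove_good_primes:
  assumes "finite A" "\<And>p. p \<in> A \<Longrightarrow> prime p \<and> p > q"
  shows "\<exists>l. l1 l \<and> (\<forall>n\<ge>1. dconv l f n = (if \<exists>p\<in>A. p dvd n then 0 else f n))"
  using assms
proof (induction A rule: finite_induct)
  case empty
  have "dconv dunit f n = f n" if "n \<ge> 1" for n
    using dconv_commute[OF that, of dunit f] dconv_dunit_right[OF that, of f] by simp
  then show ?case using dunit_facts(1) by (intro exI[of _ dunit]) auto
next
  case (insert p A)
  have "\<exists>l. l1 l \<and> (\<forall>n\<ge>1. dconv l f n = (if \<exists>p\<in>A. p dvd n then 0 else f n))"
    by (rule insert.IH) (use insert.prems in auto)
  then obtain l where l: "l1 l" "\<And>n. n \<ge> 1 \<Longrightarrow> dconv l f n = (if \<exists>p\<in>A. p dvd n then 0 else f n)" by (elim exE conjE) blast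
  have p: "prime p" "p > q" using insert.prems by auto
  have p1: "p \<ge> 1" "p \<noteq> 1" using prime_gt_1_nat[OF p(1)] by auto
  have "\<not> p dvd q" using p q by (auto dest: dvd_imp_le)
  then obtain c where c: "\<And>n. n \<ge> 1 \<Longrightarrow> a (p * n) = c * a n" using all_primes_good[OF p(1)] unfolding good_def by blast
  define x where "x = c / of_nat p powr \<alpha>"
  have fp: "f (p * m) = x * f m" if "m \<ge> 1" for m
    unfolding f_def x_def c[OF that] of_nat_powr_mult[OF p1(1) that] by simp
  define e where "e = (\<lambda>n. if n = 1 then 1 else if n = p then - x else 0)"
  have "l1 e" unfolding l1_def
    by (rule finite_nonzero_values_imp_summable_on) (rule finite_subset[of _ "{1, p}"], auto simp: e_def)
  then have "l1 (dconv e l)" using l(1) by (rule infsum_dconv(1))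
  moreover have "dconv (dconv e l) f n = (if \<exists>p'\<in>insert p A. p' dvd n then 0 else f n)" if n: "n \<ge> 1" for n
  proof -
    have eq: "dconv (dconv e l) f n = dconv l f n - (if p dvd n then x * dconv l f (n div p) else 0)"
      unfolding dconv_assoc[OF n] unfolding e_def by (rule dconv_one_minus_prime[OF n p1(2)])
    show ?thesis
    proof (cases "p dvd n")
      case False
      then show ?thesis unfolding eq using l(2)[OF n] by simp
    next
      case True
      then obtain m where m: "n = p * m" by blast
      have m1: "m \<ge> 1" using m n by (cases m) auto
      have nm: "n div p = m" using m p1 by simp
      have "p' dvd n \<longleftrightarrow> p' dvd m" if "p' \<in> A" for p'
      proof -
        have "prime p'" "p' \<noteq> p" using insert that by auto
        then show ?thesis unfolding m using p(1) by (auto simp: prime_dvd_mult_iff dest: primes_dvd_imp_eq)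
      qed
      then have "dconv l f n = x * dconv l f m" using l(2)[OF n] l(2)[OF m1] fp[OF m1] m by auto
      then show ?thesis unfolding eq nm using True by simp
    qed
  qed
  ultimately show ?case by blast
qed

text \<open>With the primes between \<open>q\<close> and \<open>N\<close> removed, the result agrees
  with the smooth part up to \<open>N\<close> and beyond it differs by at most
  \<open>cmod (f n)\<close>. The error is thus a tail of \<open>f\<close> in
  \<open>H2\<close>.\<close>

lemma remove_good_primes_approx:
  assumes "e > 0"
  shows "\<exists>l. l1 l \<and> dconv l f \<in> H2 \<and> h2_norm (\<lambda>n. dconv l f n - smooth_part q f n) < e"
proof -
  have fs: "(\<lambda>n. (cmod (f n))\<^sup>2) summable_on {1..}" using f_H2 by (simp add: H2_def)
  have e2: "(e/2)\<^sup>2 > 0" using assms by simp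
  obtain N where N: "infsum (\<lambda>n. (cmod (f n))\<^sup>2) {N<..} < (e/2)\<^sup>2"
    using summable_tail_small[OF _ fs e2, of 0] by auto
  let ?A = "{p. prime p \<and> p > q \<and> p \<le> N}"
  have fA: "finite ?A" by (rule finite_subset[of _ "{..N}"]) auto
  have "\<exists>l. l1 l \<and> (\<forall>n\<ge>1. dconv l f n = (if \<exists>p\<in>?A. p dvd n then 0 else f n))"
    by (rule remove_good_primes[OF fA]) auto
  then obtain l where l: "l1 l" "\<And>n. n \<ge> 1 \<Longrightarrow> dconv l f n = (if \<exists>p\<in>?A. p dvd n then 0 else f n)"
    by (elim exE conjE) blast
  have pt: "cmod (dconv l f n - smooth_part q f n) \<le> (if n > N then cmod (f n) else 0)" if n: "n \<ge> 1" for n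
  proof (cases "n > N")
    case True
    then show ?thesis unfolding l(2)[OF n] by (auto simp: smooth_part_def smooth_def)
  next
    case False
    have le: "p \<le> N" if "p dvd n" for p using dvd_imp_le[OF that] n False by simp
    have "(\<exists>p\<in>?A. p dvd n) \<longleftrightarrow> \<not> smooth q n"
      unfolding smooth_def using le by (auto simp: not_le)
    then show ?thesis unfolding l(2)[OF n] by (auto simp: smooth_part_def)
  qed
  have "(\<Sum>n=1..L. (cmod (dconv l f n - smooth_part q f n))\<^sup>2) \<le> (e/2)\<^sup>2" for L
  proof -
    have "(\<Sum>n=1..L. (cmod (dconv l f n - smooth_part q f n))\<^sup>2) \<le> (\<Sum>n=1..L. if n > N then (cmod (f n))\<^sup>2 else 0)"
    proof (rule sum_mono)
      fix n assume "n \<in> {1..L}"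
      then show "(cmod (dconv l f n - smooth_part q f n))\<^sup>2 \<le> (if n > N then (cmod (f n))\<^sup>2 else 0)"
        using pt[of n] by (auto intro: power_mono)
    qed
    also have "\<dots> = (\<Sum>n\<in>{n\<in>{1..L}. n > N}. (cmod (f n))\<^sup>2)" by (rule sum.inter_filter[symmetric]) simp
    also have "\<dots> \<le> infsum (\<lambda>n. (cmod (f n))\<^sup>2) {N<..}"
      by (rule finite_sum_le_infsum[OF summable_on_subset_banach[OF fs]]) auto
    finally show ?thesis using N by simp
  qed
  then have "h2_norm (\<lambda>n. dconv l f n - smooth_part q f n) \<le> e/2" by (rule H2_I(2)) (use assms in simp)
  then show ?thesis using l(1) dconv_l1_H2(1)[OF l(1) f_H2] assms by (intro exI[of _ l]) auto
qed

text \<open>The approximating multipliers are \<open>dconv (t k) (l k)\<close>: \<open>l k\<close>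
  carries \<open>f\<close> close to its smooth part \<open>g\<close>, and \<open>t k\<close>, a
  translate of the inverse of \<open>g\<close>, carries \<open>g\<close> towards
  \<open>dunit\<close>.\<close>

lemma cyclic_f: "cyclic_H2 f"
proof -
  define g where "g = smooth_part q f"
  obtain B where B: "\<forall>n\<ge>1. cmod (a n) \<le> B" using a_bounded by (rule exE)
  have B0: "B \<ge> 0" using B order_trans[OF norm_ge_zero[of "a 1"]] by auto
  \<comment> \<open>On smooth integers the coefficients weighted by \<open>n powr (1/2)\<close> are
    at most \<open>B * n powr (- (1/2))\<close>, and these are absolutely summable as monomials at a
    finitely supported point.\<close>
  have gd: "dabs g (- (1/2))" unfolding dabs_def
  proof (rule summable_on_comparison_test)
    have "l1 (cm (smooth_pt q (1/2)))" by (rule finsupp_l1[OF finsupp_smooth_pt]) simp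
    then show "(\<lambda>n. B * cmod (cm (smooth_pt q (1/2)) n)) summable_on {1..}"
      unfolding l1_def by (rule summable_on_cmult_right)
    fix n :: nat assume "n \<in> {1..}"
    then have n: "n \<ge> 1" by simp
    show "cmod (g n) * real n powr (- (- (1/2))) \<le> B * cmod (cm (smooth_pt q (1/2)) n)"
    proof (cases "smooth q n")
      case True
      have "cmod (g n) = cmod (a n) * real n powr (- 1)"
        using True dirichlet_term_norm[OF n, of a \<alpha>] \<alpha>1 by (simp add: g_def smooth_part_def f_def)
      moreover have "real n powr (- 1) * real n powr (- (- (1/2))) = real n powr (- (1/2))"
        unfolding powr_add[symmetric] by simp
      ultimately have "cmod (g n) * real n powr (- (- (1/2))) = cmod (a n) * real n powr (- (1/2))"
        by (simp only: mult.assoc)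
      also have "\<dots> \<le> B * real n powr (- (1/2))" using B n by (intro mult_right_mono) auto
      also have "real n powr (- (1/2)) = cmod (cm (smooth_pt q (1/2)) n)"
        unfolding cm_smooth_pt[OF n] using True dirichlet_term_norm[OF n, of "\<lambda>_. 1" "1/2"] by simp
      finally show ?thesis .
    qed (use B0 in \<open>simp add: g_def smooth_part_def\<close>)
  qed auto
  have g1: "g 1 \<noteq> 0" using a1 by (simp add: g_def smooth_part_def smooth_def f_def)
  have gnz: "dirichlet_eval g s \<noteq> 0" if "Re s > 0" for s
    using polydisc[OF finsupp_smooth_pt[OF that, of q]] unfolding infsum_smooth_pt g_def .
  have gd': "dabs g \<sigma>" if "\<sigma> > 0" for \<sigma> by (rule dabs_mono[OF gd]) (use that in simp)
  have gH: "g \<in> H2"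
  proof -
    have "(\<lambda>n. (cmod (g n))\<^sup>2) summable_on {1..}"
      by (rule summable_on_comparison_test[of "\<lambda>n. (cmod (f n))\<^sup>2"])
        (use f_H2 in \<open>auto simp: H2_def g_def smooth_part_def\<close>)
    then show ?thesis by (simp add: H2_def)
  qed
  obtain \<kappa> where b: "dabs (dinv g) \<kappa>" using dabs_dinv[OF gd g1] by blast
  have inv: "dconv g (dinv g) n = dunit n" if "n \<ge> 1" for n by (rule dconv_dinv) (use g1 that in auto)
  have bs: "dinv g n = 0" if "n \<ge> 1" "\<not> smooth q n" for n
  proof (rule dirichlet_inverse_support[OF inv g1, where P = "smooth q"])
    show "smooth q (m * n)" if "smooth q m" "smooth q n" for m n
      using that by (auto simp: smooth_def prime_dvd_mult_iff)
  qed (use that in \<open>auto simp: smooth_def g_def smooth_part_def\<close>)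
  define t where "t k = tw (of_real (1 / real (Suc k))) (dinv g)" for k
  \<comment> \<open>Half of the shift makes the inverse square summable. On smooth integers, where
    the inverse is supported, the other half is a square summable monomial, and Cauchy-Schwarz makes
    the product absolutely summable.\<close>
  have tl1: "l1 (t k)" for k
  proof -
    let ?d = "1 / real (Suc k) / 2"
    have d: "?d > 0" by simp
    have "tw (of_real ?d) (dinv g) \<in> Hinf" by (rule inverse_translate_Hinf[OF gd' g1 gnz d b inv])
    then have "tw (of_real ?d) (dinv g) \<in> H2" by (simp add: Hinf_def)
    moreover have "finsupp {p. prime p \<and> p \<le> q} (smooth_pt q (of_real ?d))" by (rule finsupp_smooth_pt) (use d in simp)
    ultimately have l: "l1 (\<lambda>n. tw (of_real ?d) (dinv g) n * cm (smooth_pt q (of_real ?d)) n)" by (rule l1_times_H2)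
    have tk: "t k n = tw (of_real ?d) (dinv g) n * cm (smooth_pt q (of_real ?d)) n" if n: "n \<ge> 1" for n
    proof (cases "smooth q n")
      case True
      have e: "of_real (1 / real (Suc k)) = (of_real ?d + of_real ?d :: complex)" by (simp only: of_real_add[symmetric] field_sum_of_halves)
      show ?thesis using True unfolding t_def tw_def cm_smooth_pt[OF n] e powr_add by simp
    qed (use n bs in \<open>simp add: t_def tw_def\<close>)
    show ?thesis by (rule iffD2[OF l1_cong l]) (rule tk)
  qed
  have half: "(1/2 :: real) > 0" by simp
  obtain C where C: "\<forall>\<delta>. 0 < \<delta> \<longrightarrow> \<delta> \<le> 1 \<longrightarrow> dconv (tw (of_real \<delta>) (dinv g)) g \<in> H2 \<and> h2_norm (dconv (tw (of_real \<delta>) (dinv g)) g) \<le> C"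
    using inverse_translate_norm[OF gd half g1 gnz b inv] by (rule exE)
  have tC: "dconv (t k) g \<in> H2" "h2_norm (dconv (t k) g) \<le> C" for k
    using C[rule_format, of "1 / real (Suc k)"] unfolding t_def by simp_all
  define K where "K k = infsum (\<lambda>n. cmod (t k n)) {1..}" for k
  have K0: "K k \<ge> 0" for k unfolding K_def by (rule infsum_nonneg) simp
  \<comment> \<open>\<open>K k\<close> is the \<open>l1\<close> norm of \<open>t k\<close>, known
    before \<open>l k\<close> is chosen. This tolerance leaves an error of at most
    \<open>1 / real (Suc k)\<close> after convolution with \<open>t k\<close>.\<close>
  have ex: "\<exists>l. l1 l \<and> dconv l f \<in> H2 \<and> h2_norm (\<lambda>n. dconv l f n - g n) < 1 / real (Suc k) / (K k + 1)" for k
    unfolding g_def by (rule remove_good_primes_approx) (use K0[of k] in simp)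
  obtain l where l': "\<forall>k. l1 (l k) \<and> dconv (l k) f \<in> H2 \<and> h2_norm (\<lambda>n. dconv (l k) f n - g n) < 1 / real (Suc k) / (K k + 1)"
    using choice[OF allI[OF ex]] by (rule exE)
  have l: "l1 (l k)" "dconv (l k) f \<in> H2" "h2_norm (\<lambda>n. dconv (l k) f n - g n) < 1 / real (Suc k) / (K k + 1)" for k
    using l'[rule_format, of k] by auto
  define v where "v k n = dconv (l k) f n - g n" for k n
  have v: "v k \<in> H2" for k unfolding v_def by (intro H2_diff l gH)
  have tv: "dconv (t k) (v k) \<in> H2" "h2_norm (dconv (t k) (v k)) \<le> 1 / real (Suc k)" for k
  proof -
    show "dconv (t k) (v k) \<in> H2" by (rule dconv_l1_H2(1)[OF tl1 v])
    have "h2_norm (dconv (t k) (v k)) \<le> K k * h2_norm (v k)" unfolding K_def by (rule dconv_l1_H2(2)[OF tl1 v])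
    also have "\<dots> \<le> K k * (1 / real (Suc k) / (K k + 1))"
      using l(3)[of k] K0[of k] unfolding v_def[abs_def] by (intro mult_left_mono) auto
    also have "\<dots> = 1 / real (Suc k) * (K k / (K k + 1))" by simp
    also have "\<dots> \<le> 1 / real (Suc k) * 1" using K0[of k] by (intro mult_left_mono) auto
    finally show "h2_norm (dconv (t k) (v k)) \<le> 1 / real (Suc k)" by simp
  qed
  have dec: "dconv (dconv (t k) (l k)) f n = dconv (t k) g n + dconv (t k) (v k) n" if n: "n \<ge> 1" for k n
  proof -
    have "dconv (t k) (v k) n = dconv (t k) (dconv (l k) f) n - dconv (t k) g n"
      unfolding v_def by (rule dconv_diff_right)
    then show ?thesis unfolding dconv_assoc[OF n] by simp
  qed
  have sH: "(\<lambda>n. dconv (t k) g n + dconv (t k) (v k) n) \<in> H2" for k by (intro H2_add tC tv)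
  show ?thesis
  proof (rule cyclic_if_approximate_unit[where h = "\<lambda>k. dconv (t k) (l k)" and C = "C + 1", OF f_H2])
    fix k
    show "dconv (t k) (l k) \<in> Hinf" by (intro l1_Hinf infsum_dconv tl1 l)
    show "dconv (dconv (t k) (l k)) f \<in> H2" by (rule iffD2[OF H2_cong(1) sH[of k]]) (rule dec)
    have "h2_norm (dconv (dconv (t k) (l k)) f) = h2_norm (\<lambda>n. dconv (t k) g n + dconv (t k) (v k) n)" by (rule H2_cong(2)) (rule dec)
    also have "\<dots> \<le> h2_norm (dconv (t k) g) + h2_norm (dconv (t k) (v k))" by (intro H2_add tC tv)
    also have "\<dots> \<le> C + 1 / real (Suc k)" by (intro add_mono tC tv)
    also have "\<dots> \<le> C + 1" by simp
    finally show "h2_norm (dconv (dconv (t k) (l k)) f) \<le> C + 1" .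
  next
    fix n :: nat assume n: "n \<ge> 1"
    have lim: "(\<lambda>k. 1 / real (Suc k)) \<longlonglongrightarrow> 0" by real_asymp
    have le: "cmod (dconv (t k) (v k) n) \<le> 1 / real (Suc k)" for k
      using h2_norm_coeff[OF tv(1) n, of k] tv(2)[of k] by linarith
    have 1: "(\<lambda>k. dconv (t k) (v k) n) \<longlonglongrightarrow> 0"
      by (rule Lim_null_comparison[OF always_eventually lim]) (intro allI le)
    have 2: "(\<lambda>k. dconv (t k) g n) \<longlonglongrightarrow> dunit n" unfolding t_def by (rule translate_coeff_tendsto[OF inv n])
    show "(\<lambda>k. dconv (dconv (t k) (l k)) f n) \<longlonglongrightarrow> dunit n"
      unfolding dec[OF n] using tendsto_add[OF 2 1] by simp
  qed
qed

end

theorem theorem1p2: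
  fixes a :: "nat \<Rightarrow> complex" and q :: nat and \<alpha> :: complex
  assumes "q > 0" and "\<forall>n\<ge>1. a (n + q) = a n"
    and "Re \<alpha> \<ge> 1"
  shows "cyclic_H2 (\<lambda>n. a n / (of_nat n) powr \<alpha>) \<longleftrightarrow>
           (a 1 \<noteq> 0 \<and> (\<forall>s. Re s > Re \<alpha> \<longrightarrow> dirichlet_eval a s \<noteq> 0))"
proof -
  interpret periodic_series a q \<alpha> by unfold_locales (use assms in auto)
  have f: "(\<lambda>n. a n / (of_nat n) powr \<alpha>) = f" by (simp add: f_def fun_eq_iff)
  have ev: "dirichlet_eval f s = dirichlet_eval a (s + \<alpha>)" for s
    using dirichlet_eval_of_tw[of \<alpha> a s] by (simp add: f_def[abs_def] tw_def[abs_def])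
  have pos: "dabs f \<sigma>" if "\<sigma> > 0" for \<sigma> by (rule dabs_f) (use that \<alpha> in simp)
  have nz: "(\<forall>s. Re s > Re \<alpha> \<longrightarrow> dirichlet_eval a s \<noteq> 0) \<longleftrightarrow> (\<forall>s. Re s > 0 \<longrightarrow> dirichlet_eval f s \<noteq> 0)"
  proof (intro iffI allI impI)
    fix s assume "\<forall>s. Re s > Re \<alpha> \<longrightarrow> dirichlet_eval a s \<noteq> 0" "Re s > 0"
    then show "dirichlet_eval f s \<noteq> 0" unfolding ev by simp
  next
    fix s assume h: "\<forall>s. Re s > 0 \<longrightarrow> dirichlet_eval f s \<noteq> 0" "Re s > Re \<alpha>"
    then have "dirichlet_eval f (s - \<alpha>) \<noteq> 0" by simp
    then show "dirichlet_eval a s \<noteq> 0" unfolding ev by simp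
  qed
  have f1: "f 1 \<noteq> 0 \<longleftrightarrow> a 1 \<noteq> 0" by (simp add: f_def)
  show ?thesis unfolding f nz f1[symmetric]
  proof
    assume "cyclic_H2 f"
    then show "f 1 \<noteq> 0 \<and> (\<forall>s. Re s > 0 \<longrightarrow> dirichlet_eval f s \<noteq> 0)"
      using cyclic_imp_nonvanishing[OF _ pos] by blast
  next
    assume h: "f 1 \<noteq> 0 \<and> (\<forall>s. Re s > 0 \<longrightarrow> dirichlet_eval f s \<noteq> 0)"
    show "cyclic_H2 f"
    proof (cases "Re \<alpha> = 1")
      case True
      interpret nonvanishing_on_line a q \<alpha> by unfold_locales (use True h f1 in auto)
      show ?thesis by (rule cyclic_f)
    next
      case False
      then have eta: "(Re \<alpha> - 1) / 2 > 0" using \<alpha> by simp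
      \<comment> \<open>Half of \<open>Re \<alpha> - 1\<close> stays strictly to the right of the
        abscissa \<open>1 - Re \<alpha>\<close> of absolute convergence and strictly to the left of
        0.\<close>
      have "dabs f (- ((Re \<alpha> - 1) / 2))" by (rule dabs_f) (use eta in \<open>simp add: field_simps\<close>)
      then show ?thesis by (rule cyclic_if_absolutely_convergent_beyond[OF _ eta _ f_H2]) (use h in auto)
    qed
  qed
qed

end
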